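(* Let $r$ and $s$ be fixed integers with $1 \leq s \leq r/2$, and let $H^r(n,p)$ be the random $r$-uniform hypergraph on $[n]$ (where $p=p(n)$). If $p(1-p)\gg \frac{\log^4 n }{n^{r-s}}$ and $1-p\gg \frac{\log n}{n^2}$, then almost surely $$\bar\lambda^{(s)}(H^r(n,p))\leq \frac{s}{n-s}+ \left(3+o(1)\right)\sqrt{\frac{1-p}{\binom{n-s}{r-s}p}}.$$ Moreover, for $1\leq k \leq \binom{n}{s}-1$, almost surely $$|\lambda_k^{(s)}(H^r(n,p))-\lambda_k^{(s)}(K^r_n)|\leq \left(3+o(1)\right)\sqrt{\frac{1-p}{\binom{n-s}{r-s}p}},$$ where $K^r_n$ is the complete $r$-uniform hypergraph on $[n]$.
   Context: For $0<p<1$, $H^r(n,p)$ is the random $r$-uniform hypergraph on $[n]=\{1,\dots,n\}$ in which each $r$-subset of $[n]$ is an edge independently with probability $p$. "Almost surely" means with probability tending to $1$ as $n\to\infty$; $f\gg g$ means $g=o(f)$. For an $r$-uniform hypergraph $H=(V,E)$ and $1\le s\le r/2$: $d_S$ is the number of edges containing $S\subseteq V$; the weighted graph $G^{(s)}$ on vertex set $\binom{V}{s}$ has weights $w(S,T)=d_{S\cup T}$ if $S\cap T=\emptyset$ and $0$ otherwise; with $W=(w(S,T))$, $D=\mathrm{diag}(d_S)$ and $T=\binom{r-s}{s}D$, the $s$-th Laplacian is $\mathcal{L}^{(s)}=I-T^{-1/2}WT^{-1/2}$. Its eigenvalues are listed in non-decreasing order as $\lambda^{(s)}_0\le\lambda^{(s)}_1\le\dots\le\lambda^{(s)}_{\binom{n}{s}-1}$,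 and $\bar\lambda^{(s)}(H)=\max_{i\neq 0}|1-\lambda^{(s)}_i|$. *)

theory Defs
  imports
    "HOL-Probability.Probability"
    "HOL-Library.Ramsey"
    "HOL-Library.Landau_Symbols"
    "Jordan_Normal_Form.Char_Poly"
begin

text \<open>
  A hypergraph is given by a finite vertex set \<open>V\<close> and a set \<open>E\<close> of edges. The set of
  \<open>s\<close>-element subsets of \<open>V\<close> is \<open>nsets V s\<close>.
\<close>

definition hdegree :: "'a set set \<Rightarrow> 'a set \<Rightarrow> nat" where
  "hdegree E S = card {e \<in> E. S \<subseteq> e}"

definition weight :: "'a set set \<Rightarrow> 'a set \<Rightarrow> 'a set \<Rightarrow> real" where
  "weight E S T = (if S \<inter> T = {} then real (hdegree E (S \<union> T)) else 0)"

text \<open>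
  The matrix with rows and columns indexed by the \<open>s\<close>-subsets of \<open>V\<close>. For finite \<open>V\<close>,
  \<open>from_nat_into (nsets V s)\<close> enumerates them bijectively by \<open>{..<card (nsets V s)}\<close>; the
  spectrum does not depend on the enumeration.
\<close>

definition subset_mat :: "'a set \<Rightarrow> nat \<Rightarrow> ('a set \<Rightarrow> 'a set \<Rightarrow> real) \<Rightarrow> real mat" where
  "subset_mat V s f =
     Matrix.mat (card (nsets V s)) (card (nsets V s))
       (\<lambda>(i, j). f (from_nat_into (nsets V s) i) (from_nat_into (nsets V s) j))"

text \<open>
  \<open>T powr (-1/2)\<close> for the diagonal matrix \<open>T\<close> with entries \<open>(r - s choose s) * d\<^sub>S\<close>. Since
  \<open>1 / 0 = 0\<close>, entries belonging to sets of degree \<open>0\<close> are \<open>0\<close>, as usual for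
  normalized Laplacians.
\<close>

definition inv_sqrt_T :: "'a set \<Rightarrow> nat \<Rightarrow> nat \<Rightarrow> 'a set set \<Rightarrow> real mat" where
  "inv_sqrt_T V r s E =
     subset_mat V s
       (\<lambda>S S'. if S = S' then 1 / sqrt (real ((r - s) choose s) * real (hdegree E S)) else 0)"

definition laplacian :: "'a set \<Rightarrow> nat \<Rightarrow> nat \<Rightarrow> 'a set set \<Rightarrow> real mat" where
  "laplacian V r s E =
     1\<^sub>m (card (nsets V s)) - inv_sqrt_T V r s E * subset_mat V s (weight E) * inv_sqrt_T V r s E"

text \<open>
  The Laplacian is real symmetric, so its characteristic polynomial splits over the reals and the
  list below has length \<open>card (nsets V s)\<close>, each eigenvalue occurring with its multiplicity.
\<close>

definition laplacian_eigenvalue :: "'a set \<Rightarrow> nat \<Rightarrow> nat \<Rightarrow> 'a set set \<Rightarrow> nat \<Rightarrow> real" where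
  "laplacian_eigenvalue V r s E k =
     sorted_list_of_multiset (proots (char_poly (laplacian V r s E))) ! k"

definition lambda_bar :: "'a set \<Rightarrow> nat \<Rightarrow> nat \<Rightarrow> 'a set set \<Rightarrow> real" where
  "lambda_bar V r s E =
     Max ((\<lambda>i. \<bar>1 - laplacian_eigenvalue V r s E i\<bar>) ` {1..card (nsets V s) - 1})"

definition random_hypergraph :: "nat \<Rightarrow> nat \<Rightarrow> real \<Rightarrow> nat set set pmf" where
  "random_hypergraph r n p =
     map_pmf (\<lambda>f. {e \<in> nsets {1..n} r. f e})
       (Pi_pmf (nsets {1..n} r) False (\<lambda>_. bernoulli_pmf p))"

end

theory Submission
  imports
    Defs
    "HOL-Real_Asymp.Real_Asymp"
begin

text \<open>
  Write \<open>W = p W\<^sub>K + M\<close>, where \<open>W\<^sub>K\<close> is the weight matrix of the complete hypergraph and \<open>M\<close> has mean zero,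
  and put \<open>C = (r - s choose s)\<close>, \<open>d = (n - s choose r - s) p\<close>, \<open>\<sigma>\<^sup>2 = d (1 - p)\<close>, so that the error term of
  the theorem is \<open>3 \<sigma> / d\<close>.

  The norm of \<open>M\<close> is at most \<open>(2 + o(1)) C \<sigma>\<close> by the trace method: \<open>E tr M\<^sup>L\<close> with \<open>L\<close> of order \<open>log n\<close> is a sum
  over closed walks in which every edge is used at least twice. Extend a walk step by step. An edge is
  either new (weight \<open>\<sigma>\<^sup>2\<close>, shared evenly with the step that uses it for the second time), or closes
  an edge used exactly once, or is used for at least the third time. The number of open edges
  that could be closed from the current position exceeds one only if the walk has previously run into old
  vertices or used an edge for the third time, and both are so unlikely that a potential
  function pays for the choice. Hence each step multiplies the total weight by at most \<open>(2 + o(1)) C \<sigma>\<close>.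

  The degrees satisfy \<open>d\<^sub>S = (1 + O(\<sigma> log n / d)) d\<close> by an exponential moment bound. The form of the
  Laplacian in the coordinates \<open>z = T powr (-1/2) y\<close> is invariant under adding constants to \<open>z\<close>, therefore the
  degrees influence the eigenvalues other than \<open>\<lambda>\<^sub>0\<close> only to second order, and the minimax principle
  compares them with the spectrum of the complete hypergraph, that is, of the Kneser graph.
\<close>


subsection \<open>Real symmetric matrices indexed by a finite set\<close>

text \<open>The obstacle is the scale of the degree fluctuations. Their relative size
  \<open>\<tau>\<close> is controlled only up to order \<open>\<sigma> log n / d\<close>, a factor
  log n above the admissible error, so a contribution linear in \<open>\<tau>\<close> with a
  constant coefficient would be fatal. After the cancellation the linear term survives only with the
  factor \<open>s / (n - s)\<close>, the bound for \<open>\<bar>1 - \<lambda>\<bar>\<close> on the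
  complete hypergraph away from \<open>\<lambda>\<^sub>0\<close>, and \<open>\<tau>\<^sup>2\<close>
  is small against \<open>\<sigma> / d\<close> once \<open>\<sigma>\<close> exceeds a large multiple
  of log^2 n. This is what the log^4 n in the hypothesis provides; it also makes the steps that use
  an edge for at least the third time, of total weight \<open>L\<^sup>2\<close>, negligible against
  \<open>\<sigma>\<close>. The length \<open>L\<close> must be of order log n because the number of
  starting sets is polynomial in n and has to be beaten by a constant to the power \<open>L\<close>.
  Numerically, 2 + o(1) becomes 11/5, Markov's inequality is applied at 29/10, and the remaining
  1/10 of \<open>\<sigma> / d\<close> pays for the degrees.\<close>

lemma homogeneous_system_nontrivial:
  fixes a :: "'b \<Rightarrow> nat \<Rightarrow> real"
  assumes "finite J" "m < card J"
  shows "\<exists>c. (\<exists>i\<in>J. c i \<noteq> 0) \<and> (\<forall>j<m. (\<Sum>i\<in>J. c i * a i j) = 0)"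
  using assms
proof (induction m arbitrary: J a)
  case 0
  then have "J \<noteq> {}" by auto
  then show ?case by (intro exI[of _ "\<lambda>_. 1"]) auto
next
  case (Suc m)
  show ?case
  proof (cases "\<forall>i\<in>J. a i m = 0")
    case True
    from Suc.IH[of J a] Suc.prems obtain c where "\<exists>i\<in>J. c i \<noteq> 0" "\<forall>j<m. (\<Sum>i\<in>J. c i * a i j) = 0"
      by auto
    with True show ?thesis by (intro exI[of _ c]) (auto simp: less_Suc_eq)
  next
    case False
    then obtain i0 where i0: "i0 \<in> J" "a i0 m \<noteq> 0" by auto
    \<comment> \<open>Gaussian elimination with pivot \<open>a i0 m\<close>: the last equation
      expresses the unknown at \<open>i0\<close> through the others, which leaves \<open>m\<close>
      equations in \<open>card J - 1\<close> unknowns.\<close>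
    define J' where "J' = J - {i0}"
    have J': "finite J'" "m < card J'" using Suc.prems i0 by (auto simp: J'_def)
    from Suc.IH[OF J', of "\<lambda>i j. a i j - a i m / a i0 m * a i0 j"] obtain c' where
      c': "\<exists>i\<in>J'. c' i \<noteq> 0" "\<forall>j<m. (\<Sum>i\<in>J'. c' i * (a i j - a i m / a i0 m * a i0 j)) = 0" by auto
    define c where "c = (\<lambda>i. if i = i0 then - (\<Sum>i\<in>J'. c' i * a i m) / a i0 m else c' i)"
    have split: "(\<Sum>i\<in>J. c i * a i j) = c i0 * a i0 j + (\<Sum>i\<in>J'. c' i * a i j)" for j
    proof -
      have "(\<Sum>i\<in>J. c i * a i j) = c i0 * a i0 j + (\<Sum>i\<in>J'. c i * a i j)"
        using Suc.prems i0 by (simp add: J'_def sum.remove)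
      also have "(\<Sum>i\<in>J'. c i * a i j) = (\<Sum>i\<in>J'. c' i * a i j)"
        by (intro sum.cong) (auto simp: J'_def c_def)
      finally show ?thesis .
    qed
    have "(\<Sum>i\<in>J. c i * a i j) = 0" if "j < Suc m" for j
    proof (cases "j = m")
      case True
      then show ?thesis using i0 by (simp add: split) (simp add: c_def)
    next
      case False
      then have "j < m" using that by auto
      then have "(\<Sum>i\<in>J'. c' i * (a i j - a i m / a i0 m * a i0 j)) = 0" using c' by auto
      moreover have "(\<Sum>i\<in>J'. c' i * (a i j - a i m / a i0 m * a i0 j)) =
        (\<Sum>i\<in>J'. c' i * a i j) - (\<Sum>i\<in>J'. c' i * a i m) / a i0 m * a i0 j"
        by (simp add: algebra_simps sum_subtractf sum_distrib_left sum_divide_distrib)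
      ultimately show ?thesis by (simp add: split) (simp add: c_def)
    qed
    moreover have "\<exists>i\<in>J. c i \<noteq> 0" using c' by (auto simp: c_def J'_def)
    ultimately show ?thesis by blast
  qed
qed

text \<open>Underdetermined systems stand in for dimensions of subspaces: the count supplies nonzero
  vectors of a span in an orthogonal complement, and a linear dependence among
  \<open>card I + 1\<close> functions on \<open>I\<close>.\<close>

lemma homogeneous_system_nontrivial_set:
  fixes a :: "'b \<Rightarrow> 'c \<Rightarrow> real"
  assumes "finite J" "finite K" "card K < card J"
  obtains c where "\<exists>i\<in>J. c i \<noteq> 0" "\<And>j. j \<in> K \<Longrightarrow> (\<Sum>i\<in>J. c i * a i j) = 0"
proof -
  obtain g where g: "bij_betw g {..<card K} K"
    using ex_bij_betw_nat_finite[OF assms(2)] by (auto simp: lessThan_atLeast0)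
  obtain c where c: "\<exists>i\<in>J. c i \<noteq> 0" "\<forall>j<card K. (\<Sum>i\<in>J. c i * a i (g j)) = 0"
    using homogeneous_system_nontrivial[OF assms(1,3), of "\<lambda>i j. a i (g j)"] by blast
  have "(\<Sum>i\<in>J. c i * a i j) = 0" if "j \<in> K" for j
  proof -
    from g that obtain j' where "j' < card K" "j = g j'" by (auto simp: bij_betw_def)
    then show ?thesis using c by simp
  qed
  with c(1) show ?thesis using that by blast
qed

text \<open>Vectors are total functions of which only the values on \<open>I\<close> count;
  \<open>ip I x x = 0\<close> means vanishing on \<open>I\<close>.\<close>

definition ip :: "'a set \<Rightarrow> ('a \<Rightarrow> real) \<Rightarrow> ('a \<Rightarrow> real) \<Rightarrow> real" where
  "ip I x y = (\<Sum>S\<in>I. x S * y S)"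

definition mv :: "'a set \<Rightarrow> ('a \<Rightarrow> 'a \<Rightarrow> real) \<Rightarrow> ('a \<Rightarrow> real) \<Rightarrow> 'a \<Rightarrow> real" where
  "mv I A x S = (\<Sum>T\<in>I. A S T * x T)"

definition symm :: "'a set \<Rightarrow> ('a \<Rightarrow> 'a \<Rightarrow> real) \<Rightarrow> bool" where
  "symm I A \<longleftrightarrow> (\<forall>S\<in>I. \<forall>T\<in>I. A S T = A T S)"

lemma ip_commute: "ip I x y = ip I y x"
  by (simp add: ip_def mult.commute)

lemma ip_add_left: "ip I (\<lambda>S. x S + y S) z = ip I x z + ip I y z"
  by (simp add: ip_def algebra_simps sum.distrib)

lemma ip_diff_left: "ip I (\<lambda>S. x S - y S) z = ip I x z - ip I y z"
  by (simp add: ip_def algebra_simps sum_subtractf)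

lemma ip_scale_left: "ip I (\<lambda>S. c * x S) z = c * ip I x z"
  by (simp add: ip_def algebra_simps sum_distrib_left)

lemma ip_add_right: "ip I z (\<lambda>S. x S + y S) = ip I z x + ip I z y"
  by (simp add: ip_def algebra_simps sum.distrib)

lemma ip_diff_right: "ip I z (\<lambda>S. x S - y S) = ip I z x - ip I z y"
  by (simp add: ip_def algebra_simps sum_subtractf)

lemma ip_scale_right: "ip I z (\<lambda>S. c * x S) = c * ip I z x"
  by (simp add: ip_def algebra_simps sum_distrib_left)

lemma ip_sum_left: "ip I (\<lambda>S. \<Sum>i\<in>J. f i S) z = (\<Sum>i\<in>J. ip I (f i) z)"
  unfolding ip_def by (simp add: sum_distrib_right) (rule sum.swap)

lemma ip_sum_right: "ip I z (\<lambda>S. \<Sum>i\<in>J. f i S) = (\<Sum>i\<in>J. ip I z (f i))"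
  by (subst ip_commute) (simp add: ip_sum_left ip_commute)

lemma ip_cong: "(\<And>S. S \<in> I \<Longrightarrow> x S = x' S) \<Longrightarrow> (\<And>S. S \<in> I \<Longrightarrow> y S = y' S) \<Longrightarrow> ip I x y = ip I x' y'"
  unfolding ip_def by (intro sum.cong) auto

lemma ip_self_nonneg: "ip I x x \<ge> 0"
  by (simp add: ip_def sum_nonneg)

lemma ip_self_eq_0_iff: "finite I \<Longrightarrow> ip I x x = 0 \<longleftrightarrow> (\<forall>S\<in>I. x S = 0)"
  by (simp add: ip_def sum_nonneg_eq_0_iff)

lemma mv_add: "mv I A (\<lambda>S. x S + y S) = (\<lambda>S. mv I A x S + mv I A y S)"
  by (simp add: mv_def fun_eq_iff algebra_simps sum.distrib)

lemma mv_scale: "mv I A (\<lambda>S. c * x S) = (\<lambda>S. c * mv I A x S)"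
  by (simp add: mv_def fun_eq_iff algebra_simps sum_distrib_left)

lemma mv_sum: "mv I A (\<lambda>S. \<Sum>i\<in>J. f i S) = (\<lambda>S. \<Sum>i\<in>J. mv I A (f i) S)"
  unfolding mv_def by (rule ext) (simp add: sum_distrib_left, rule sum.swap)

lemma mv_cong: "(\<And>S. S \<in> I \<Longrightarrow> x S = y S) \<Longrightarrow> mv I A x = mv I A y"
  unfolding mv_def by (rule ext, intro sum.cong) auto

lemma ip_mv_symm:
  assumes "symm I A"
  shows "ip I x (mv I A y) = ip I (mv I A x) y"
proof -
  have "ip I x (mv I A y) = (\<Sum>S\<in>I. \<Sum>T\<in>I. x S * A S T * y T)"
    by (simp add: ip_def mv_def sum_distrib_left mult.assoc)
  also have "\<dots> = (\<Sum>T\<in>I. \<Sum>S\<in>I. x S * A S T * y T)" by (rule sum.swap)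
  also have "\<dots> = (\<Sum>T\<in>I. \<Sum>S\<in>I. A T S * x S * y T)"
    using assms by (intro sum.cong) (auto simp: symm_def)
  also have "\<dots> = ip I (mv I A x) y"
    by (simp add: ip_def mv_def sum_distrib_right)
  finally show ?thesis .
qed

section \<open>Spectral theorem by successive maximisation of the Rayleigh quotient\<close>

lemma rayleigh_maximizer:
  fixes A :: "'a \<Rightarrow> 'a \<Rightarrow> real" and u :: "nat \<Rightarrow> 'a \<Rightarrow> real"
  assumes fin: "finite I" and m: "m < card I"
  obtains v where "ip I v v = 1" "\<And>i. i < m \<Longrightarrow> ip I v (u i) = 0"
    "\<And>x. (\<And>i. i < m \<Longrightarrow> ip I x (u i) = 0) \<Longrightarrow> ip I x (mv I A x) \<le> ip I v (mv I A v) * ip I x x"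
proof -
  \<comment> \<open>Pinning the coordinates outside \<open>I\<close> to 0 makes \<open>B\<close> a
    product of compact sets, hence compact by Tychonoff even over an infinite index type.\<close>
  define B where "B = PiE UNIV (\<lambda>S::'a. if S \<in> I then {-1..1::real} else {0})"
  define X where "X = {x \<in> B. ip I x x = 1 \<and> (\<forall>i<m. ip I x (u i) = 0)}"
  have "compactin (product_topology (\<lambda>_. euclidean) UNIV) B"
    unfolding B_def compactin_PiE by (intro disjI2 ballI) auto
  then have B: "compact B" by (simp add: euclidean_product_topology)
  have cont_coord: "continuous_on UNIV (\<lambda>x::'a \<Rightarrow> real. x S)" for S
    by (rule continuous_on_product_coordinates)
  have cont_ip: "continuous_on UNIV (\<lambda>x. ip I x y)" for y
    unfolding ip_def by (intro continuous_intros cont_coord)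
  have cont_ip2: "continuous_on UNIV (\<lambda>x. ip I x x)"
    unfolding ip_def by (intro continuous_intros cont_coord)
  have cont_q: "continuous_on UNIV (\<lambda>x. ip I x (mv I A x))"
    unfolding ip_def mv_def by (intro continuous_intros cont_coord)
  have "X = B \<inter> ({x. ip I x x = 1} \<inter> (\<Inter>i\<in>{..<m}. {x. ip I x (u i) = 0}))"
    by (auto simp: X_def)
  moreover have "closed ({x. ip I x x = 1} \<inter> (\<Inter>i\<in>{..<m}. {x. ip I x (u i) = 0}))"
    by (intro closed_Int closed_INT ballI closed_Collect_eq cont_ip cont_ip2 continuous_on_const)
  ultimately have X: "compact X" using B by (simp add: compact_Int_closed)
  \<comment> \<open>The form and the squared norm are both homogeneous of degree two, so the maximum
    over the unit vectors in \<open>X\<close> controls every \<open>x\<close> orthogonal to the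
    \<open>u i\<close>.\<close>
  have normalise: "(\<lambda>S. if S \<in> I then x S / sqrt (ip I x x) else 0) \<in> X \<and>
      ip I x (mv I A x) = ip I x x * ip I (\<lambda>S. if S \<in> I then x S / sqrt (ip I x x) else 0)
        (mv I A (\<lambda>S. if S \<in> I then x S / sqrt (ip I x x) else 0))"
    if x: "\<And>i. i < m \<Longrightarrow> ip I x (u i) = 0" "ip I x x \<noteq> 0" for x
  proof -
    define c where "c = 1 / sqrt (ip I x x)"
    define y where "y = (\<lambda>S. if S \<in> I then x S / sqrt (ip I x x) else 0)"
    have pos: "ip I x x > 0" using x(2) ip_self_nonneg[of I x] by linarith
    have y: "ip I y z = c * ip I x z" for z
      unfolding ip_scale_left[symmetric] by (rule ip_cong) (auto simp: y_def c_def)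
    have "mv I A y = mv I A (\<lambda>S. c * x S)" by (rule mv_cong) (auto simp: y_def c_def)
    then have Ay: "mv I A y = (\<lambda>S. c * mv I A x S)" by (simp add: mv_scale)
    have cc: "c * c * ip I x x = 1" using pos by (simp add: c_def)
    have yy: "ip I y y = 1" using cc by (simp add: y ip_commute[of I x y])
    have "y \<in> B"
    proof -
      have "\<bar>y S\<bar> \<le> 1" if "S \<in> I" for S
      proof -
        have "y S * y S \<le> ip I y y" unfolding ip_def
          using that fin by (intro member_le_sum[of S I "\<lambda>S. y S * y S"]) auto
        then have "(y S)\<^sup>2 \<le> 1" by (simp add: yy power2_eq_square)
        then show ?thesis by (simp add: abs_square_le_1)
      qed
      then have "y S \<in> (if S \<in> I then {-1..1} else {0})" for S
        using abs_le_iff[of "y S" 1] by (cases "S \<in> I") (force, simp add: y_def)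
      then show ?thesis unfolding B_def by (rule PiE_I) simp
    qed
    moreover have "ip I x (mv I A x) = ip I x x * ip I y (mv I A y)"
      using cc by (simp add: Ay y ip_scale_right) (metis mult.commute mult.left_commute mult.right_neutral)
    ultimately show ?thesis unfolding y_def[symmetric] using x yy y by (auto simp: X_def)
  qed
  obtain c where c: "\<exists>S\<in>I. c S \<noteq> 0" "\<forall>j<m. (\<Sum>S\<in>I. c S * u j S) = 0"
    using homogeneous_system_nontrivial[OF fin m, of "\<lambda>S j. u j S"] by auto
  have "X \<noteq> {}"
    using normalise[of c] c ip_self_eq_0_iff[OF fin, of c] by (auto simp: ip_def)
  then obtain v where v: "v \<in> X" "\<forall>x\<in>X. ip I x (mv I A x) \<le> ip I v (mv I A v)"
    using continuous_attains_sup[OF X, of "\<lambda>x. ip I x (mv I A x)"] continuous_on_subset[OF cont_q]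
    by blast
  show ?thesis
  proof (rule that[of v])
    fix x assume x: "\<And>i. i < m \<Longrightarrow> ip I x (u i) = 0"
    show "ip I x (mv I A x) \<le> ip I v (mv I A v) * ip I x x"
    proof (cases "ip I x x = 0")
      case True
      then have "ip I x (mv I A x) = 0"
        using fin by (simp add: ip_self_eq_0_iff) (simp add: ip_def)
      with True show ?thesis by simp
    next
      case False
      define y where "y = (\<lambda>S. if S \<in> I then x S / sqrt (ip I x x) else 0)"
      have y: "y \<in> X" "ip I x (mv I A x) = ip I x x * ip I y (mv I A y)"
        unfolding y_def using normalise[OF x False] by blast+
      have "ip I x x * ip I y (mv I A y) \<le> ip I x x * ip I v (mv I A v)"
        using v(2) y(1) ip_self_nonneg[of I x] by (intro mult_left_mono) auto
      then show ?thesis unfolding y(2) by (simp only: mult.commute)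
    qed
  qed (use v in \<open>auto simp: X_def\<close>)
qed

text \<open>For small \<open>t\<close> the linear term dominates. This is the first-order condition
  at a maximum, obtained without differentiation.\<close>

lemma quadratic_nonpos_imp_linear_zero:
  fixes a b :: real
  assumes "\<And>t. 2 * t * a + t\<^sup>2 * b \<le> 0"
  shows "a = 0"
proof (rule ccontr)
  assume a: "a \<noteq> 0"
  define t where "t = a / (\<bar>b\<bar> + 1)"
  have "t\<^sup>2 * b \<ge> - t\<^sup>2 * \<bar>b\<bar>" by (smt (verit, ccfv_SIG) mult_left_mono mult_minus_left mult_minus_right zero_le_power2)
  moreover have "2 * t * a = 2 * (t\<^sup>2 * \<bar>b\<bar>) + 2 * t\<^sup>2"
  proof -
    have "a = t * (\<bar>b\<bar> + 1)" by (simp add: t_def)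
    then show ?thesis by (simp add: algebra_simps power2_eq_square)
  qed
  moreover have "t\<^sup>2 > 0" using a by (simp add: t_def add_nonneg_eq_0_iff)
  moreover have "t\<^sup>2 * \<bar>b\<bar> \<ge> 0" by simp
  ultimately show False using assms[of t] by linarith
qed

text \<open>A maximiser \<open>v\<close> of the Rayleigh quotient on the complement of the
  \<open>u i\<close> is an eigenvector: the residual \<open>w\<close> is itself orthogonal to every
  \<open>u i\<close>, so \<open>v + t w\<close> is admissible for all \<open>t\<close>, and the
  first-order term of the comparison is \<open>2 * t * ip I w w\<close>, which must vanish.\<close>

lemma next_eigenvector:
  fixes A :: "'a \<Rightarrow> 'a \<Rightarrow> real" and u :: "nat \<Rightarrow> 'a \<Rightarrow> real"
  assumes fin: "finite I" and m: "m < card I" and sym: "symm I A"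
    and eig: "\<And>i S. i < m \<Longrightarrow> S \<in> I \<Longrightarrow> mv I A (u i) S = l i * u i S"
  obtains v \<mu> where "ip I v v = 1" "\<And>i. i < m \<Longrightarrow> ip I v (u i) = 0"
    "\<And>S. S \<in> I \<Longrightarrow> mv I A v S = \<mu> * v S"
proof -
  obtain v where v: "ip I v v = 1" "\<And>i. i < m \<Longrightarrow> ip I v (u i) = 0"
    and max: "\<And>x. (\<And>i. i < m \<Longrightarrow> ip I x (u i) = 0) \<Longrightarrow> ip I x (mv I A x) \<le> ip I v (mv I A v) * ip I x x"
    using rayleigh_maximizer[OF fin m] by metis
  define \<mu> where "\<mu> = ip I v (mv I A v)"
  define w where "w = (\<lambda>S. mv I A v S - \<mu> * v S)"
  have w_orth: "ip I w (u i) = 0" if "i < m" for i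
  proof -
    have "ip I (mv I A v) (u i) = ip I v (mv I A (u i))" by (simp add: ip_mv_symm[OF sym])
    also have "\<dots> = ip I v (\<lambda>S. l i * u i S)" by (rule ip_cong) (auto simp: eig that)
    also have "\<dots> = 0" using v(2)[OF that] by (simp add: ip_scale_right)
    finally show ?thesis using v(2)[OF that] by (simp add: w_def ip_diff_left ip_scale_left)
  qed
  have "2 * t * ip I w w + t\<^sup>2 * (ip I w (mv I A w) - \<mu> * ip I w w) \<le> 0" for t
  proof -
    have le: "ip I (\<lambda>S. v S + t * w S) (mv I A (\<lambda>S. v S + t * w S))
        \<le> \<mu> * ip I (\<lambda>S. v S + t * w S) (\<lambda>S. v S + t * w S)"
      unfolding \<mu>_def by (rule max) (simp add: ip_add_left ip_scale_left v w_orth)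
    have e1: "ip I (\<lambda>S. v S + t * w S) (mv I A (\<lambda>S. v S + t * w S)) =
      \<mu> + 2 * t * ip I w (mv I A v) + t\<^sup>2 * ip I w (mv I A w)"
      by (simp add: ip_add_left ip_scale_left mv_add mv_scale ip_add_right ip_scale_right
          ip_mv_symm[OF sym, of v w] ip_commute[of I "mv I A v" w] \<mu>_def algebra_simps power2_eq_square)
    have e2: "ip I (\<lambda>S. v S + t * w S) (\<lambda>S. v S + t * w S) = 1 + 2 * t * ip I w v + t\<^sup>2 * ip I w w"
      by (simp add: ip_add_left ip_scale_left ip_add_right ip_scale_right ip_commute[of I v w] v
          algebra_simps power2_eq_square)
    have ww: "ip I w w = ip I w (mv I A v) - \<mu> * ip I w v"
    proof -
      have "ip I w w = ip I w (\<lambda>S. mv I A v S - \<mu> * v S)" by (simp add: w_def)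
      then show ?thesis by (simp add: ip_diff_right ip_scale_right)
    qed
    have "2 * t * W + t\<^sup>2 * (Q - \<mu> * W) \<le> 0"
      if "\<mu> + 2 * t * X + t\<^sup>2 * Q \<le> \<mu> * (1 + 2 * t * Y + t\<^sup>2 * W)" "W = X - \<mu> * Y" for W X Y Q
    proof -
      have "2 * t * (X - \<mu> * Y) + t\<^sup>2 * (Q - \<mu> * W)
          = (\<mu> + 2 * t * X + t\<^sup>2 * Q) - \<mu> * (1 + 2 * t * Y + t\<^sup>2 * W)"
        by (simp add: algebra_simps)
      then show ?thesis using that by simp
    qed
    from this[OF le[unfolded e1 e2] ww] show ?thesis .
  qed
  from quadratic_nonpos_imp_linear_zero[OF this] have "ip I w w = 0" .
  then have "\<forall>S\<in>I. w S = 0" using fin by (simp add: ip_self_eq_0_iff)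
  then show ?thesis using v by (intro that[of v \<mu>]) (auto simp: w_def)
qed

lemma orthonormal_eigenvectors_exist:
  fixes A :: "'a \<Rightarrow> 'a \<Rightarrow> real"
  assumes fin: "finite I" and sym: "symm I A" and "m \<le> card I"
  shows "\<exists>u l. (\<forall>i<m. \<forall>j<m. ip I (u i) (u j) = of_bool (i = j)) \<and>
    (\<forall>i<m. \<forall>S\<in>I. mv I A (u i) S = l i * u i S)"
  using assms(3)
proof (induction m)
  case 0
  then show ?case by simp
next
  case (Suc m)
  then obtain u l where u: "\<forall>i<m. \<forall>j<m. ip I (u i) (u j) = of_bool (i = j)"
    "\<forall>i<m. \<forall>S\<in>I. mv I A (u i) S = l i * u i S" by auto
  from Suc.prems have "m < card I" by simp
  from next_eigenvector[OF fin this sym, of u l] u(2) obtain v \<mu> where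
    v: "ip I v v = 1" "\<And>i. i < m \<Longrightarrow> ip I v (u i) = 0" "\<And>S. S \<in> I \<Longrightarrow> mv I A v S = \<mu> * v S" by metis
  show ?case
    by (rule exI[of _ "u(m := v)"], rule exI[of _ "l(m := \<mu>)"])
      (use u v in \<open>auto simp: less_Suc_eq ip_commute\<close>)
qed

text \<open>The matrix with orthonormal eigenvectors as columns conjugates \<open>Am\<close> to a
  diagonal matrix, so the roots of the characteristic polynomial are the eigenvalues with
  multiplicity. Sorting them is a permutation, and the eigenvectors are permuted along.\<close>

lemma spectral_decomposition:
  fixes A :: "'a \<Rightarrow> 'a \<Rightarrow> real"
  assumes fin: "finite I" and sym: "symm I A" and f: "bij_betw f {..<card I} I"
  defines "es \<equiv> sorted_list_of_multiset (proots (char_poly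
      (Matrix.mat (card I) (card I) (\<lambda>(i, j). A (f i) (f j)))))"
  shows "length es = card I"
    and "\<exists>u. (\<forall>i<card I. \<forall>j<card I. ip I (u i) (u j) = of_bool (i = j)) \<and>
      (\<forall>i<card I. \<forall>S\<in>I. mv I A (u i) S = es ! i * u i S)"
proof -
  define N where "N = card I"
  define Am where "Am = Matrix.mat N N (\<lambda>(i, j). A (f i) (f j))"
  obtain u l where u: "\<forall>i<N. \<forall>j<N. ip I (u i) (u j) = of_bool (i = j)"
    and eig: "\<forall>i<N. \<forall>S\<in>I. mv I A (u i) S = l i * u i S"
    using orthonormal_eigenvectors_exist[OF fin sym, of N] by (auto simp: N_def)
  have reindex: "(\<Sum>a<N. g (f a)) = (\<Sum>S\<in>I. g S)" for g :: "'a \<Rightarrow> real"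
    using sum.reindex_bij_betw[OF f] by (simp add: N_def)
  have fI: "f a \<in> I" if "a < N" for a using f that by (auto simp: N_def bij_betw_def)
  define P where "P = Matrix.mat N N (\<lambda>(a, i). u i (f a))"
  define B where "B = Matrix.mat N N (\<lambda>(i, j). if i = j then l i else 0)"
  have carr: "P \<in> carrier_mat N N" "B \<in> carrier_mat N N" "Am \<in> carrier_mat N N"
    by (auto simp: P_def B_def Am_def)
  have PtP: "transpose_mat P * P = 1\<^sub>m N"
  proof (rule eq_matI)
    fix i j assume "i < dim_row (1\<^sub>m N)" "j < dim_col (1\<^sub>m N)"
    then have ij: "i < N" "j < N" by auto
    have "(transpose_mat P * P) $$ (i, j) = (\<Sum>a<N. u i (f a) * u j (f a))"
      using ij by (simp add: P_def scalar_prod_def lessThan_atLeast0)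
    also have "\<dots> = ip I (u i) (u j)" by (simp add: reindex[of "\<lambda>S. u i S * u j S"] ip_def)
    finally show "(transpose_mat P * P) $$ (i, j) = 1\<^sub>m N $$ (i, j)" using u ij by simp
  qed (use carr in auto)
  have PPt: "P * transpose_mat P = 1\<^sub>m N"
    by (rule mat_mult_left_right_inverse[OF _ _ PtP]) (use carr in auto)
  have AP: "Am * P = P * B"
  proof (rule eq_matI)
    fix a i assume "a < dim_row (P * B)" "i < dim_col (P * B)"
    then have ai: "a < N" "i < N" using carr by auto
    have "(Am * P) $$ (a, i) = (\<Sum>b<N. A (f a) (f b) * u i (f b))"
      using ai by (simp add: P_def Am_def scalar_prod_def lessThan_atLeast0)
    also have "\<dots> = mv I A (u i) (f a)" by (simp add: reindex[of "\<lambda>S. A (f a) S * u i S"] mv_def)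
    also have "\<dots> = l i * u i (f a)" using eig ai fI by auto
    also have "\<dots> = (\<Sum>j<N. u j (f a) * (if j = i then l j else 0))" using ai by (simp add: if_distrib mult.commute sum.delta cong: if_cong)
    also have "\<dots> = (P * B) $$ (a, i)"
      using ai by (simp add: P_def B_def scalar_prod_def lessThan_atLeast0)
    finally show "(Am * P) $$ (a, i) = (P * B) $$ (a, i)" .
  qed (use carr in auto)
  have "Am = Am * (P * transpose_mat P)" using carr by (simp add: PPt)
  also have "\<dots> = Am * P * transpose_mat P" using carr by (simp add: assoc_mult_mat[of _ N N _ N _ N])
  finally have "Am = P * B * transpose_mat P" by (simp add: AP)
  then have "similar_mat Am B"
    using carr PtP PPt unfolding similar_mat_def similar_mat_wit_def
    by (intro exI[of _ P] exI[of _ "transpose_mat P"]) (auto simp: Let_def)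
  then have "char_poly Am = char_poly B" by (rule char_poly_similar)
  also have "\<dots> = (\<Prod>a\<leftarrow>diag_mat B. [:- a, 1:])"
    by (rule char_poly_upper_triangular[OF carr(2)]) (auto simp: B_def)
  also have "diag_mat B = map l [0..<N]" by (auto simp: diag_mat_def B_def)
  finally have cp: "char_poly Am = (\<Prod>a\<leftarrow>map l [0..<N]. [:- a, 1:])" .
  have "proots (\<Prod>a\<leftarrow>xs. [:- a, 1:]) = mset xs" for xs :: "real list"
  proof (induction xs)
    case (Cons a xs)
    have "(\<Prod>a\<leftarrow>xs. [:- a, 1:]) \<noteq> 0" by (auto simp: prod_list_zero_iff)
    then have "proots ([:- a, 1:] * (\<Prod>a\<leftarrow>xs. [:- a, 1:])) = proots [:- a, 1:] + proots (\<Prod>a\<leftarrow>xs. [:- a, 1:])"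
      by (intro proots_mult) simp_all
    then show ?case by (simp only: Cons.IH list.map prod_list.Cons proots_linear_factor) simp
  qed simp
  then have proots: "proots (char_poly Am) = mset (map l [0..<N])" unfolding cp .
  have es: "es = sort (map l [0..<N])"
    unfolding es_def N_def[symmetric] Am_def[symmetric] proots by (rule sorted_list_of_multiset_mset)
  then show "length es = card I" by (simp add: N_def)
  have "mset es = mset (map l [0..<N])" by (simp add: es)
  then obtain \<pi> where \<pi>0: "\<pi> permutes {..<length (map l [0..<N])}" "permute_list \<pi> (map l [0..<N]) = es"
    by (rule mset_eq_permutation)
  have \<pi>: "\<pi> permutes {..<N}" "permute_list \<pi> (map l [0..<N]) = es" using \<pi>0 by simp_all
  have \<pi>N: "\<pi> i < N" if "i < N" for i using permutes_in_image[OF \<pi>(1), of i] that by auto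
  have es_nth: "es ! i = l (\<pi> i)" if "i < N" for i
    unfolding \<pi>(2)[symmetric] using that \<pi>0(1) \<pi>N[OF that] by (simp add: permute_list_nth)
  show "\<exists>u. (\<forall>i<card I. \<forall>j<card I. ip I (u i) (u j) = of_bool (i = j)) \<and>
      (\<forall>i<card I. \<forall>S\<in>I. mv I A (u i) S = es ! i * u i S)"
  proof (intro exI[of _ "\<lambda>i. u (\<pi> i)"] conjI allI impI ballI)
    fix i j assume "i < card I" "j < card I"
    then show "ip I (u (\<pi> i)) (u (\<pi> j)) = of_bool (i = j)"
      using u \<pi>N[of i] \<pi>N[of j] inj_eq[OF permutes_inj[OF \<pi>(1)]] by (simp add: N_def)
  next
    fix i S assume "i < card I" "S \<in> I"
    then show "mv I A (u (\<pi> i)) S = es ! i * u (\<pi> i) S"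
      using eig \<pi>N[of i] es_nth[of i] by (simp add: N_def)
  qed
qed

section \<open>Expansions in an eigenbasis and the minimax inequalities\<close>

definition eigenbasis :: "'a set \<Rightarrow> ('a \<Rightarrow> 'a \<Rightarrow> real) \<Rightarrow> (nat \<Rightarrow> real) \<Rightarrow> (nat \<Rightarrow> 'a \<Rightarrow> real) \<Rightarrow> bool" where
  "eigenbasis I A e u \<longleftrightarrow> (\<forall>i<card I. \<forall>j<card I. ip I (u i) (u j) = of_bool (i = j)) \<and>
     (\<forall>i<card I. \<forall>S\<in>I. mv I A (u i) S = e i * u i S)"

lemma eigenbasis_ip: "eigenbasis I A e u \<Longrightarrow> i < card I \<Longrightarrow> j < card I \<Longrightarrow> ip I (u i) (u j) = of_bool (i = j)"
  by (simp add: eigenbasis_def)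

lemma eigenbasis_mv: "eigenbasis I A e u \<Longrightarrow> i < card I \<Longrightarrow> S \<in> I \<Longrightarrow> mv I A (u i) S = e i * u i S"
  by (simp add: eigenbasis_def)

lemma eigenbasis_ip_sum:
  assumes "eigenbasis I A e u" "J \<subseteq> {..<card I}" "j < card I"
  shows "ip I (\<lambda>S. \<Sum>i\<in>J. c i * u i S) (u j) = (if j \<in> J then c j else 0)"
proof -
  have "finite J" using assms(2) finite_subset by blast
  have "ip I (\<lambda>S. \<Sum>i\<in>J. c i * u i S) (u j) = (\<Sum>i\<in>J. c i * of_bool (i = j))"
    unfolding ip_sum_left ip_scale_left
    by (intro sum.cong refl) (use assms in \<open>auto simp: eigenbasis_ip[OF assms(1)]\<close>)
  also have "\<dots> = (\<Sum>i\<in>J. if i = j then c i else 0)" by (intro sum.cong) auto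
  also have "\<dots> = (if j \<in> J then c j else 0)" using \<open>finite J\<close> by (simp add: sum.delta)
  finally show ?thesis .
qed

text \<open>The residual \<open>w\<close> is orthogonal to all \<open>u j\<close>. The
  \<open>card I + 1\<close> functions \<open>u j\<close> and \<open>w\<close> are dependent on
  \<open>I\<close>; orthogonality removes every coefficient except that of \<open>w\<close>, which
  forces \<open>w\<close> to vanish on \<open>I\<close>.\<close>

lemma eigenbasis_expansion:
  assumes fin: "finite I" and eb: "eigenbasis I A e u" and S: "S \<in> I"
  shows "x S = (\<Sum>i<card I. ip I x (u i) * u i S)"
proof -
  define N where "N = card I"
  define w where "w = (\<lambda>S. x S - (\<Sum>i<N. ip I x (u i) * u i S))"
  have w_orth: "ip I w (u j) = 0" if "j < N" for j
    using eigenbasis_ip_sum[OF eb, of "{..<N}" j "\<lambda>i. ip I x (u i)"] that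
    by (simp add: w_def ip_diff_left N_def)
  define v where "v = (\<lambda>i. if i < N then u i else w)"
  have "card I < card {..N}" by (simp add: N_def)
  from homogeneous_system_nontrivial_set[OF _ fin this, of v]
  obtain c where c: "\<exists>i\<in>{..N}. c i \<noteq> 0" "\<And>T. T \<in> I \<Longrightarrow> (\<Sum>i\<le>N. c i * v i T) = 0"
    by auto
  have split: "(\<Sum>i<N. c i * u i T) + c N * w T = 0" if "T \<in> I" for T
  proof -
    have "(\<Sum>i\<le>N. c i * v i T) = (\<Sum>i<N. c i * v i T) + c N * v N T"
      by (simp add: lessThan_Suc_atMost[symmetric])
    also have "(\<Sum>i<N. c i * v i T) = (\<Sum>i<N. c i * u i T)" by (intro sum.cong) (auto simp: v_def)
    finally show ?thesis using c(2)[OF that] by (simp add: v_def)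
  qed
  have 0: "ip I (\<lambda>T. (\<Sum>i<N. c i * u i T) + c N * w T) z = 0" for z
    using split by (simp add: ip_def)
  have cj: "c j = 0" if "j < N" for j
    using 0[of "u j"] eigenbasis_ip_sum[OF eb, of "{..<N}" j c] that w_orth[OF that]
    by (simp add: ip_add_left ip_scale_left N_def)
  then have "c N \<noteq> 0" using c(1) by (metis atMost_iff le_neq_implies_less)
  moreover have "c N * ip I w w = 0"
    using 0[of w] cj by (simp add: ip_add_left ip_scale_left ip_sum_left)
  ultimately have "ip I w w = 0" by simp
  then have "w S = 0" using ip_self_eq_0_iff[OF fin, of w] S by blast
  then show ?thesis by (simp add: w_def N_def)
qed

lemma eigenbasis_parseval:
  assumes fin: "finite I" and eb: "eigenbasis I A e u"
  shows "ip I x y = (\<Sum>i<card I. ip I x (u i) * ip I y (u i))"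
proof -
  have "ip I x y = ip I (\<lambda>S. \<Sum>i<card I. ip I x (u i) * u i S) y"
    by (rule ip_cong) (use eigenbasis_expansion[OF fin eb, of _ x] in auto)
  then show ?thesis by (simp add: ip_sum_left ip_scale_left ip_commute[of I y])
qed

lemma eigenbasis_quadratic_form:
  assumes fin: "finite I" and sym: "symm I A" and eb: "eigenbasis I A e u"
  shows "ip I x (mv I A x) = (\<Sum>i<card I. e i * (ip I x (u i))\<^sup>2)"
proof -
  have "ip I (mv I A x) (u i) = e i * ip I x (u i)" if "i < card I" for i
  proof -
    have "ip I (mv I A x) (u i) = ip I x (mv I A (u i))" by (simp add: ip_mv_symm[OF sym])
    also have "\<dots> = ip I x (\<lambda>S. e i * u i S)" by (rule ip_cong) (auto simp: eigenbasis_mv[OF eb that])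
    finally show ?thesis by (simp add: ip_scale_right)
  qed
  then show ?thesis unfolding eigenbasis_parseval[OF fin eb, of x "mv I A x"]
    by (intro sum.cong) (auto simp: power2_eq_square)
qed

lemma eigenbasis_norm:
  assumes fin: "finite I" and eb: "eigenbasis I A e u"
  shows "ip I x x = (\<Sum>i<card I. (ip I x (u i))\<^sup>2)"
  unfolding eigenbasis_parseval[OF fin eb, of x x] by (simp add: power2_eq_square)

text \<open>One half of the Courant-Fischer principle: the span of \<open>w 0, ..., w k\<close> has
  dimension \<open>k + 1\<close>, hence contains a nonzero vector orthogonal to the \<open>k\<close>
  eigenvectors before \<open>u k\<close>, where the Rayleigh quotient is at least
  \<open>e k\<close>.\<close>

lemma eigenvalue_le_of_subspace:
  assumes fin: "finite I" and sym: "symm I A" and eb: "eigenbasis I A e u"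
    and mono: "\<And>i j. i \<le> j \<Longrightarrow> j < card I \<Longrightarrow> e i \<le> e j" and k: "k < card I"
    and indep: "\<And>c. (\<And>S. S \<in> I \<Longrightarrow> (\<Sum>i\<le>k. c i * w i S) = 0) \<Longrightarrow> \<forall>i\<le>k. c i = 0"
    and le: "\<And>c. ip I (\<lambda>S. \<Sum>i\<le>k. c i * w i S) (mv I A (\<lambda>S. \<Sum>i\<le>k. c i * w i S))
      \<le> t * ip I (\<lambda>S. \<Sum>i\<le>k. c i * w i S) (\<lambda>S. \<Sum>i\<le>k. c i * w i S)"
  shows "e k \<le> t"
proof -
  obtain c where c: "\<exists>i\<in>{..k}. c i \<noteq> 0" "\<And>j. j \<in> {..<k} \<Longrightarrow> (\<Sum>i\<le>k. c i * ip I (w i) (u j)) = 0"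
    using homogeneous_system_nontrivial_set[of "{..k}" "{..<k}" "\<lambda>i j. ip I (w i) (u j)"] by auto
  define y where "y = (\<lambda>S. \<Sum>i\<le>k. c i * w i S)"
  have y0: "ip I y (u j) = 0" if "j < k" for j
    using c(2)[of j] that by (simp add: y_def ip_sum_left ip_scale_left)
  have "ip I y y \<noteq> 0" using indep[of c] c(1) by (auto simp: ip_self_eq_0_iff[OF fin] y_def)
  then have pos: "ip I y y > 0" using ip_self_nonneg[of I y] by linarith
  have "e k * ip I y y = (\<Sum>i<card I. e k * (ip I y (u i))\<^sup>2)"
    unfolding eigenbasis_norm[OF fin eb, of y] by (simp add: sum_distrib_left)
  also have "\<dots> \<le> (\<Sum>i<card I. e i * (ip I y (u i))\<^sup>2)"
  proof (rule sum_mono)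
    fix i assume "i \<in> {..<card I}"
    then show "e k * (ip I y (u i))\<^sup>2 \<le> e i * (ip I y (u i))\<^sup>2"
      using y0[of i] mono[of k i] by (cases "i < k") (auto intro: mult_right_mono)
  qed
  also have "\<dots> = ip I y (mv I A y)" by (simp add: eigenbasis_quadratic_form[OF fin sym eb])
  also have "\<dots> \<le> t * ip I y y" using le[of c] by (simp add: y_def)
  finally show ?thesis using pos by simp
qed

text \<open>The other half: \<open>card I - k\<close> independent vectors against only
  \<open>card I - k - 1\<close> eigenvectors above index \<open>k\<close> leave a nonzero vector
  whose Rayleigh quotient is at most \<open>e k\<close>.\<close>

lemma eigenvalue_ge_of_subspace:
  assumes fin: "finite I" and sym: "symm I A" and eb: "eigenbasis I A e u"
    and mono: "\<And>i j. i \<le> j \<Longrightarrow> j < card I \<Longrightarrow> e i \<le> e j" and k: "k < card I"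
    and indep: "\<And>c. (\<And>S. S \<in> I \<Longrightarrow> (\<Sum>i\<in>{k..<card I}. c i * w i S) = 0) \<Longrightarrow> \<forall>i\<in>{k..<card I}. c i = 0"
    and ge: "\<And>c. ip I (\<lambda>S. \<Sum>i\<in>{k..<card I}. c i * w i S) (mv I A (\<lambda>S. \<Sum>i\<in>{k..<card I}. c i * w i S))
      \<ge> t * ip I (\<lambda>S. \<Sum>i\<in>{k..<card I}. c i * w i S) (\<lambda>S. \<Sum>i\<in>{k..<card I}. c i * w i S)"
  shows "e k \<ge> t"
proof -
  have "card {k<..<card I} < card {k..<card I}" using k by simp
  then obtain c where c: "\<exists>i\<in>{k..<card I}. c i \<noteq> 0"
    "\<And>j. j \<in> {k<..<card I} \<Longrightarrow> (\<Sum>i\<in>{k..<card I}. c i * ip I (w i) (u j)) = 0"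
    using homogeneous_system_nontrivial_set[of "{k..<card I}" "{k<..<card I}" "\<lambda>i j. ip I (w i) (u j)"] by blast
  define y where "y = (\<lambda>S. \<Sum>i\<in>{k..<card I}. c i * w i S)"
  have y0: "ip I y (u j) = 0" if "k < j" "j < card I" for j
    using c(2)[of j] that by (simp add: y_def ip_sum_left ip_scale_left)
  have "ip I y y \<noteq> 0" using indep[of c] c(1) by (auto simp: ip_self_eq_0_iff[OF fin] y_def)
  then have pos: "ip I y y > 0" using ip_self_nonneg[of I y] by linarith
  have "t * ip I y y \<le> ip I y (mv I A y)" using ge[of c] by (simp add: y_def)
  also have "\<dots> = (\<Sum>i<card I. e i * (ip I y (u i))\<^sup>2)" by (simp add: eigenbasis_quadratic_form[OF fin sym eb])
  also have "\<dots> \<le> (\<Sum>i<card I. e k * (ip I y (u i))\<^sup>2)"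
  proof (rule sum_mono)
    fix i assume "i \<in> {..<card I}"
    then show "e i * (ip I y (u i))\<^sup>2 \<le> e k * (ip I y (u i))\<^sup>2"
      using y0[of i] mono[of i k] k by (cases "k < i") (auto intro: mult_right_mono)
  qed
  also have "\<dots> = e k * ip I y y"
    unfolding eigenbasis_norm[OF fin eb, of y] by (simp add: sum_distrib_left)
  finally show ?thesis using pos by simp
qed

subsection \<open>The disjointness matrix\<close>

lemma card_nsets_between:
  assumes "finite V" "J \<subseteq> V" "T \<subseteq> V" "J \<inter> T = {}" "card J \<le> k"
  shows "card {S \<in> nsets V k. J \<subseteq> S \<and> S \<inter> T = {}} = (card V - card J - card T) choose (k - card J)"
proof -
  have fin: "finite J" "finite T" using assms finite_subset by blast+
  have "bij_betw (\<lambda>S. S - J) {S \<in> nsets V k. J \<subseteq> S \<and> S \<inter> T = {}} (nsets (V - J - T) (k - card J))"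
  proof (rule bij_betw_byWitness[where f' = "\<lambda>S. S \<union> J"])
    show "(\<lambda>S. S - J) ` {S \<in> nsets V k. J \<subseteq> S \<and> S \<inter> T = {}} \<subseteq> nsets (V - J - T) (k - card J)"
      using fin by (auto simp: nsets_def card_Diff_subset)
    show "(\<lambda>S. S \<union> J) ` nsets (V - J - T) (k - card J) \<subseteq> {S \<in> nsets V k. J \<subseteq> S \<and> S \<inter> T = {}}"
    proof safe
      fix S assume S: "S \<in> nsets (V - J - T) (k - card J)"
      then have "card (S \<union> J) = card S + card J"
        using fin by (intro card_Un_disjoint) (auto simp: nsets_def)
      then show "S \<union> J \<in> nsets V k" using S assms fin by (auto simp: nsets_def)
    qed (use assms in \<open>auto simp: nsets_def\<close>)
  qed (auto simp: nsets_def)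
  then have "card {S \<in> nsets V k. J \<subseteq> S \<and> S \<inter> T = {}} = card (nsets (V - J - T) (k - card J))"
    by (rule bij_betw_same_card)
  also have "card (V - J - T) = card V - card J - card T"
    using assms fin by (subst card_Diff_subset, simp, force, subst card_Diff_subset) auto
  then have "card (nsets (V - J - T) (k - card J)) = (card V - card J - card T) choose (k - card J)"
    using assms by (simp add: card_nsets)
  finally show ?thesis .
qed

lemma card_nsets_superset:
  assumes "finite V" "J \<subseteq> V" "card J \<le> k"
  shows "card {S \<in> nsets V k. J \<subseteq> S} = (card V - card J) choose (k - card J)"
  using card_nsets_between[of V J "{}" k] assms by simp

lemma sum_alternating_Pow:
  assumes "finite X"
  shows "(\<Sum>J\<in>Pow X. (-1) ^ card J) = (of_bool (X = {}) :: real)"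
  using assms
proof (induction X)
  case (insert x X)
  have "(\<Sum>J\<in>Pow (insert x X). (-1) ^ card J) =
      (\<Sum>J\<in>Pow X. (-1::real) ^ card J) + (\<Sum>J\<in>insert x ` Pow X. (-1) ^ card J)"
    unfolding Pow_insert using insert by (intro sum.union_disjoint) auto
  also have "(\<Sum>J\<in>insert x ` Pow X. (-1::real) ^ card J) = (\<Sum>J\<in>Pow X. (-1) ^ card (insert x J))"
    using insert by (subst sum.reindex) (auto simp: inj_on_def)
  also have "\<dots> = (\<Sum>J\<in>Pow X. - ((-1::real) ^ card J))"
  proof (rule sum.cong)
    fix J assume "J \<in> Pow X"
    then have "finite J" "x \<notin> J" using insert by (auto intro: finite_subset)
    then show "(-1::real) ^ card (insert x J) = - ((-1) ^ card J)" by simp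
  qed simp
  finally show ?case by (simp add: sum_negf)
qed simp

text \<open>Trades disjointness for containment, so that the disjointness matrix acts on the
  containment sums, which can be treated level by level.\<close>

lemma inclusion_exclusion_disjoint:
  assumes "finite X"
  shows "(\<Sum>J\<in>Pow X. (-1) ^ card J * of_bool (J \<subseteq> T)) = (of_bool (X \<inter> T = {}) :: real)"
proof -
  have "(\<Sum>J\<in>Pow X. (-1) ^ card J * of_bool (J \<subseteq> T)) = (\<Sum>J\<in>Pow (X \<inter> T). (-1::real) ^ card J)"
    using assms by (intro sum.mono_neutral_cong_right) auto
  then show ?thesis using sum_alternating_Pow[of "X \<inter> T"] assms by simp
qed

lemma binomial_pred_pred_le: "1 \<le> j \<Longrightarrow> j \<le> k \<Longrightarrow> k \<le> m \<Longrightarrow> (m - j) choose (k - j) \<le> (m - 1) choose (k - 1)"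
proof (induction j rule: dec_induct)
  case (step j)
  have "m - j = Suc (m - Suc j)" "k - j = Suc (k - Suc j)" using step by auto
  then have "(m - Suc j) choose (k - Suc j) \<le> (m - j) choose (k - j)" by simp
  with step show ?case by simp
qed simp

text \<open>
  An eigenvector orthogonal to the constants has a smallest level \<open>j \<ge> 1\<close> at which some sum
  \<open>\<Sum>S\<supseteq>J. y S\<close> with \<open>card J = j\<close> does not vanish; testing against such a \<open>J\<close> determines the eigenvalue.
\<close>

lemma disjointness_eigenvalue_bound:
  fixes y :: "'a set \<Rightarrow> real"
  assumes V: "finite V" and s: "1 \<le> s" and n: "2 * s \<le> card V"
    and eig: "\<And>S. S \<in> nsets V s \<Longrightarrow> (\<Sum>T\<in>nsets V s. of_bool (S \<inter> T = {}) * y T) = \<theta> * y S"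
    and orth: "(\<Sum>S\<in>nsets V s. y S) = 0"
    and nz: "S0 \<in> nsets V s" "y S0 \<noteq> 0"
  shows "\<bar>\<theta>\<bar> \<le> real ((card V - s - 1) choose (s - 1))"
proof -
  define I where "I = nsets V s"
  have finI: "finite I" using V by (simp add: I_def finite_imp_finite_nsets)
  define Y where "Y = (\<lambda>J. \<Sum>S\<in>I. of_bool (J \<subseteq> S) * y S)"
  define P where "P = (\<lambda>j. \<exists>J\<subseteq>V. card J = j \<and> Y J \<noteq> 0)"
  \<comment> \<open>At level \<open>s\<close> a containment sum has a single term, so a nonvanishing
    level exists and the least one is at most \<open>s\<close>.\<close>
  have "Y S0 = y S0"
  proof -
    have "Y S0 = (\<Sum>S\<in>I. if S = S0 then y S else 0)"
      unfolding Y_def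
    proof (rule sum.cong)
      fix S assume "S \<in> I"
      then have "S0 \<subseteq> S \<longleftrightarrow> S = S0" using nz(1) card_subset_eq[of S S0] by (auto simp: I_def nsets_def)
      then show "of_bool (S0 \<subseteq> S) * y S = (if S = S0 then y S else 0)" by simp
    qed simp
    then show ?thesis using nz finI by (simp add: I_def)
  qed
  then have Ps: "P s" using nz by (auto simp: P_def nsets_def)
  define j where "j = (LEAST j. P j)"
  have Pj: "P j" unfolding j_def using Ps by (rule LeastI)
  have js: "j \<le> s" unfolding j_def using Ps by (rule Least_le)
  have minimal: "Y J = 0" if "J \<subseteq> V" "card J < j" for J
    using not_less_Least[of "card J" P] that unfolding j_def[symmetric] by (auto simp: P_def)
  obtain J where J: "J \<subseteq> V" "card J = j" "Y J \<noteq> 0" using Pj by (auto simp: P_def)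
  have finJ: "finite J" using J V finite_subset by blast
  have j1: "1 \<le> j"
  proof (rule ccontr)
    assume "\<not> 1 \<le> j"
    then have "card J = 0" using J by simp
    then have "J = {}" using finJ by simp
    then show False using J orth by (simp add: Y_def I_def)
  qed
  define b where "b = real ((card V - j - s) choose (s - j))"
  have count: "(\<Sum>S\<in>I. of_bool (J \<subseteq> S) * of_bool (S \<inter> T = {})) = b * of_bool (J \<inter> T = {})"
    if T: "T \<in> I" for T
  proof -
    have "(\<Sum>S\<in>I. of_bool (J \<subseteq> S) * of_bool (S \<inter> T = {})) = real (card {S \<in> I. J \<subseteq> S \<and> S \<inter> T = {}})"
      using finI by (simp only: of_bool_conj[symmetric] sum_of_bool_eq Int_def mem_Collect_eq)
    also have "\<dots> = b * of_bool (J \<inter> T = {})"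
    proof (cases "J \<inter> T = {}")
      case True
      then show ?thesis using card_nsets_between[of V J T s] V J T js by (auto simp: I_def nsets_def b_def)
    next
      case False
      then have "{S \<in> I. J \<subseteq> S \<and> S \<inter> T = {}} = {}" by auto
      then have "card {S \<in> I. J \<subseteq> S \<and> S \<inter> T = {}} = 0" by (simp only: card.empty)
      with False show ?thesis by simp
    qed
    finally show ?thesis .
  qed
  have "\<theta> * Y J = (\<Sum>S\<in>I. of_bool (J \<subseteq> S) * (\<Sum>T\<in>I. of_bool (S \<inter> T = {}) * y T))"
    unfolding Y_def sum_distrib_left by (intro sum.cong refl) (simp add: eig I_def)
  also have "\<dots> = (\<Sum>T\<in>I. (\<Sum>S\<in>I. of_bool (J \<subseteq> S) * of_bool (S \<inter> T = {})) * y T)"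
    unfolding sum_distrib_left sum_distrib_right by (subst sum.swap) (simp add: mult.assoc)
  also have "\<dots> = (\<Sum>T\<in>I. b * of_bool (J \<inter> T = {}) * y T)"
    by (intro sum.cong refl) (simp add: count)
  also have "\<dots> = b * (\<Sum>T\<in>I. (\<Sum>L\<in>Pow J. (-1) ^ card L * of_bool (L \<subseteq> T)) * y T)"
    unfolding inclusion_exclusion_disjoint[OF finJ] by (simp add: sum_distrib_left mult.assoc)
  also have "(\<Sum>T\<in>I. (\<Sum>L\<in>Pow J. (-1) ^ card L * of_bool (L \<subseteq> T)) * y T) = (\<Sum>L\<in>Pow J. (-1) ^ card L * Y L)"
    unfolding Y_def sum_distrib_left sum_distrib_right by (subst sum.swap) (simp add: mult.assoc)
  \<comment> \<open>By minimality of \<open>j\<close> every proper subset \<open>L\<close>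
    contributes 0. What remains is the Kneser eigenvalue, \<open>b\<close> with sign
    \<open>(-1) ^ j\<close>; among the levels \<open>j \<ge> 1\<close> the first has the largest
    modulus.\<close>
  also have "\<dots> = (\<Sum>L\<in>Pow J. if L = J then (-1) ^ j * Y J else 0)"
  proof (rule sum.cong)
    fix L assume "L \<in> Pow J"
    then show "(-1) ^ card L * Y L = (if L = J then (-1) ^ j * Y J else 0)"
      using psubset_card_mono[OF finJ, of L] minimal[of L] J by auto
  qed simp
  also have "\<dots> = (-1) ^ j * Y J" using finJ by simp
  finally have "\<theta> = b * (-1) ^ j" using J(3) by simp
  then have "\<bar>\<theta>\<bar> = b" by (simp add: abs_mult b_def)
  moreover have "(card V - s - j) choose (s - j) \<le> (card V - s - 1) choose (s - 1)"
    using n by (intro binomial_pred_pred_le[OF j1 js]) simp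
  ultimately show ?thesis by (simp add: b_def add.commute)
qed

subsection \<open>Weighted walks\<close>

text \<open>A history \<open>h\<close> lists the edges of a walk with the latest first. Open edges
  are those used exactly once: a walk that ends with one has expectation 0, since the edge variables
  are centred and independent.\<close>

definition open_edges :: "'a set list \<Rightarrow> 'a set set" where
  "open_edges h = {e \<in> set h. count_list h e = 1}"

definition open_degree :: "'a set list \<Rightarrow> 'a set \<Rightarrow> nat" where
  "open_degree h U = card {e \<in> open_edges h. U \<subseteq> e}"

text \<open>
  Along a walk that always enters fresh vertices, at most one open edge contains the current
  set and at most two contain any other set; the potential measures the violation of this.
\<close>

definition potential :: "'a set set \<Rightarrow> 'a set list \<Rightarrow> 'a set \<Rightarrow> nat" where
  "potential I h S = (\<Sum>U\<in>I. open_degree h U - 2) + of_bool (2 \<le> open_degree h S)"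

lemma finite_open_edges [simp]: "finite (open_edges h)"
  by (simp add: open_edges_def)

lemma open_edges_new: "e \<notin> set h \<Longrightarrow> open_edges (e # h) = insert e (open_edges h)"
  by (auto simp: open_edges_def count_list_0_iff)

lemma open_edges_close: "e \<in> open_edges h \<Longrightarrow> open_edges (e # h) = open_edges h - {e}"
  by (auto simp: open_edges_def)

lemma open_edges_neutral: "e \<in> set h \<Longrightarrow> e \<notin> open_edges h \<Longrightarrow> open_edges (e # h) = open_edges h"
  by (auto simp: open_edges_def count_list_0_iff)

lemma open_degree_new:
  assumes "e \<notin> set h"
  shows "open_degree (e # h) U = open_degree h U + of_bool (U \<subseteq> e)"
proof -
  have "e \<notin> open_edges h" using assms by (simp add: open_edges_def)
  moreover have "{x \<in> insert e (open_edges h). U \<subseteq> x} =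
    (if U \<subseteq> e then insert e {x \<in> open_edges h. U \<subseteq> x} else {x \<in> open_edges h. U \<subseteq> x})" by auto
  ultimately show ?thesis by (simp add: open_degree_def open_edges_new[OF assms])
qed

lemma open_degree_close:
  assumes "e \<in> open_edges h"
  shows "open_degree (e # h) U = open_degree h U - of_bool (U \<subseteq> e)"
proof -
  have "{x \<in> open_edges h - {e}. U \<subseteq> x} =
    (if U \<subseteq> e then {x \<in> open_edges h. U \<subseteq> x} - {e} else {x \<in> open_edges h. U \<subseteq> x})" by auto
  then show ?thesis using assms by (simp add: open_degree_def open_edges_close)
qed

lemma open_degree_neutral:
  "e \<in> set h \<Longrightarrow> e \<notin> open_edges h \<Longrightarrow> open_degree (e # h) U = open_degree h U"
  by (simp add: open_degree_def open_edges_neutral)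

text \<open>Another subset of \<open>e\<close> goes from open degree 0 to 1, which the truncated
  subtraction of 2 ignores. The excess of \<open>S\<close> grows by one precisely if its open degree
  was at least 2, and this replaces the flag that the walk gives up on leaving \<open>S\<close>; the
  flag at \<open>T\<close> is 0.\<close>

lemma potential_new_tree:
  assumes fin: "finite I" and S: "S \<in> I" and new: "e \<notin> set h"
    and Se: "S \<subseteq> e" and T: "T \<in> I" "T \<subseteq> e" "T \<noteq> S"
    and fresh: "\<And>U. U \<in> I \<Longrightarrow> U \<subseteq> e \<Longrightarrow> U \<noteq> S \<Longrightarrow> open_degree h U = 0"
  shows "potential I (e # h) T = potential I h S"
proof -
  have "(\<Sum>U\<in>I. open_degree (e # h) U - 2) =
      (\<Sum>U\<in>I. (open_degree h U - 2) + (if U = S then of_bool (2 \<le> open_degree h S) else 0))"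
  proof (rule sum.cong)
    fix U assume "U \<in> I"
    then show "open_degree (e # h) U - 2 =
        (open_degree h U - 2) + (if U = S then of_bool (2 \<le> open_degree h S) else 0)"
      using fresh[of U] Se by (cases "U = S"; cases "U \<subseteq> e") (auto simp: open_degree_new[OF new] of_bool_def)
  qed simp
  then have "(\<Sum>U\<in>I. open_degree (e # h) U - 2) =
      (\<Sum>U\<in>I. open_degree h U - 2) + of_bool (2 \<le> open_degree h S)"
    using fin S by (simp add: sum.distrib)
  moreover have "open_degree (e # h) T = 1" using fresh[of T] T by (simp add: open_degree_new[OF new])
  ultimately show ?thesis by (simp add: potential_def)
qed

lemma potential_new_le:
  assumes fin: "finite I" and new: "e \<notin> set h"
  shows "potential I (e # h) T \<le> potential I h S + card {U \<in> I. U \<subseteq> e} + 1"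
proof -
  have "(\<Sum>U\<in>I. open_degree (e # h) U - 2) \<le> (\<Sum>U\<in>I. (open_degree h U - 2) + of_bool (U \<subseteq> e))"
    by (intro sum_mono) (auto simp: open_degree_new[OF new])
  also have "\<dots> = (\<Sum>U\<in>I. open_degree h U - 2) + card {U \<in> I. U \<subseteq> e}"
    using fin by (simp only: sum.distrib sum_of_bool_eq Int_def mem_Collect_eq of_nat_id)
  finally show ?thesis by (simp add: potential_def)
qed

text \<open>Leaving \<open>S\<close> releases its flag. If the flag at \<open>T\<close> is set after
  \<open>e\<close> is closed, the open degree of \<open>T\<close> was at least 3 and its excess has
  just dropped by one, which pays for it.\<close>

lemma potential_close_le:
  assumes fin: "finite I" and T: "T \<in> I" "T \<subseteq> e" and close: "e \<in> open_edges h"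
  shows "potential I (e # h) T + of_bool (2 \<le> open_degree h S) \<le> potential I h S"
proof -
  have "potential I (e # h) T =
      (\<Sum>U\<in>I. (open_degree (e # h) U - 2) + (if U = T then of_bool (2 \<le> open_degree (e # h) T) else 0))"
    using fin T by (simp add: potential_def sum.distrib)
  also have "\<dots> \<le> (\<Sum>U\<in>I. open_degree h U - 2)"
    using T by (intro sum_mono) (auto simp: open_degree_close[OF close])
  finally show ?thesis by (simp add: potential_def)
qed

lemma potential_neutral_le:
  assumes "e \<in> set h" "e \<notin> open_edges h"
  shows "potential I (e # h) T \<le> potential I h S + 1"
  using assms by (simp add: potential_def open_degree_neutral)

text \<open>
  Here \<open>q = p (1 - p)\<close> bounds the central moments of order at least two. The factor \<open>1 / \<sigma>\<close> is charged when an edge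
  is opened and refunded when it is closed, so it is absent from walks that use every edge at least twice.
\<close>

definition walk_weight :: "'a set set \<Rightarrow> real \<Rightarrow> real \<Rightarrow> real \<Rightarrow> 'a set list \<Rightarrow> 'a set \<Rightarrow> real" where
  "walk_weight I q \<sigma> \<eta> h S = q ^ card (set h) * (1 / \<sigma>) ^ card (open_edges h) * \<eta> ^ potential I h S"

lemma walk_weight_nonneg: "0 \<le> q \<Longrightarrow> 0 < \<sigma> \<Longrightarrow> 0 \<le> \<eta> \<Longrightarrow> 0 \<le> walk_weight I q \<sigma> \<eta> h S"
  by (simp add: walk_weight_def)

lemma walk_weight_new:
  assumes "e \<notin> set h" "0 \<le> q" "0 < \<sigma>" "1 \<le> \<eta>" "potential I (e # h) T \<le> potential I h S + c"
  shows "walk_weight I q \<sigma> \<eta> (e # h) T \<le> q / \<sigma> * \<eta> ^ c * walk_weight I q \<sigma> \<eta> h S"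
proof -
  have "e \<notin> open_edges h" using assms by (simp add: open_edges_def)
  then have "walk_weight I q \<sigma> \<eta> (e # h) T =
      q / \<sigma> * (q ^ card (set h) * (1 / \<sigma>) ^ card (open_edges h)) * \<eta> ^ potential I (e # h) T"
    using assms by (simp add: walk_weight_def open_edges_new)
  also have "\<dots> \<le> q / \<sigma> * (q ^ card (set h) * (1 / \<sigma>) ^ card (open_edges h)) * \<eta> ^ (potential I h S + c)"
    using assms by (intro mult_left_mono power_increasing) auto
  finally show ?thesis by (simp add: walk_weight_def power_add algebra_simps)
qed

lemma walk_weight_close:
  assumes "e \<in> open_edges h" "0 \<le> q" "0 < \<sigma>" "1 \<le> \<eta>"
    "potential I (e # h) T + c \<le> potential I h S"
  shows "walk_weight I q \<sigma> \<eta> (e # h) T \<le> \<sigma> / \<eta> ^ c * walk_weight I q \<sigma> \<eta> h S"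
proof -
  have e: "e \<in> set h" using assms by (simp add: open_edges_def)
  obtain m where m: "card (open_edges h) = Suc m"
    using assms(1) by (metis card_gt_0_iff empty_iff finite_open_edges gr0_conv_Suc)
  have "walk_weight I q \<sigma> \<eta> (e # h) T = q ^ card (set h) * (1 / \<sigma>) ^ m * \<eta> ^ potential I (e # h) T"
    using assms e m by (simp add: walk_weight_def open_edges_close insert_absorb)
  also have "\<dots> = \<sigma> / \<eta> ^ c * (q ^ card (set h) * (1 / \<sigma>) ^ Suc m * \<eta> ^ (potential I (e # h) T + c))"
    using assms by (simp add: power_add)
  also have "\<dots> \<le> \<sigma> / \<eta> ^ c * (q ^ card (set h) * (1 / \<sigma>) ^ Suc m * \<eta> ^ potential I h S)"
    using assms by (intro mult_left_mono power_increasing) auto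
  finally show ?thesis by (simp add: walk_weight_def m)
qed

lemma walk_weight_neutral:
  assumes "e \<in> set h" "e \<notin> open_edges h" "0 \<le> q" "0 < \<sigma>" "1 \<le> \<eta>"
  shows "walk_weight I q \<sigma> \<eta> (e # h) T \<le> \<eta> * walk_weight I q \<sigma> \<eta> h S"
proof -
  have "walk_weight I q \<sigma> \<eta> (e # h) T = q ^ card (set h) * (1 / \<sigma>) ^ card (open_edges h) * \<eta> ^ potential I (e # h) T"
    using assms by (simp add: walk_weight_def open_edges_neutral insert_absorb)
  also have "\<dots> \<le> q ^ card (set h) * (1 / \<sigma>) ^ card (open_edges h) * \<eta> ^ (potential I h S + 1)"
    using assms potential_neutral_le[OF assms(1,2)] by (intro mult_left_mono power_increasing) auto
  finally show ?thesis by (simp add: walk_weight_def algebra_simps)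
qed

text \<open>The edges through \<open>S\<close> fall into four classes. Fresh new edges
  (\<open>P1\<close>): at most \<open>D\<close> of them at \<open>q / \<sigma>\<close> each give
  \<open>\<sigma>\<close>. New edges that meet old vertices outside \<open>S\<close>
  (\<open>P2\<close>) may raise the potential by \<open>K\<close>, but are rarer by the factor
  \<open>c (r - s) / (card V - s)\<close>. Closing steps (\<open>P3\<close>): a single open edge
  contributes \<open>\<sigma>\<close>; if there are several, there are at most \<open>L\<close>, and
  the drop of the potential divides each by \<open>\<eta> = L\<close>. Later uses
  (\<open>P4\<close>): at most \<open>L\<close> edges with factor \<open>\<eta>\<close>.\<close>

lemma walk_weight_step:
  fixes V :: "'a set" and r s :: nat
  defines "I \<equiv> nsets V s" and "D \<equiv> (card V - s) choose (r - s)"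
  assumes V: "finite V" and s: "1 \<le> s" and sr: "s < r" and n: "s < card V"
    and S: "S \<in> nsets V s" and h: "length h \<le> L" and L: "1 \<le> L"
    and X: "X \<subseteq> V" "S \<subseteq> X" "\<And>e. e \<in> set h \<Longrightarrow> e \<subseteq> X" "card X \<le> c"
    and q: "0 \<le> q" and \<sigma>: "0 < \<sigma>" "\<sigma>\<^sup>2 = q * real D"
  shows "(\<Sum>e\<in>{e \<in> nsets V r. S \<subseteq> e}. \<Sum>T\<in>{T \<in> nsets e s. T \<inter> S = {}}. walk_weight I q \<sigma> (real L) (e # h) T)
    \<le> real ((r - s) choose s) * (\<sigma> * (2 + real c * real (r - s) / real (card V - s) * real L ^ ((r choose s) + 1)) + real L ^ 2)
      * walk_weight I q \<sigma> (real L) h S"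
proof -
  define \<eta> where "\<eta> = real L"
  have \<eta>: "1 \<le> \<eta>" using L by (simp add: \<eta>_def)
  define K where "K = (r choose s) + 1"
  define w where "w = walk_weight I q \<sigma> \<eta> h S"
  have w0: "w \<ge> 0" unfolding w_def using q \<sigma> \<eta> by (intro walk_weight_nonneg) auto
  define ES where "ES = {e \<in> nsets V r. S \<subseteq> e}"
  have finI: "finite I" and finES: "finite ES" using V by (auto simp: I_def ES_def finite_imp_finite_nsets)
  have S': "S \<subseteq> V" "finite S" "card S = s" using S by (auto simp: nsets_def)
  define P1 where "P1 = (\<lambda>e. e \<notin> set h \<and> e \<inter> X \<subseteq> S)"
  define P2 where "P2 = (\<lambda>e. e \<notin> set h \<and> \<not> e \<inter> X \<subseteq> S)"
  define P3 where "P3 = (\<lambda>e. e \<in> open_edges h)"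
  define P4 where "P4 = (\<lambda>e. e \<in> set h \<and> e \<notin> open_edges h)"
  define o3 where "o3 = (of_bool (2 \<le> open_degree h S) :: nat)"
  define b where "b = (\<lambda>e. q / \<sigma> * of_bool (P1 e) + q / \<sigma> * \<eta> ^ K * of_bool (P2 e)
      + \<sigma> / \<eta> ^ o3 * of_bool (P3 e) + \<eta> * of_bool (P4 e))"
  have eV: "e \<subseteq> V" "finite e" "card e = r" "S \<subseteq> e" if "e \<in> ES" for e
    using that by (auto simp: ES_def nsets_def)
  have pointwise: "walk_weight I q \<sigma> \<eta> (e # h) T \<le> b e * w"
    if e: "e \<in> ES" and T: "T \<in> nsets e s" "T \<inter> S = {}" for e T
  proof -
    have TI: "T \<in> I" "T \<subseteq> e" using T eV[OF e] by (auto simp: I_def nsets_def)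
    have TS: "T \<noteq> S" using T s by (auto simp: nsets_def)
    consider (1) "P1 e" | (2) "P2 e" | (3) "P3 e" | (4) "P4 e"
      by (auto simp: P1_def P2_def P3_def P4_def)
    then show ?thesis
    proof cases
      case 1
      have "open_degree h U = 0" if U: "U \<in> I" "U \<subseteq> e" "U \<noteq> S" for U
      proof -
        have "\<not> U \<subseteq> S" using U S' card_subset_eq[of S U] by (auto simp: I_def nsets_def)
        then obtain v where "v \<in> U" "v \<notin> S" by auto
        then have "v \<notin> X" using 1 U by (auto simp: P1_def)
        then have "{f \<in> open_edges h. U \<subseteq> f} = {}" using X(3) \<open>v \<in> U\<close> by (fastforce simp: open_edges_def)
        then show ?thesis by (simp only: open_degree_def card.empty)
      qed
      then have "potential I (e # h) T = potential I h S"
        using 1 TI TS S eV[OF e] by (intro potential_new_tree[OF finI]) (auto simp: I_def P1_def)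
      then have "walk_weight I q \<sigma> \<eta> (e # h) T \<le> q / \<sigma> * \<eta> ^ 0 * w"
        unfolding w_def using 1 q \<sigma> \<eta> by (intro walk_weight_new) (auto simp: P1_def)
      moreover have "b e = q / \<sigma>" using 1 by (auto simp: b_def P1_def P2_def P3_def P4_def open_edges_def)
      ultimately show ?thesis by simp
    next
      case 2
      have "{U \<in> I. U \<subseteq> e} = nsets e s" using eV[OF e] by (auto simp: I_def nsets_def)
      then have "card {U \<in> I. U \<subseteq> e} = r choose s" using eV[OF e] by (simp add: card_nsets)
      then have "potential I (e # h) T \<le> potential I h S + K"
        using potential_new_le[OF finI, of e h T S] 2 by (simp add: P2_def K_def)
      then have "walk_weight I q \<sigma> \<eta> (e # h) T \<le> q / \<sigma> * \<eta> ^ K * w"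
        unfolding w_def using 2 q \<sigma> \<eta> by (intro walk_weight_new) (auto simp: P2_def)
      moreover have "b e = q / \<sigma> * \<eta> ^ K" using 2 by (auto simp: b_def P1_def P2_def P3_def P4_def open_edges_def)
      ultimately show ?thesis by simp
    next
      case 3
      then have "potential I (e # h) T + o3 \<le> potential I h S"
        unfolding o3_def using TI by (intro potential_close_le[OF finI]) (auto simp: P3_def)
      then have "walk_weight I q \<sigma> \<eta> (e # h) T \<le> \<sigma> / \<eta> ^ o3 * w"
        unfolding w_def using 3 q \<sigma> \<eta> by (intro walk_weight_close) (auto simp: P3_def)
      moreover have "b e = \<sigma> / \<eta> ^ o3" using 3 by (auto simp: b_def P1_def P2_def P3_def P4_def open_edges_def)
      ultimately show ?thesis by simp
    next
      case 4
      then have "walk_weight I q \<sigma> \<eta> (e # h) T \<le> \<eta> * w"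
        unfolding w_def using q \<sigma> \<eta> by (intro walk_weight_neutral) (auto simp: P4_def)
      moreover have "b e = \<eta>" using 4 by (auto simp: b_def P1_def P2_def P3_def P4_def open_edges_def)
      ultimately show ?thesis by simp
    qed
  qed
  have cardT: "card {T \<in> nsets e s. T \<inter> S = {}} = (r - s) choose s" if "e \<in> ES" for e
    using card_nsets_between[of e "{}" S s] eV[OF that] S' by simp
  have "(\<Sum>e\<in>ES. \<Sum>T\<in>{T \<in> nsets e s. T \<inter> S = {}}. walk_weight I q \<sigma> \<eta> (e # h) T)
      \<le> (\<Sum>e\<in>ES. \<Sum>T\<in>{T \<in> nsets e s. T \<inter> S = {}}. b e * w)"
    by (intro sum_mono pointwise) auto
  also have "\<dots> = (\<Sum>e\<in>ES. real ((r - s) choose s) * w * b e)"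
    by (intro sum.cong refl) (simp add: cardT mult_ac)
  also have "\<dots> = real ((r - s) choose s) * w * (\<Sum>e\<in>ES. b e)" by (simp add: sum_distrib_left)
  also have "\<dots> \<le> real ((r - s) choose s) * w *
      (\<sigma> * (2 + real c * real (r - s) / real (card V - s) * \<eta> ^ K) + \<eta> ^ 2)"
  proof (rule mult_left_mono)
    have count: "(\<Sum>e\<in>ES. of_bool (P e)) = real (card {e \<in> ES. P e})" for P
      using finES by (simp only: sum_of_bool_eq Int_def mem_Collect_eq)
    have sum_b: "(\<Sum>e\<in>ES. b e) = q / \<sigma> * card {e \<in> ES. P1 e} + q / \<sigma> * \<eta> ^ K * card {e \<in> ES. P2 e}
        + \<sigma> / \<eta> ^ o3 * card {e \<in> ES. P3 e} + \<eta> * card {e \<in> ES. P4 e}"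
      unfolding b_def sum.distrib sum_distrib_left[symmetric] count ..
    have cardES: "card ES = D" unfolding ES_def D_def using card_nsets_superset[of V S r] V S' sr by simp
    have "card {e \<in> ES. P1 e} \<le> D" using cardES card_mono[OF finES, of "{e \<in> ES. P1 e}"] by auto
    then have "q / \<sigma> * card {e \<in> ES. P1 e} \<le> q / \<sigma> * D" using q \<sigma> by (intro mult_left_mono) auto
    also have "\<dots> = \<sigma>" using \<sigma> by (simp add: field_simps power2_eq_square)
    finally have 1: "q / \<sigma> * card {e \<in> ES. P1 e} \<le> \<sigma>" .
    \<comment> \<open>\<open>B\<close> counts the edges that contain \<open>S\<close> and one given
      further vertex; the union bound below runs over the old vertices outside
      \<open>S\<close>.\<close>
    define B where "B = (card V - s - 1) choose (r - s - 1)"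
    have finX: "finite X" using X V finite_subset by blast
    have "{e \<in> ES. P2 e} \<subseteq> (\<Union>v\<in>X - S. {e \<in> nsets V r. insert v S \<subseteq> e})"
      by (auto simp: P2_def ES_def)
    then have "card {e \<in> ES. P2 e} \<le> card (\<Union>v\<in>X - S. {e \<in> nsets V r. insert v S \<subseteq> e})"
      using finX V by (intro card_mono finite_UN_I) (auto simp: finite_imp_finite_nsets)
    also have "\<dots> \<le> (\<Sum>v\<in>X - S. card {e \<in> nsets V r. insert v S \<subseteq> e})"
      using finX by (intro card_UN_le) auto
    also have "\<dots> = (\<Sum>v\<in>X - S. B)"
    proof (rule sum.cong)
      fix v assume "v \<in> X - S"
      then show "card {e \<in> nsets V r. insert v S \<subseteq> e} = B"
        using card_nsets_superset[of V "insert v S" r] V S' sr X(1) by (auto simp: B_def)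
    qed simp
    also have "\<dots> \<le> c * B" using X(4) card_mono[OF finX, of "X - S"] by auto
    finally have "real (card {e \<in> ES. P2 e}) \<le> real c * real B" by (metis of_nat_le_iff of_nat_mult)
    moreover have "real B = real D * real (r - s) / real (card V - s)"
    proof -
      have "(r - s) * D = (card V - s) * B"
        unfolding B_def D_def using sr by (intro times_binomial_minus1_eq) simp
      then have "real (r - s) * real D = real (card V - s) * real B" by (metis of_nat_mult)
      moreover have "real (card V - s) \<noteq> 0" using n by simp
      ultimately show ?thesis by (simp add: nonzero_eq_divide_eq mult.commute del: of_nat_diff)
    qed
    ultimately have "q / \<sigma> * \<eta> ^ K * card {e \<in> ES. P2 e} \<le> q / \<sigma> * \<eta> ^ K * (real c * (real D * real (r - s) / real (card V - s)))"
      using q \<sigma> \<eta> by (intro mult_left_mono) auto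
    also have "\<dots> = \<sigma> * (real c * real (r - s) / real (card V - s) * \<eta> ^ K)"
    proof -
      have "q / \<sigma> * real D = \<sigma>" using \<sigma> by (simp add: field_simps power2_eq_square)
      moreover have "q / \<sigma> * \<eta> ^ K * (real c * (real D * real (r - s) / real (card V - s)))
        = q / \<sigma> * real D * (real c * real (r - s) / real (card V - s) * \<eta> ^ K)" by simp
      ultimately show ?thesis by simp
    qed
    finally have 2: "q / \<sigma> * \<eta> ^ K * card {e \<in> ES. P2 e} \<le> \<sigma> * (real c * real (r - s) / real (card V - s) * \<eta> ^ K)" .
    have "card {e \<in> ES. P3 e} \<le> open_degree h S"
      unfolding open_degree_def by (intro card_mono) (auto simp: P3_def ES_def)
    moreover have "open_degree h S \<le> card (set h)"
      unfolding open_degree_def by (intro card_mono) (auto simp: open_edges_def)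
    then have "open_degree h S \<le> L" using card_length[of h] h by linarith
    \<comment> \<open>This is why \<open>\<eta>\<close> equals \<open>L\<close>: the number of open
      edges through \<open>S\<close> is at most 1 without the flag and at most \<open>L\<close> with
      it, and the flag buys exactly one factor \<open>\<eta>\<close>.\<close>
    ultimately have "real (card {e \<in> ES. P3 e}) \<le> \<eta> ^ o3"
      by (auto simp: o3_def \<eta>_def)
    then have 3: "\<sigma> / \<eta> ^ o3 * card {e \<in> ES. P3 e} \<le> \<sigma>" using \<sigma> \<eta> by (simp add: field_simps)
    have "card {e \<in> ES. P4 e} \<le> card (set h)" by (intro card_mono) (auto simp: P4_def)
    then have "real (card {e \<in> ES. P4 e}) \<le> \<eta>" using card_length[of h] h by (simp add: \<eta>_def)
    then have 4: "\<eta> * card {e \<in> ES. P4 e} \<le> \<eta> ^ 2" using \<eta> by (simp add: power2_eq_square)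
    show "(\<Sum>e\<in>ES. b e) \<le> \<sigma> * (2 + real c * real (r - s) / real (card V - s) * \<eta> ^ K) + \<eta> ^ 2"
      unfolding sum_b distrib_left using add_mono[OF add_mono[OF add_mono[OF 1 2] 3] 4]
      by (simp only: mult_2_right add_ac)
  qed (use w0 in simp)
  finally show ?thesis unfolding ES_def w_def \<eta>_def K_def by (simp add: mult_ac)
qed

text \<open>The summand \<open>F\<close> sees the whole history and the endpoint, so one recursion
  covers walk weights, products of edge variables and their expectations.\<close>

primrec walk_sum :: "'a set \<Rightarrow> nat \<Rightarrow> nat \<Rightarrow> ('a set list \<Rightarrow> 'a set \<Rightarrow> real) \<Rightarrow> nat \<Rightarrow> 'a set list \<Rightarrow> 'a set \<Rightarrow> real" where
  "walk_sum V r s F 0 h S = F h S"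
| "walk_sum V r s F (Suc m) h S =
     (\<Sum>e\<in>{e \<in> nsets V r. S \<subseteq> e}. \<Sum>T\<in>{T \<in> nsets e s. T \<inter> S = {}}. walk_sum V r s F m (e # h) T)"

lemma nsets_trans: "T \<in> nsets e s \<Longrightarrow> e \<in> nsets V r \<Longrightarrow> T \<in> nsets V s"
  by (auto simp: nsets_def)

lemma walk_sum_mono:
  assumes "S \<in> nsets V s" "set h \<subseteq> nsets V r"
    and "\<And>h T. set h \<subseteq> nsets V r \<Longrightarrow> T \<in> nsets V s \<Longrightarrow> F h T \<le> G h T"
  shows "walk_sum V r s F m h S \<le> walk_sum V r s G m h S"
  using assms(1,2)
proof (induction m arbitrary: h S)
  case (Suc m)
  then show ?case by (auto intro!: sum_mono Suc.IH intro: nsets_trans)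
qed (use assms in auto)

text \<open>A walk of at most \<open>L\<close> edges sees at most \<open>s + r * L\<close> vertices,
  so one growth factor serves every step; the empty history has weight 1.\<close>

lemma walk_sum_weight_le:
  fixes V :: "'a set" and r s :: nat
  defines "I \<equiv> nsets V s" and "D \<equiv> (card V - s) choose (r - s)"
  assumes V: "finite V" and s: "1 \<le> s" and sr: "s < r" and n: "s < card V" and L: "1 \<le> L"
    and q: "0 \<le> q" and \<sigma>: "0 < \<sigma>" "\<sigma>\<^sup>2 = q * real D"
    and S0: "S0 \<in> nsets V s"
  shows "walk_sum V r s (walk_weight I q \<sigma> (real L)) L [] S0
    \<le> (real ((r - s) choose s) * (\<sigma> * (2 + real (s + r * L) * real (r - s) / real (card V - s) * real L ^ ((r choose s) + 1)) + real L ^ 2)) ^ L"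
proof -
  define \<rho> where "\<rho> = real ((r - s) choose s) * (\<sigma> * (2 + real (s + r * L) * real (r - s) / real (card V - s) * real L ^ ((r choose s) + 1)) + real L ^ 2)"
  have \<rho>0: "\<rho> \<ge> 0" using \<sigma> by (simp add: \<rho>_def)
  define w where "w = walk_weight I q \<sigma> (real L)"
  have "walk_sum V r s w m h S \<le> \<rho> ^ m * w h S"
    if "S \<in> nsets V s" "set h \<subseteq> nsets V r" "length h + m \<le> L" "S \<subseteq> S0 \<union> \<Union>(set h)" for m h S
    using that
  proof (induction m arbitrary: h S)
    case (Suc m)
    have "walk_sum V r s w (Suc m) h S
        \<le> (\<Sum>e\<in>{e \<in> nsets V r. S \<subseteq> e}. \<Sum>T\<in>{T \<in> nsets e s. T \<inter> S = {}}. \<rho> ^ m * w (e # h) T)"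
      unfolding walk_sum.simps
    proof (intro sum_mono Suc.IH)
      fix e T assume "e \<in> {e \<in> nsets V r. S \<subseteq> e}" "T \<in> {T \<in> nsets e s. T \<inter> S = {}}"
      with Suc.prems show "T \<in> nsets V s" "set (e # h) \<subseteq> nsets V r" "length (e # h) + m \<le> L"
        "T \<subseteq> S0 \<union> \<Union>(set (e # h))"
        by (auto simp: nsets_def)
    qed
    also have "\<dots> = \<rho> ^ m * (\<Sum>e\<in>{e \<in> nsets V r. S \<subseteq> e}. \<Sum>T\<in>{T \<in> nsets e s. T \<inter> S = {}}. w (e # h) T)"
      by (simp add: sum_distrib_left)
    also have "\<dots> \<le> \<rho> ^ m * (\<rho> * w h S)"
    proof (rule mult_left_mono)
      have "card (\<Union>(set h)) \<le> (\<Sum>e\<in>set h. card e)" using card_Union_le_sum_card by blast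
      also have "\<dots> = (\<Sum>e\<in>set h. r)" using Suc.prems by (intro sum.cong) (auto simp: nsets_def)
      also have "\<dots> \<le> r * length h" using card_length[of h] by simp
      also have "\<dots> \<le> r * L" using Suc.prems by simp
      finally have "card (\<Union>(set h)) \<le> r * L" .
      then have "card (S0 \<union> \<Union>(set h)) \<le> s + r * L"
        using card_Un_le[of S0 "\<Union>(set h)"] S0 by (simp add: nsets_def)
      then show "(\<Sum>e\<in>{e \<in> nsets V r. S \<subseteq> e}. \<Sum>T\<in>{T \<in> nsets e s. T \<inter> S = {}}. w (e # h) T) \<le> \<rho> * w h S"
        unfolding w_def \<rho>_def I_def using Suc.prems S0 V s sr n L q \<sigma>
        by (intro walk_weight_step[where X = "S0 \<union> \<Union>(set h)"]) (auto simp: nsets_def D_def)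
    qed (use \<rho>0 in simp)
    finally show ?case by (simp add: mult_ac)
  qed simp
  from this[of S0 "[]" L] S0 have "walk_sum V r s w L [] S0 \<le> \<rho> ^ L * w [] S0" by auto
  moreover have "w [] S0 = 1"
    by (simp add: w_def walk_weight_def potential_def open_degree_def open_edges_def)
  ultimately show ?thesis by (simp add: w_def \<rho>_def)
qed

text \<open>The weight matrix with edge values \<open>Y\<close> in place of indicators. It is linear
  in \<open>Y\<close>: the indicator of \<open>E\<close> gives \<open>W\<close>, the constant 1
  gives \<open>W\<^sub>K\<close>, and centred indicators give \<open>M\<close>.\<close>

definition signed_weight :: "'a set \<Rightarrow> nat \<Rightarrow> ('a set \<Rightarrow> real) \<Rightarrow> 'a set \<Rightarrow> 'a set \<Rightarrow> real" where
  "signed_weight V r Y S T = (\<Sum>e\<in>nsets V r. of_bool (S \<subseteq> e \<and> T \<subseteq> e \<and> T \<inter> S = {}) * Y e)"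

lemma symm_signed_weight: "symm I (signed_weight V r Y)"
  by (auto simp: symm_def signed_weight_def Int_commute conj_ac intro!: sum.cong)

lemma mv_signed_weight:
  assumes "finite V"
  shows "mv (nsets V s) (signed_weight V r Y) x S =
    (\<Sum>e\<in>{e \<in> nsets V r. S \<subseteq> e}. \<Sum>T\<in>{T \<in> nsets e s. T \<inter> S = {}}. Y e * x T)"
proof -
  have fin: "finite (nsets V k)" for k using assms by (rule finite_imp_finite_nsets)
  have "mv (nsets V s) (signed_weight V r Y) x S =
      (\<Sum>e\<in>nsets V r. \<Sum>T\<in>nsets V s. of_bool (S \<subseteq> e \<and> T \<subseteq> e \<and> T \<inter> S = {}) * Y e * x T)"
    unfolding mv_def signed_weight_def sum_distrib_right by (rule sum.swap)
  also have "\<dots> = (\<Sum>e\<in>{e \<in> nsets V r. S \<subseteq> e}. \<Sum>T\<in>nsets V s. of_bool (S \<subseteq> e \<and> T \<subseteq> e \<and> T \<inter> S = {}) * Y e * x T)"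
    using fin by (intro sum.mono_neutral_right) auto
  also have "\<dots> = (\<Sum>e\<in>{e \<in> nsets V r. S \<subseteq> e}. \<Sum>T\<in>{T \<in> nsets e s. T \<inter> S = {}}. Y e * x T)"
    using fin by (intro sum.cong refl sum.mono_neutral_cong_right) (auto simp: nsets_def)
  finally show ?thesis .
qed

text \<open>The \<open>m\<close>-th matrix power expanded over walks. Admitting an arbitrary past
  \<open>h\<close>, whose product factors out, carries the induction.\<close>

lemma walk_sum_prod_list:
  assumes "finite V"
  shows "walk_sum V r s (\<lambda>h T. (\<Prod>e\<leftarrow>h. Y e) * g T) m h S =
    (\<Prod>e\<leftarrow>h. Y e) * (mv (nsets V s) (signed_weight V r Y) ^^ m) g S"
proof (induction m arbitrary: h S)
  case (Suc m)
  have "walk_sum V r s (\<lambda>h T. (\<Prod>e\<leftarrow>h. Y e) * g T) (Suc m) h S =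
      (\<Sum>e\<in>{e \<in> nsets V r. S \<subseteq> e}. \<Sum>T\<in>{T \<in> nsets e s. T \<inter> S = {}}.
        (\<Prod>e\<leftarrow>e # h. Y e) * (mv (nsets V s) (signed_weight V r Y) ^^ m) g T)"
    by (simp only: walk_sum.simps Suc.IH)
  also have "\<dots> = (\<Prod>e\<leftarrow>h. Y e) *
      mv (nsets V s) (signed_weight V r Y) ((mv (nsets V s) (signed_weight V r Y) ^^ m) g) S"
    unfolding mv_signed_weight[OF assms, of s r Y "(mv (nsets V s) (signed_weight V r Y) ^^ m) g"] sum_distrib_left
    by (intro sum.cong refl) (simp add: mult_ac)
  finally show ?case by simp
qed simp

lemma eigenbasis_funpow:
  assumes fin: "finite I" and eb: "eigenbasis I A e u" and S: "S \<in> I"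
  shows "(mv I A ^^ m) x S = (\<Sum>i<card I. e i ^ m * ip I x (u i) * u i S)"
  using S
proof (induction m arbitrary: S)
  case 0
  then show ?case using eigenbasis_expansion[OF fin eb, of S x] by simp
next
  case (Suc m)
  have "(mv I A ^^ Suc m) x S = mv I A (\<lambda>S. \<Sum>i<card I. (e i ^ m * ip I x (u i)) * u i S) S"
    by (simp, rule fun_cong[OF mv_cong]) (simp add: Suc.IH)
  also have "\<dots> = (\<Sum>i<card I. e i ^ m * ip I x (u i) * mv I A (u i) S)"
    by (simp only: mv_sum mv_scale)
  also have "\<dots> = (\<Sum>i<card I. e i ^ Suc m * ip I x (u i) * u i S)"
    by (intro sum.cong refl) (simp add: eigenbasis_mv[OF eb _ Suc.prems])
  finally show ?case .
qed

lemma trace_funpow: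
  assumes fin: "finite I" and eb: "eigenbasis I A e u"
  shows "(\<Sum>S\<in>I. (mv I A ^^ m) (\<lambda>T. of_bool (T = S)) S) = (\<Sum>i<card I. e i ^ m)"
proof -
  have "ip I (\<lambda>T. of_bool (T = S)) x = x S" if "S \<in> I" for S x
  proof -
    have "ip I (\<lambda>T. of_bool (T = S)) x = (\<Sum>T\<in>I. if T = S then x T else 0)"
      unfolding ip_def by (intro sum.cong) auto
    then show ?thesis using fin that by simp
  qed
  then have "(\<Sum>S\<in>I. (mv I A ^^ m) (\<lambda>T. of_bool (T = S)) S) = (\<Sum>S\<in>I. \<Sum>i<card I. e i ^ m * (u i S * u i S))"
    by (intro sum.cong refl) (simp add: eigenbasis_funpow[OF fin eb] mult_ac)
  also have "\<dots> = (\<Sum>i<card I. e i ^ m * ip I (u i) (u i))"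
    by (subst sum.swap) (simp add: ip_def sum_distrib_left)
  also have "\<dots> = (\<Sum>i<card I. e i ^ m)" by (simp add: eigenbasis_ip[OF eb])
  finally show ?thesis .
qed

lemma eigenbasis_exists:
  assumes "finite I" "symm I A"
  obtains e u where "eigenbasis I A e u"
  using orthonormal_eigenvectors_exist[OF assms order.refl] unfolding eigenbasis_def by metis

lemma quadratic_form_bound_of_eigenvalues:
  assumes fin: "finite I" and sym: "symm I A" and eb: "eigenbasis I A e u"
    and bound: "\<And>i. i < card I \<Longrightarrow> \<bar>e i\<bar> \<le> t"
  shows "\<bar>ip I x (mv I A x)\<bar> \<le> t * ip I x x"
proof -
  have "\<bar>ip I x (mv I A x)\<bar> \<le> (\<Sum>i<card I. \<bar>e i * (ip I x (u i))\<^sup>2\<bar>)"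
    unfolding eigenbasis_quadratic_form[OF fin sym eb] by (rule sum_abs)
  also have "\<dots> \<le> (\<Sum>i<card I. t * (ip I x (u i))\<^sup>2)"
    by (intro sum_mono) (auto simp: abs_mult intro!: mult_right_mono bound)
  also have "\<dots> = t * ip I x x" unfolding eigenbasis_norm[OF fin eb, of x] by (simp add: sum_distrib_left)
  finally show ?thesis .
qed

text \<open>With \<open>L\<close> even all \<open>e i ^ L\<close> are nonnegative, so each is
  bounded by their sum, the trace of the power; the diagonal entries are read off with indicator
  vectors.\<close>

lemma quadratic_form_bound_of_trace:
  assumes fin: "finite I" and sym: "symm I A" and L: "even L" "0 < L" and t: "0 \<le> t"
    and trace: "(\<Sum>S\<in>I. (mv I A ^^ L) (\<lambda>T. of_bool (T = S)) S) \<le> t ^ L"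
  shows "\<bar>ip I x (mv I A x)\<bar> \<le> t * ip I x x"
proof -
  obtain e u where eb: "eigenbasis I A e u" using eigenbasis_exists[OF fin sym] .
  have "\<bar>e i\<bar> \<le> t" if "i < card I" for i
  proof -
    have "\<bar>e i\<bar> ^ L = e i ^ L" using L by (simp add: power_even_abs)
    also have "\<dots> \<le> (\<Sum>i<card I. e i ^ L)"
      using that L by (intro member_le_sum[of i "{..<card I}" "\<lambda>i. e i ^ L"]) (auto simp: zero_le_even_power)
    also have "\<dots> \<le> t ^ L" using trace trace_funpow[OF fin eb] by simp
    finally show ?thesis using t L by (simp add: power_mono_iff)
  qed
  then show ?thesis by (rule quadratic_form_bound_of_eigenvalues[OF fin sym eb])
qed

subsection \<open>Random edges\<close>

abbreviation bernoulli_edges :: "'b set \<Rightarrow> real \<Rightarrow> ('b \<Rightarrow> bool) pmf" where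
  "bernoulli_edges A p \<equiv> Pi_pmf A False (\<lambda>_. bernoulli_pmf p)"

lemma finite_set_bernoulli_edges: "finite A \<Longrightarrow> finite (set_pmf (bernoulli_edges A p))"
  by (auto simp: set_Pi_pmf)

lemma integrable_bernoulli_edges:
  fixes g :: "('b \<Rightarrow> bool) \<Rightarrow> real"
  shows "finite A \<Longrightarrow> integrable (measure_pmf (bernoulli_edges A p)) g"
  by (intro integrable_measure_pmf_finite finite_set_bernoulli_edges)

lemma expectation_prod_bernoulli_edges:
  fixes g :: "'b \<Rightarrow> bool \<Rightarrow> real"
  assumes A: "finite A" and p: "0 \<le> p" "p \<le> 1"
  shows "measure_pmf.expectation (bernoulli_edges A p) (\<lambda>f. \<Prod>e\<in>A. g e (f e)) =
    (\<Prod>e\<in>A. p * g e True + (1 - p) * g e False)"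
proof -
  let ?E = "measure_pmf.expectation (bernoulli_edges A p)"
  have "prob_space.indep_vars (measure_pmf (bernoulli_edges A p)) (\<lambda>_. count_space UNIV) (\<lambda>e f. f e) A" by (rule indep_vars_Pi_pmf[OF A])
  then have "prob_space.indep_vars (measure_pmf (bernoulli_edges A p)) (\<lambda>_. borel) (\<lambda>e f. g e (f e)) A"
    by (rule prob_space.indep_vars_compose2[OF prob_space_measure_pmf, where Y = g]) auto
  then have "?E (\<lambda>f. \<Prod>e\<in>A. g e (f e)) = (\<Prod>e\<in>A. ?E (\<lambda>f. g e (f e)))"
    using A by (intro prob_space.indep_vars_lebesgue_integral[OF prob_space_measure_pmf] integrable_bernoulli_edges)
  also have "\<dots> = (\<Prod>e\<in>A. p * g e True + (1 - p) * g e False)"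
  proof (rule prod.cong)
    fix e assume "e \<in> A"
    have "?E (\<lambda>f. g e (f e)) = measure_pmf.expectation (map_pmf (\<lambda>f. f e) (bernoulli_edges A p)) (g e)"
      by simp
    also have "map_pmf (\<lambda>f. f e) (bernoulli_edges A p) = bernoulli_pmf p"
      using A \<open>e \<in> A\<close> by (simp add: Pi_pmf_component)
    finally show "?E (\<lambda>f. g e (f e)) = p * g e True + (1 - p) * g e False"
      using p by (simp add: mult.commute)
  qed simp
  finally show ?thesis .
qed

lemma prob_ge_le_expectation:
  fixes u :: "('b \<Rightarrow> bool) \<Rightarrow> real"
  assumes "finite A" "\<And>f. 0 \<le> u f" "0 < c"
  shows "measure_pmf.prob (bernoulli_edges A p) {f. c \<le> u f} \<le> measure_pmf.expectation (bernoulli_edges A p) u / c"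
  using integral_Markov_inequality_measure[of "measure_pmf (bernoulli_edges A p)" u UNIV c]
    integrable_bernoulli_edges[OF assms(1), of p u] assms by simp

lemma prod_list_eq_prod_count:
  fixes Y :: "'b \<Rightarrow> real"
  assumes "finite A" "set h \<subseteq> A"
  shows "(\<Prod>e\<leftarrow>h. Y e) = (\<Prod>e\<in>A. Y e ^ count_list h e)"
  using assms(2)
proof (induction h)
  case (Cons a h)
  have "(\<Prod>e\<in>A. Y e ^ count_list (a # h) e) = (\<Prod>e\<in>A. (if e = a then Y e else 1) * Y e ^ count_list h e)"
    by (intro prod.cong) auto
  also have "\<dots> = Y a * (\<Prod>e\<in>A. Y e ^ count_list h e)"
    using assms(1) Cons.prems by (simp add: prod.distrib)
  finally show ?case using Cons by simp
qed simp

text \<open>Taking out \<open>p * (1 - p)\<close> leaves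
  \<open>(1 - p) ^ (c - 1) + p ^ (c - 1)\<close>, at most \<open>(1 - p) + p\<close>. Thus an edge
  used at least twice costs one factor \<open>q\<close>, however often it recurs.\<close>

lemma bernoulli_central_moment_le:
  fixes p :: real
  assumes p: "0 \<le> p" "p \<le> 1" and c: "2 \<le> c"
  shows "\<bar>p * (1 - p) ^ c + (1 - p) * (0 - p) ^ c\<bar> \<le> p * (1 - p)"
proof -
  obtain k where k: "c = Suc (Suc k)" using c by (metis add_2_eq_Suc le_Suc_ex)
  have 1: "(1 - p) ^ Suc k \<le> (1 - p)" "p ^ Suc k \<le> p"
    using p power_decreasing[of 1 "Suc k" "1 - p"] power_decreasing[of 1 "Suc k" p] by auto
  have "\<bar>p * (1 - p) ^ c + (1 - p) * (0 - p) ^ c\<bar> \<le> p * (1 - p) ^ c + (1 - p) * p ^ c"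
  proof (rule order_trans[OF abs_triangle_ineq])
    show "\<bar>p * (1 - p) ^ c\<bar> + \<bar>(1 - p) * (0 - p) ^ c\<bar> \<le> p * (1 - p) ^ c + (1 - p) * p ^ c"
      using p by (simp add: abs_mult power_abs)
  qed
  also have "\<dots> = p * (1 - p) * ((1 - p) ^ Suc k + p ^ Suc k)" by (simp add: k algebra_simps)
  also have "\<dots> \<le> p * (1 - p) * 1" using 1 p by (intro mult_left_mono) auto
  finally show ?thesis by simp
qed

text \<open>An edge used exactly once makes the expectation vanish, while the weight is nonnegative.
  Otherwise no edge is open, the factors \<open>1 / \<sigma>\<close> are absent and the power of
  \<open>\<eta>\<close> is at least 1. Hence \<open>\<sigma>\<close> and \<open>\<eta>\<close> are
  free parameters of the bound.\<close>

lemma expectation_prod_list_le_walk_weight: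
  assumes A: "finite A" "set h \<subseteq> A" and p: "0 \<le> p" "p \<le> 1" and \<sigma>: "0 < \<sigma>" and \<eta>: "1 \<le> \<eta>"
  shows "measure_pmf.expectation (bernoulli_edges A p) (\<lambda>f. \<Prod>e\<leftarrow>h. of_bool (f e) - p)
    \<le> walk_weight I (p * (1 - p)) \<sigma> \<eta> h S"
proof -
  define \<mu> where "\<mu> = (\<lambda>c::nat. p * (1 - p) ^ c + (1 - p) * (0 - p) ^ c)"
  have "measure_pmf.expectation (bernoulli_edges A p) (\<lambda>f. \<Prod>e\<leftarrow>h. of_bool (f e) - p) =
      measure_pmf.expectation (bernoulli_edges A p) (\<lambda>f. \<Prod>e\<in>A. (\<lambda>b. (of_bool b - p) ^ count_list h e) (f e))"
    by (simp add: prod_list_eq_prod_count[OF A])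
  also have "\<dots> = (\<Prod>e\<in>A. \<mu> (count_list h e))"
    by (subst expectation_prod_bernoulli_edges[OF A(1) p]) (simp add: \<mu>_def)
  also have "\<dots> = (\<Prod>e\<in>set h. \<mu> (count_list h e))"
    using A by (intro prod.mono_neutral_right) (auto simp: \<mu>_def count_list_0_iff)
  also have "\<dots> \<le> walk_weight I (p * (1 - p)) \<sigma> \<eta> h S"
  proof (cases "open_edges h = {}")
    case True
    have "(\<Prod>e\<in>set h. \<mu> (count_list h e)) \<le> (\<Prod>e\<in>set h. \<bar>\<mu> (count_list h e)\<bar>)"
      by (metis abs_ge_self abs_prod)
    also have "\<dots> \<le> (\<Prod>e\<in>set h. p * (1 - p))"
    proof (intro prod_mono conjI)
      fix e assume e: "e \<in> set h"
      then have "count_list h e \<noteq> 0" "count_list h e \<noteq> 1" using True by (auto simp: open_edges_def count_list_0_iff)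
      then have "2 \<le> count_list h e" by linarith
      from bernoulli_central_moment_le[OF p this] show "\<bar>\<mu> (count_list h e)\<bar> \<le> p * (1 - p)" by (simp add: \<mu>_def)
    qed simp
    also have "\<dots> \<le> (p * (1 - p)) ^ card (set h) * \<eta> ^ potential I h S"
      using p \<eta> one_le_power[OF \<eta>, of "potential I h S"] mult_left_mono[of 1 "\<eta> ^ potential I h S" "(p * (1 - p)) ^ card (set h)"]
      by simp
    finally show ?thesis by (simp add: walk_weight_def True)
  next
    case False
    then obtain e where e: "e \<in> set h" "count_list h e = 1" by (auto simp: open_edges_def)
    have "\<mu> 1 = 0" by (simp add: \<mu>_def algebra_simps)
    then have 0: "(\<Prod>e\<in>set h. \<mu> (count_list h e)) = 0" using e by (intro prod_zero bexI[of _ e]) simp_all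
    show ?thesis unfolding 0 using p \<sigma> \<eta> by (intro walk_weight_nonneg) auto
  qed
  finally show ?thesis .
qed

lemma expectation_walk_sum:
  assumes "finite A"
  shows "measure_pmf.expectation (bernoulli_edges A p) (\<lambda>f. walk_sum V r s (F f) m h S) =
    walk_sum V r s (\<lambda>h T. measure_pmf.expectation (bernoulli_edges A p) (\<lambda>f. F f h T)) m h S"
proof (induction m arbitrary: h S)
  case (Suc m)
  show ?case unfolding walk_sum.simps
    by (simp add: Bochner_Integration.integral_sum integrable_bernoulli_edges[OF assms] Suc.IH)
qed simp

lemma expectation_trace_le:
  fixes V :: "'a set" and r s :: nat
  assumes V: "finite V" and s: "1 \<le> s" and sr: "s < r" and n: "s < card V" and L: "1 \<le> L"
    and p: "0 \<le> p" "p \<le> 1" and \<sigma>: "0 < \<sigma>" "\<sigma>\<^sup>2 = p * (1 - p) * real ((card V - s) choose (r - s))"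
  shows "measure_pmf.expectation (bernoulli_edges (nsets V r) p)
      (\<lambda>f. \<Sum>S\<in>nsets V s. (mv (nsets V s) (signed_weight V r (\<lambda>e. of_bool (f e) - p)) ^^ L) (\<lambda>T. of_bool (T = S)) S)
    \<le> real (card V choose s) * (real ((r - s) choose s) *
        (\<sigma> * (2 + real (s + r * L) * real (r - s) / real (card V - s) * real L ^ ((r choose s) + 1)) + real L ^ 2)) ^ L"
    (is "?lhs \<le> _ * ?\<rho> ^ L")
proof -
  define A where "A = nsets V r"
  have A: "finite A" using V by (simp add: A_def finite_imp_finite_nsets)
  define w where "w = walk_weight (nsets V s) (p * (1 - p)) \<sigma> (real L)"
  have w0: "0 \<le> w h T" for h T unfolding w_def using p \<sigma> L by (intro walk_weight_nonneg) auto
  have bound: "measure_pmf.expectation (bernoulli_edges A p)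
      (\<lambda>f. (mv (nsets V s) (signed_weight V r (\<lambda>e. of_bool (f e) - p)) ^^ L) (\<lambda>T. of_bool (T = S)) S) \<le> ?\<rho> ^ L"
    if S: "S \<in> nsets V s" for S
  proof -
    have "measure_pmf.expectation (bernoulli_edges A p)
        (\<lambda>f. (mv (nsets V s) (signed_weight V r (\<lambda>e. of_bool (f e) - p)) ^^ L) (\<lambda>T. of_bool (T = S)) S)
      = measure_pmf.expectation (bernoulli_edges A p)
          (\<lambda>f. walk_sum V r s (\<lambda>h T. (\<Prod>e\<leftarrow>h. of_bool (f e) - p) * of_bool (T = S)) L [] S)"
      by (simp add: walk_sum_prod_list[OF V, where Y = "\<lambda>e. of_bool (_ e) - p"])
    also have "\<dots> = walk_sum V r s (\<lambda>h T. measure_pmf.expectation (bernoulli_edges A p)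
          (\<lambda>f. (\<Prod>e\<leftarrow>h. of_bool (f e) - p) * of_bool (T = S))) L [] S"
      by (rule expectation_walk_sum[OF A])
    also have "\<dots> \<le> walk_sum V r s w L [] S"
    proof (rule walk_sum_mono[OF S])
      fix h T assume h: "set h \<subseteq> nsets V r" and "T \<in> nsets V s"
      have "measure_pmf.expectation (bernoulli_edges A p) (\<lambda>f. \<Prod>e\<leftarrow>h. of_bool (f e) - p) \<le> w h T"
        unfolding w_def using A h p \<sigma> L by (intro expectation_prod_list_le_walk_weight) (auto simp: A_def)
      \<comment> \<open>Walks that do not return to \<open>S\<close> contribute 0 on the left and a
        nonnegative weight on the right, so the bound may run over all walks from
        \<open>S\<close>.\<close>
      then show "measure_pmf.expectation (bernoulli_edges A p) (\<lambda>f. (\<Prod>e\<leftarrow>h. of_bool (f e) - p) * of_bool (T = S)) \<le> w h T"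
        using w0[of h T] by (cases "T = S") auto
    qed simp
    also have "\<dots> \<le> ?\<rho> ^ L" unfolding w_def
      using V s sr n L p \<sigma> S by (intro walk_sum_weight_le) auto
    finally show ?thesis .
  qed
  have "?lhs = (\<Sum>S\<in>nsets V s. measure_pmf.expectation (bernoulli_edges A p)
      (\<lambda>f. (mv (nsets V s) (signed_weight V r (\<lambda>e. of_bool (f e) - p)) ^^ L) (\<lambda>T. of_bool (T = S)) S))"
    unfolding A_def[symmetric] by (intro Bochner_Integration.integral_sum integrable_bernoulli_edges[OF A])
  also have "\<dots> \<le> (\<Sum>S\<in>nsets V s. ?\<rho> ^ L)" by (intro sum_mono bound)
  also have "\<dots> = real (card V choose s) * ?\<rho> ^ L" using V by (simp add: card_nsets)
  finally show ?thesis .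
qed

text \<open>Markov's inequality for the trace of the \<open>L\<close>-th power: if some
  \<open>x\<close> violates the bound on the form, the trace is at least
  \<open>t ^ L\<close>.\<close>

lemma prob_quadratic_form_large:
  fixes V :: "'a set" and r s :: nat
  assumes V: "finite V" and s: "1 \<le> s" and sr: "s < r" and n: "s < card V" and L: "even L" "0 < L"
    and p: "0 \<le> p" "p \<le> 1" and \<sigma>: "0 < \<sigma>" "\<sigma>\<^sup>2 = p * (1 - p) * real ((card V - s) choose (r - s))"
    and t: "0 < t"
  shows "measure_pmf.prob (bernoulli_edges (nsets V r) p)
      {f. \<not> (\<forall>x. \<bar>ip (nsets V s) x (mv (nsets V s) (signed_weight V r (\<lambda>e. of_bool (f e) - p)) x)\<bar>
              \<le> t * ip (nsets V s) x x)}
    \<le> real (card V choose s) * (real ((r - s) choose s) *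
        (\<sigma> * (2 + real (s + r * L) * real (r - s) / real (card V - s) * real L ^ ((r choose s) + 1)) + real L ^ 2) / t) ^ L"
    (is "measure_pmf.prob ?P ?B \<le> _ * (?\<rho> / t) ^ L")
proof -
  have finI: "finite (nsets V s)" "finite (nsets V r)" using V by (auto simp: finite_imp_finite_nsets)
  define M where "M = (\<lambda>f. signed_weight V r (\<lambda>e. of_bool (f e) - p))"
  have sym: "symm (nsets V s) (M f)" for f unfolding M_def by (rule symm_signed_weight)
  define tr where "tr = (\<lambda>f. \<Sum>S\<in>nsets V s. (mv (nsets V s) (M f) ^^ L) (\<lambda>T. of_bool (T = S)) S)"
  have tr0: "tr f \<ge> 0" for f
  proof -
    obtain e u where "eigenbasis (nsets V s) (M f) e u" using eigenbasis_exists[OF finI(1) sym] .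
    then show ?thesis unfolding tr_def using L
      by (subst trace_funpow[OF finI(1)]) (auto intro!: sum_nonneg simp: zero_le_even_power)
  qed
  have "\<bar>ip (nsets V s) x (mv (nsets V s) (M f) x)\<bar> \<le> t * ip (nsets V s) x x" if "\<not> t ^ L \<le> tr f" for f x
    using that t by (intro quadratic_form_bound_of_trace[OF finI(1) sym L]) (auto simp: tr_def)
  then have "?B \<subseteq> {f. t ^ L \<le> tr f}" unfolding M_def by blast
  then have "measure_pmf.prob ?P ?B \<le> measure_pmf.prob ?P {f. t ^ L \<le> tr f}"
    by (intro measure_pmf.finite_measure_mono) auto
  also have "\<dots> \<le> measure_pmf.expectation ?P tr / t ^ L"
    using t tr0 finI by (intro prob_ge_le_expectation) auto
  also have "\<dots> \<le> real (card V choose s) * ?\<rho> ^ L / t ^ L"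
    unfolding tr_def M_def using assms by (intro divide_right_mono expectation_trace_le) auto
  also have "\<dots> = real (card V choose s) * (?\<rho> / t) ^ L" by (simp add: power_divide)
  finally show ?thesis .
qed

section \<open>Exponential moment bound for the degrees\<close>

lemma exp_le_quadratic:
  fixes x :: real
  assumes "\<bar>x\<bar> \<le> 1"
  shows "exp x \<le> 1 + x + x\<^sup>2"
proof (cases "0 \<le> x")
  case True
  then show ?thesis using assms by (intro exp_bound) auto
next
  case False
  define y where "y = - x"
  have y: "0 \<le> y" using False by (simp add: y_def)
  \<comment> \<open>For a negative argument the claim is multiplied by \<open>exp y\<close>. The
    quadratic Taylor bound of \<open>exp y\<close> suffices, because in this product the linear
    terms cancel and the others are nonnegative.\<close>
  have 1: "(1 - y + y\<^sup>2) * (1 + y + y\<^sup>2 / 2) = 1 + (y\<^sup>2 + y ^ 3 + y ^ 4) / 2"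
    by (simp add: field_simps power2_eq_square power3_eq_cube power4_eq_xxxx)
  have pos: "0 \<le> 1 - y + y\<^sup>2"
    using assms False zero_le_power2[of y] by (simp add: y_def)
  have "1 \<le> (1 - y + y\<^sup>2) * (1 + y + y\<^sup>2 / 2)" unfolding 1 using y by simp
  also have "\<dots> \<le> (1 - y + y\<^sup>2) * exp y"
    using y pos by (intro mult_left_mono exp_lower_Taylor_quadratic) auto
  finally have "exp (- y) \<le> 1 - y + y\<^sup>2" by (simp add: exp_minus field_simps)
  then show ?thesis by (simp add: y_def)
qed

lemma bernoulli_mgf_le:
  fixes p t :: real
  assumes p: "0 \<le> p" "p \<le> 1" and t: "\<bar>t\<bar> \<le> 1"
  shows "p * exp (t * (1 - p)) + (1 - p) * exp (t * (0 - p)) \<le> exp (t\<^sup>2 * (p * (1 - p)))"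
proof -
  have "\<bar>t * (1 - p)\<bar> \<le> 1" "\<bar>t * (0 - p)\<bar> \<le> 1" using p t by (auto simp: abs_mult intro: mult_le_one)
  then have "p * exp (t * (1 - p)) + (1 - p) * exp (t * (0 - p)) \<le>
      p * (1 + t * (1 - p) + (t * (1 - p))\<^sup>2) + (1 - p) * (1 + t * (0 - p) + (t * (0 - p))\<^sup>2)"
    using p by (intro add_mono mult_left_mono exp_le_quadratic) auto
  also have "\<dots> = 1 + t\<^sup>2 * (p * (1 - p))" by (simp add: algebra_simps power2_eq_square)
  also have "\<dots> \<le> exp (t\<^sup>2 * (p * (1 - p)))" by (rule exp_ge_add_one_self)
  finally show ?thesis .
qed

definition degree_deviation :: "'a set \<Rightarrow> nat \<Rightarrow> real \<Rightarrow> ('a set \<Rightarrow> bool) \<Rightarrow> 'a set \<Rightarrow> real" where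
  "degree_deviation V r p f S = (\<Sum>e\<in>nsets V r. of_bool (S \<subseteq> e) * (of_bool (f e) - p))"

lemma prob_scaled_degree_deviation_ge:
  assumes V: "finite V" and S: "S \<in> nsets V s" and sr: "s < r" and p: "0 \<le> p" "p \<le> 1" and t: "\<bar>t\<bar> \<le> 1"
  shows "measure_pmf.prob (bernoulli_edges (nsets V r) p) {f. a \<le> t * degree_deviation V r p f S}
    \<le> exp (t\<^sup>2 * (p * (1 - p)) * real ((card V - s) choose (r - s)) - a)"
proof -
  define A where "A = nsets V r"
  have A: "finite A" using V by (simp add: A_def finite_imp_finite_nsets)
  define q where "q = t\<^sup>2 * (p * (1 - p))"
  define g where "g = (\<lambda>e b. exp (t * of_bool (S \<subseteq> e) * (of_bool b - p)))"
  have "measure_pmf.prob (bernoulli_edges A p) {f. a \<le> t * degree_deviation V r p f S}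
      = measure_pmf.prob (bernoulli_edges A p) {f. exp a \<le> exp (t * degree_deviation V r p f S)}" by simp
  also have "\<dots> \<le> measure_pmf.expectation (bernoulli_edges A p) (\<lambda>f. exp (t * degree_deviation V r p f S)) / exp a"
    using A by (intro prob_ge_le_expectation) auto
  also have "(\<lambda>f. exp (t * degree_deviation V r p f S)) = (\<lambda>f. \<Prod>e\<in>A. g e (f e))"
    by (rule ext) (simp only: degree_deviation_def g_def A_def[symmetric] sum_distrib_left exp_sum[OF A] mult.assoc)
  also have "measure_pmf.expectation (bernoulli_edges A p) (\<lambda>f. \<Prod>e\<in>A. g e (f e)) =
      (\<Prod>e\<in>A. p * g e True + (1 - p) * g e False)"
    by (rule expectation_prod_bernoulli_edges[OF A p])
  also have "\<dots> \<le> (\<Prod>e\<in>A. exp (q * of_bool (S \<subseteq> e)))"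
  proof (intro prod_mono conjI)
    fix e assume "e \<in> A"
    show "0 \<le> p * g e True + (1 - p) * g e False" using p by (simp add: g_def)
    show "p * g e True + (1 - p) * g e False \<le> exp (q * of_bool (S \<subseteq> e))"
      using bernoulli_mgf_le[OF p t] by (cases "S \<subseteq> e") (simp_all add: g_def q_def)
  qed
  also have "\<dots> = exp (q * (\<Sum>e\<in>A. of_bool (S \<subseteq> e)))" by (simp only: exp_sum[OF A] sum_distrib_left)
  also have "(\<Sum>e\<in>A. of_bool (S \<subseteq> e)) = real (card {e \<in> A. S \<subseteq> e})"
    using A by (simp only: sum_of_bool_eq Int_def mem_Collect_eq)
  also have "card {e \<in> A. S \<subseteq> e} = (card V - s) choose (r - s)"
    using card_nsets_superset[of V S r] V S sr by (auto simp: A_def nsets_def)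
  finally show ?thesis by (simp add: A_def q_def exp_diff divide_right_mono)
qed

lemma prob_degree_deviation_large:
  assumes V: "finite V" and sr: "s < r" and p: "0 \<le> p" "p \<le> 1"
    and \<sigma>: "1 \<le> \<sigma>" "\<sigma>\<^sup>2 = p * (1 - p) * real ((card V - s) choose (r - s))"
  shows "measure_pmf.prob (bernoulli_edges (nsets V r) p)
      {f. \<exists>S\<in>nsets V s. a * \<sigma> \<le> \<bar>degree_deviation V r p f S\<bar>}
    \<le> real (card V choose s) * (2 * exp (1 - a))"
proof -
  define P where "P = bernoulli_edges (nsets V r) p"
  define X where "X = degree_deviation V r p"
  have single: "measure_pmf.prob P {f. a * \<sigma> \<le> \<bar>X f S\<bar>} \<le> 2 * exp (1 - a)" if S: "S \<in> nsets V s" for S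
  proof -
    \<comment> \<open>With \<open>\<bar>t\<bar> = 1 / \<sigma>\<close> the variance term in the
      exponent equals 1, whence \<open>exp (1 - a)\<close>; \<open>1 \<le> \<sigma>\<close> keeps
      \<open>t\<close> in the range of the moment bound.\<close>
    have tail: "measure_pmf.prob P {f. a \<le> t * X f S} \<le> exp (1 - a)" if "\<bar>t\<bar> = 1 / \<sigma>" for t
    proof -
      have t2: "t\<^sup>2 = 1 / \<sigma>\<^sup>2" using that by (metis power2_abs power_one_over)
      have "t\<^sup>2 * (p * (1 - p)) * real ((card V - s) choose (r - s)) = t\<^sup>2 * \<sigma>\<^sup>2"
        unfolding \<sigma>(2) by (simp only: mult.assoc)
      also have "\<dots> = 1" unfolding t2 using \<sigma>(1) by simp
      finally have "t\<^sup>2 * (p * (1 - p)) * real ((card V - s) choose (r - s)) = 1" .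
      then show ?thesis unfolding P_def X_def
        using prob_scaled_degree_deviation_ge[OF V S sr p, of t a] that \<sigma> by simp
    qed
    have "{f. a * \<sigma> \<le> \<bar>X f S\<bar>} \<subseteq> {f. a \<le> 1 / \<sigma> * X f S} \<union> {f. a \<le> - 1 / \<sigma> * X f S}"
      using \<sigma> by (auto simp: field_simps abs_if split: if_splits)
    then have "measure_pmf.prob P {f. a * \<sigma> \<le> \<bar>X f S\<bar>} \<le>
        measure_pmf.prob P ({f. a \<le> 1 / \<sigma> * X f S} \<union> {f. a \<le> - 1 / \<sigma> * X f S})"
      by (intro measure_pmf.finite_measure_mono) auto
    also have "\<dots> \<le> measure_pmf.prob P {f. a \<le> 1 / \<sigma> * X f S} + measure_pmf.prob P {f. a \<le> - 1 / \<sigma> * X f S}"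
      by (rule measure_Un_le) auto
    also have "\<dots> \<le> 2 * exp (1 - a)" using tail[of "1 / \<sigma>"] tail[of "- 1 / \<sigma>"] \<sigma> by simp
    finally show ?thesis .
  qed
  have "{f. \<exists>S\<in>nsets V s. a * \<sigma> \<le> \<bar>X f S\<bar>} = (\<Union>S\<in>nsets V s. {f. a * \<sigma> \<le> \<bar>X f S\<bar>})" by auto
  then have "measure_pmf.prob P {f. \<exists>S\<in>nsets V s. a * \<sigma> \<le> \<bar>X f S\<bar>} \<le>
      (\<Sum>S\<in>nsets V s. measure_pmf.prob P {f. a * \<sigma> \<le> \<bar>X f S\<bar>})"
    using V by (auto intro!: measure_pmf.finite_measure_subadditive_finite finite_imp_finite_nsets)
  also have "\<dots> \<le> (\<Sum>S\<in>nsets V s. 2 * exp (1 - a))" by (intro sum_mono single)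
  also have "\<dots> = real (card V choose s) * (2 * exp (1 - a))" using V by (simp add: card_nsets)
  finally show ?thesis by (simp add: P_def X_def)
qed

subsection \<open>Perturbation of the spectrum\<close>

lemma ip_const_left: "ip I (\<lambda>_. c) z = c * (\<Sum>S\<in>I. z S)"
  by (simp add: ip_def sum_distrib_left)

lemma scaled_quadratic_form:
  assumes m: "\<And>S. S \<in> I \<Longrightarrow> 0 < m S"
    and fin: "finite I" and A: "\<And>S T. S \<in> I \<Longrightarrow> T \<in> I \<Longrightarrow> A S T = of_bool (S = T) - G S T / (sqrt (m S) * sqrt (m T))"
  shows "ip I (\<lambda>S. sqrt (m S) * z S) (mv I A (\<lambda>S. sqrt (m S) * z S)) = (\<Sum>S\<in>I. m S * (z S)\<^sup>2) - ip I z (mv I G z)"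
proof -
  have "sqrt (m S) * z S * mv I A (\<lambda>S. sqrt (m S) * z S) S = m S * (z S)\<^sup>2 - z S * mv I G z S" if S: "S \<in> I" for S
  proof -
    have "mv I A (\<lambda>S. sqrt (m S) * z S) S = (\<Sum>T\<in>I. (if T = S then sqrt (m T) * z T else 0) - G S T * z T / sqrt (m S))"
      unfolding mv_def
    proof (rule sum.cong)
      fix T assume T: "T \<in> I"
      have "sqrt (m T) > 0" using m[OF T] by simp
      then show "A S T * (sqrt (m T) * z T) = (if T = S then sqrt (m T) * z T else 0) - G S T * z T / sqrt (m S)"
        by (simp add: A[OF S T] algebra_simps)
    qed simp
    also have "\<dots> = sqrt (m S) * z S - mv I G z S / sqrt (m S)"
      using fin S by (simp add: sum_subtractf sum_divide_distrib[symmetric] mv_def)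
    finally have eq: "mv I A (\<lambda>S. sqrt (m S) * z S) S = sqrt (m S) * z S - mv I G z S / sqrt (m S)" .
    have "x * y * (x * y - g / x) = x * x * y\<^sup>2 - y * g" if "x > 0" for x y g :: real
      using that by (simp add: right_diff_distrib power2_eq_square)
    from this[of "sqrt (m S)" "z S" "mv I G z S"] show ?thesis unfolding eq using m[OF S] by simp
  qed
  then show ?thesis by (simp add: ip_def sum_subtractf cong: sum.cong)
qed

lemma scaled_norm:
  assumes "\<And>S. S \<in> I \<Longrightarrow> 0 < m S"
  shows "ip I (\<lambda>S. sqrt (m S) * z S) (\<lambda>S. sqrt (m S) * z S) = (\<Sum>S\<in>I. m S * (z S)\<^sup>2)"
  unfolding ip_def
proof (rule sum.cong)
  fix S assume "S \<in> I"
  then have "sqrt (m S) * sqrt (m S) = m S" using assms[of S] by simp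
  then show "sqrt (m S) * z S * (sqrt (m S) * z S) = m S * (z S)\<^sup>2"
    by (metis (no_types, lifting) mult.assoc mult.left_commute power2_eq_square)
qed simp

lemma eigenbasis_norm_sum:
  assumes "eigenbasis I A e u" "J \<subseteq> {..<card I}"
  shows "ip I (\<lambda>S. \<Sum>i\<in>J. c i * u i S) (\<lambda>S. \<Sum>i\<in>J. c i * u i S) = (\<Sum>i\<in>J. (c i)\<^sup>2)"
proof -
  have "ip I (\<lambda>S. \<Sum>i\<in>J. c i * u i S) (\<lambda>S. \<Sum>i\<in>J. c i * u i S) =
      (\<Sum>j\<in>J. c j * ip I (\<lambda>S. \<Sum>i\<in>J. c i * u i S) (u j))"
    by (simp add: ip_sum_right[of I "\<lambda>S. \<Sum>i\<in>J. c i * u i S"] ip_scale_right)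
  also have "\<dots> = (\<Sum>j\<in>J. (c j)\<^sup>2)"
  proof (rule sum.cong)
    fix j assume j: "j \<in> J"
    then have "j < card I" using assms by auto
    from eigenbasis_ip_sum[OF assms this] j show "c j * ip I (\<lambda>S. \<Sum>i\<in>J. c i * u i S) (u j) = (c j)\<^sup>2"
      by (simp add: power2_eq_square)
  qed simp
  finally show ?thesis .
qed

lemma eigenbasis_quadratic_form_sum:
  assumes "eigenbasis I A e u" "J \<subseteq> {..<card I}"
  shows "ip I (\<lambda>S. \<Sum>i\<in>J. c i * u i S) (mv I A (\<lambda>S. \<Sum>i\<in>J. c i * u i S)) = (\<Sum>i\<in>J. e i * (c i)\<^sup>2)"
proof -
  have "ip I (\<lambda>S. \<Sum>i\<in>J. c i * u i S) (mv I A (\<lambda>S. \<Sum>i\<in>J. c i * u i S)) =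
      ip I (\<lambda>S. \<Sum>i\<in>J. c i * u i S) (\<lambda>S. \<Sum>j\<in>J. (c j * e j) * u j S)"
  proof (rule ip_cong)
    fix S assume "S \<in> I"
    then show "mv I A (\<lambda>S. \<Sum>i\<in>J. c i * u i S) S = (\<Sum>j\<in>J. (c j * e j) * u j S)"
      unfolding mv_sum mv_scale using assms by (intro sum.cong) (auto simp: eigenbasis_mv[OF assms(1)])
  qed simp
  also have "\<dots> = (\<Sum>j\<in>J. c j * e j * ip I (\<lambda>S. \<Sum>i\<in>J. c i * u i S) (u j))"
    by (simp add: ip_sum_right[of I "\<lambda>S. \<Sum>i\<in>J. c i * u i S"] ip_scale_right)
  also have "\<dots> = (\<Sum>j\<in>J. e j * (c j)\<^sup>2)"
  proof (rule sum.cong)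
    fix j assume j: "j \<in> J"
    then have "j < card I" using assms by auto
    from eigenbasis_ip_sum[OF assms this] j
    show "c j * e j * ip I (\<lambda>S. \<Sum>i\<in>J. c i * u i S) (u j) = e j * (c j)\<^sup>2"
      by (simp add: power2_eq_square)
  qed simp
  finally show ?thesis .
qed

lemma sum_mult_squared_le:
  fixes x y :: "'a \<Rightarrow> real"
  assumes "\<And>S. S \<in> I \<Longrightarrow> \<bar>x S\<bar> \<le> \<tau>"
  shows "(\<Sum>S\<in>I. x S * y S)\<^sup>2 \<le> real (card I) * \<tau>\<^sup>2 * (\<Sum>S\<in>I. (y S)\<^sup>2)"
proof -
  have "(\<Sum>S\<in>I. x S * y S)\<^sup>2 \<le> (\<Sum>S\<in>I. (x S)\<^sup>2) * (\<Sum>S\<in>I. (y S)\<^sup>2)"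
    by (rule Cauchy_Schwarz_ineq_sum)
  also have "\<dots> \<le> (\<Sum>S\<in>I. \<tau>\<^sup>2) * (\<Sum>S\<in>I. (y S)\<^sup>2)"
    using order_trans[OF assms abs_ge_self] by (intro mult_right_mono sum_mono sum_nonneg) (auto simp: abs_le_square_iff[symmetric])
  finally show ?thesis by simp
qed

text \<open>
  Since \<open>G\<close> has row sums \<open>m\<close>, the form \<open>\<Sum>S. m S * (z S)\<^sup>2 - ip I z (mv I G z)\<close> does not change when a
  constant is added to \<open>z\<close>. This makes the effect of the degrees \<open>m\<close> on the upper bound quadratic in \<open>\<tau>\<close>.
\<close>

lemma eigenvalue_perturbation_le:
  assumes fin: "finite I" and symA: "symm I A" and symG: "symm I G"
    and ebA: "eigenbasis I A e v" and monoA: "\<And>i j. i \<le> j \<Longrightarrow> j < card I \<Longrightarrow> e i \<le> e j"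
    and ebB: "eigenbasis I B l u" and monoB: "\<And>i j. i \<le> j \<Longrightarrow> j < card I \<Longrightarrow> l i \<le> l j"
    and \<tau>: "0 \<le> \<tau>" "\<tau> < 1" and m: "\<And>S. S \<in> I \<Longrightarrow> \<bar>m S - 1\<bar> \<le> \<tau>"
    and A: "\<And>S T. S \<in> I \<Longrightarrow> T \<in> I \<Longrightarrow> A S T = of_bool (S = T) - G S T / (sqrt (m S) * sqrt (m T))"
    and rows: "\<And>S. S \<in> I \<Longrightarrow> (\<Sum>T\<in>I. G S T) = m S"
    and GB: "\<And>z. \<bar>ip I z (mv I G z) - (ip I z z - ip I z (mv I B z))\<bar> \<le> \<beta> * ip I z z"
    and orth: "\<And>i. 1 \<le> i \<Longrightarrow> i < card I \<Longrightarrow> (\<Sum>S\<in>I. u i S) = 0"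
    and \<kappa>: "\<kappa> \<le> 1" "\<And>i. 1 \<le> i \<Longrightarrow> i < card I \<Longrightarrow> \<bar>1 - l i\<bar> \<le> \<kappa>"
    and num: "0 \<le> \<epsilon>" "\<kappa> * \<tau> + \<beta> + (1 + \<kappa> + \<epsilon>) * \<tau>\<^sup>2 / (1 - \<tau>) \<le> \<epsilon> * (1 - \<tau>)"
    and k: "1 \<le> k" "k < card I"
  shows "e k \<le> l k + \<epsilon>"
proof -
  have mpos: "0 < m S" if "S \<in> I" for S using m[OF that] \<tau> by (simp add: abs_le_iff)
  \<comment> \<open>The test space is spanned by the constant, placed at index 0 instead of
    \<open>u 0\<close>, and by \<open>u 1, ..., u k\<close>; the factor \<open>sqrt (m S)\<close> is
    the change of coordinates.\<close>
  define w where "w = (\<lambda>i S. sqrt (m S) * (if i = 0 then 1 else u i S))"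
  define zz where "zz = (\<lambda>c::nat \<Rightarrow> real. \<lambda>S. \<Sum>i\<in>{1..k}. c i * u i S)"
  have sub: "{1..k} \<subseteq> {..<card I}" using k by auto
  have w_sum: "(\<Sum>i\<le>k. c i * w i S) = sqrt (m S) * (c 0 + zz c S)" for c S
  proof -
    have "(\<Sum>i\<le>k. c i * w i S) = c 0 * w 0 S + (\<Sum>i\<in>{1..k}. c i * w i S)"
      by (simp add: sum.atMost_shift sum.atLeast1_atMost_eq lessThan_Suc_atMost)
    also have "(\<Sum>i\<in>{1..k}. c i * w i S) = (\<Sum>i\<in>{1..k}. sqrt (m S) * (c i * u i S))"
      by (intro sum.cong) (auto simp: w_def)
    finally show ?thesis by (simp add: w_def zz_def sum_distrib_left algebra_simps)
  qed
  have zz_orth: "(\<Sum>S\<in>I. zz c S) = 0" for c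
  proof -
    have "(\<Sum>S\<in>I. zz c S) = (\<Sum>i\<in>{1..k}. c i * (\<Sum>S\<in>I. u i S))"
      unfolding zz_def sum_distrib_left by (rule sum.swap)
    also have "\<dots> = 0" using orth k by (intro sum.neutral) auto
    finally show ?thesis .
  qed
  show ?thesis
  proof (rule eigenvalue_le_of_subspace[OF fin symA ebA monoA k(2), where w = w])
    fix c assume 0: "\<And>S. S \<in> I \<Longrightarrow> (\<Sum>i\<le>k. c i * w i S) = 0"
    have z: "c 0 + zz c S = 0" if "S \<in> I" for S
      using 0[OF that] mpos[OF that] unfolding w_sum by simp
    have "0 = (\<Sum>S\<in>I. c 0 + zz c S)" using z by simp
    also have "\<dots> = real (card I) * c 0" using zz_orth[of c] by (simp add: sum.distrib)
    finally have c0: "c 0 = 0" using k by simp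
    have "c j = 0" if "j \<in> {1..k}" for j
    proof -
      have "0 = ip I (zz c) (u j)" using z c0 by (simp add: ip_def)
      also have "\<dots> = c j" unfolding zz_def
        using eigenbasis_ip_sum[OF ebB sub, of j c] that k by auto
      finally show ?thesis by simp
    qed
    then show "\<forall>i\<le>k. c i = 0" using c0 by (metis One_nat_def Suc_leI atLeastAtMost_iff bot_nat_0.not_eq_extremum)
  next
    fix c
    define z where "z = zz c"
    define a where "a = ip I z z"
    define A' where "A' = (\<Sum>S\<in>I. m S * (z S)\<^sup>2)"
    define \<mu> where "\<mu> = (\<Sum>S\<in>I. m S * z S)"
    define Z where "Z = (\<Sum>S\<in>I. m S)"
    have a0: "a \<ge> 0" by (simp add: a_def ip_self_nonneg)
    have a: "a = (\<Sum>S\<in>I. (z S)\<^sup>2)" by (simp add: a_def ip_def power2_eq_square)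
    have "l i * (c i)\<^sup>2 \<le> l k * (c i)\<^sup>2" if "i \<in> {1..k}" for i
      using that k by (intro mult_right_mono monoB) auto
    then have "ip I z (mv I B z) \<le> l k * a"
      unfolding a_def z_def zz_def eigenbasis_quadratic_form_sum[OF ebB sub] eigenbasis_norm_sum[OF ebB sub] sum_distrib_left
      by (intro sum_mono) auto
    then have G_ge: "ip I z (mv I G z) \<ge> (1 - l k) * a - \<beta> * a"
      using GB[of z] unfolding a_def[symmetric] by (simp add: algebra_simps abs_le_iff)
    have G1: "mv I G (\<lambda>S. c 0 + z S) S = c 0 * m S + mv I G z S" if "S \<in> I" for S
    proof -
      have "mv I G (\<lambda>S. c 0 + z S) S = c 0 * (\<Sum>T\<in>I. G S T) + mv I G z S"
        by (simp add: mv_def algebra_simps sum.distrib sum_distrib_left)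
      then show ?thesis using rows[OF that] by simp
    qed
    have "ip I (\<lambda>S. c 0 + z S) (mv I G (\<lambda>S. c 0 + z S)) = ip I (\<lambda>S. c 0 + z S) (\<lambda>S. c 0 * m S + mv I G z S)"
      by (rule ip_cong) (auto simp: G1)
    also have "\<dots> = c 0 * c 0 * Z + c 0 * \<mu> + c 0 * (\<Sum>S\<in>I. mv I G z S) + ip I z (mv I G z)"
      by (simp add: ip_add_left ip_add_right ip_scale_right ip_const_left Z_def \<mu>_def ip_def algebra_simps sum_distrib_left)
    also have "(\<Sum>S\<in>I. mv I G z S) = \<mu>"
    proof -
      have "(\<Sum>S\<in>I. mv I G z S) = ip I (\<lambda>_. 1) (mv I G z)" by (simp add: ip_def)
      also have "\<dots> = ip I (mv I G (\<lambda>_. 1)) z" by (rule ip_mv_symm[OF symG])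
      also have "\<dots> = ip I m z" by (rule ip_cong) (auto simp: mv_def rows)
      finally show ?thesis by (simp add: ip_def \<mu>_def)
    qed
    finally have Gshift: "ip I (\<lambda>S. c 0 + z S) (mv I G (\<lambda>S. c 0 + z S)) = c 0 * c 0 * Z + 2 * (c 0 * \<mu>) + ip I z (mv I G z)"
      by simp
    have mshift: "(\<Sum>S\<in>I. m S * (c 0 + z S)\<^sup>2) = c 0 * c 0 * Z + 2 * (c 0 * \<mu>) + A'"
      by (simp add: A'_def \<mu>_def Z_def power2_eq_square algebra_simps sum.distrib sum_distrib_left)
    have y: "(\<lambda>S. \<Sum>i\<le>k. c i * w i S) = (\<lambda>S. sqrt (m S) * (c 0 + z S))" by (simp add: w_sum z_def)
    \<comment> \<open>Orthogonality of \<open>z\<close> to the constants replaces \<open>m\<close>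
      by \<open>m - 1\<close>, so \<open>\<mu>\<close> is of first order in \<open>\<tau>\<close>;
      only its square enters the final estimate.\<close>
    have "\<mu> = (\<Sum>S\<in>I. (m S - 1) * z S)"
      using zz_orth[of c] by (simp add: \<mu>_def z_def algebra_simps sum_subtractf)
    then have \<mu>2: "\<mu>\<^sup>2 \<le> real (card I) * \<tau>\<^sup>2 * a"
      unfolding a using sum_mult_squared_le[of I "\<lambda>S. m S - 1" \<tau> z] m by simp
    have "1 - \<tau> \<le> m S" if "S \<in> I" for S using m[OF that] by (simp add: abs_le_iff)
    then have "Z \<ge> (\<Sum>S\<in>I. 1 - \<tau>)" unfolding Z_def by (intro sum_mono)
    then have Z: "Z \<ge> real (card I) * (1 - \<tau>)" by simp
    moreover have "real (card I) * (1 - \<tau>) > 0" using k \<tau> by simp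
    ultimately have Zpos: "Z > 0" by linarith
    have "\<mu>\<^sup>2 / Z \<le> (real (card I) * \<tau>\<^sup>2 * a) / (real (card I) * (1 - \<tau>))"
      using \<mu>2 Z \<open>real (card I) * (1 - \<tau>) > 0\<close> a0 by (intro frac_le) auto
    also have "\<dots> = \<tau>\<^sup>2 / (1 - \<tau>) * a" using k by simp
    finally have \<mu>Z: "\<mu>\<^sup>2 / Z \<le> \<tau>\<^sup>2 / (1 - \<tau>) * a" .
    \<comment> \<open>Completing the square in \<open>c 0\<close>: the shift by a constant lowers
      the norm by at most \<open>\<mu>\<^sup>2 / Z\<close>, which is quadratic in
      \<open>\<tau>\<close>.\<close>
    have "0 \<le> (c 0 * Z + \<mu>)\<^sup>2 / Z" using Zpos by simp
    also have "\<dots> = c 0 * c 0 * Z + 2 * (c 0 * \<mu>) + \<mu>\<^sup>2 / Z"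
      using Zpos by (simp add: field_simps power2_eq_square)
    finally have norm_ge: "c 0 * c 0 * Z + 2 * (c 0 * \<mu>) + A' \<ge> A' - \<tau>\<^sup>2 / (1 - \<tau>) * a" using \<mu>Z by linarith
    have A'_le: "\<bar>A' - a\<bar> \<le> \<tau> * a"
    proof -
      have "A' - a = (\<Sum>S\<in>I. (m S - 1) * (z S)\<^sup>2)" by (simp add: A'_def a algebra_simps sum_subtractf)
      also have "\<bar>\<dots>\<bar> \<le> (\<Sum>S\<in>I. \<tau> * (z S)\<^sup>2)"
        by (rule order_trans[OF sum_abs]) (auto intro!: sum_mono mult_right_mono m simp: abs_mult)
      finally show ?thesis by (simp add: a sum_distrib_left)
    qed
    have lk: "\<bar>1 - l k\<bar> \<le> \<kappa>" using \<kappa>(2) k by simp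
    define t where "t = l k + \<epsilon>"
    \<comment> \<open>\<open>\<kappa> \<le> 1\<close> makes \<open>t\<close> nonnegative, as
      required to multiply the lower bound of the norm by \<open>t\<close>.\<close>
    have t0: "0 \<le> t" "t \<le> 1 + \<kappa> + \<epsilon>" using lk \<kappa>(1) num(1) by (auto simp: t_def abs_le_iff)
    have e1: "(1 - l k) * (A' - a) \<le> \<kappa> * (\<tau> * a)"
    proof -
      have "(1 - l k) * (A' - a) \<le> \<bar>1 - l k\<bar> * \<bar>A' - a\<bar>" by (metis abs_ge_self abs_mult)
      also have "\<dots> \<le> \<kappa> * (\<tau> * a)" using lk A'_le by (intro mult_mono) auto
      finally show ?thesis .
    qed
    have e2: "t * (\<tau>\<^sup>2 / (1 - \<tau>) * a) \<le> (1 + \<kappa> + \<epsilon>) * (\<tau>\<^sup>2 / (1 - \<tau>) * a)"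
      using t0 a0 \<tau> by (intro mult_right_mono) auto
    have e3: "\<epsilon> * A' \<ge> \<epsilon> * (1 - \<tau>) * a"
    proof -
      have "A' \<ge> (1 - \<tau>) * a" using A'_le by (simp add: abs_le_iff algebra_simps)
      then show ?thesis using num(1) by (metis mult.assoc mult_left_mono)
    qed
    have e4: "(\<kappa> * \<tau> + \<beta> + (1 + \<kappa> + \<epsilon>) * \<tau>\<^sup>2 / (1 - \<tau>)) * a \<le> \<epsilon> * (1 - \<tau>) * a"
      using num(2) a0 by (rule mult_right_mono)
    have "ip I (\<lambda>S. sqrt (m S) * (c 0 + z S)) (mv I A (\<lambda>S. sqrt (m S) * (c 0 + z S))) =
        (\<Sum>S\<in>I. m S * (c 0 + z S)\<^sup>2) - ip I (\<lambda>S. c 0 + z S) (mv I G (\<lambda>S. c 0 + z S))"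
      by (rule scaled_quadratic_form[OF mpos fin A])
    then have "ip I (\<lambda>S. \<Sum>i\<le>k. c i * w i S) (mv I A (\<lambda>S. \<Sum>i\<le>k. c i * w i S)) = A' - ip I z (mv I G z)"
      unfolding y Gshift mshift by simp
    also have "\<dots> \<le> t * (A' - \<tau>\<^sup>2 / (1 - \<tau>) * a)"
    proof -
      have "t * (A' - \<tau>\<^sup>2 / (1 - \<tau>) * a) = l k * A' + \<epsilon> * A' - t * (\<tau>\<^sup>2 / (1 - \<tau>) * a)"
        by (simp add: t_def algebra_simps)
      moreover have "(\<kappa> * \<tau> + \<beta> + (1 + \<kappa> + \<epsilon>) * \<tau>\<^sup>2 / (1 - \<tau>)) * a = \<kappa> * (\<tau> * a) + \<beta> * a + (1 + \<kappa> + \<epsilon>) * (\<tau>\<^sup>2 / (1 - \<tau>) * a)"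
        by (simp add: distrib_right)
      moreover have "(1 - l k) * (A' - a) = A' - l k * A' - (1 - l k) * a" by (simp add: algebra_simps)
      ultimately show ?thesis using e1 e2 e3 e4 G_ge by linarith
    qed
    also have "\<dots> \<le> t * (c 0 * c 0 * Z + 2 * (c 0 * \<mu>) + A')" using norm_ge t0(1) by (intro mult_left_mono)
    also have "\<dots> = t * ip I (\<lambda>S. \<Sum>i\<le>k. c i * w i S) (\<lambda>S. \<Sum>i\<le>k. c i * w i S)"
    proof -
      have "ip I (\<lambda>S. sqrt (m S) * (c 0 + z S)) (\<lambda>S. sqrt (m S) * (c 0 + z S)) = (\<Sum>S\<in>I. m S * (c 0 + z S)\<^sup>2)"
        by (rule scaled_norm[OF mpos])
      then show ?thesis unfolding y mshift by simp
    qed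
    finally show "ip I (\<lambda>S. \<Sum>i\<le>k. c i * w i S) (mv I A (\<lambda>S. \<Sum>i\<le>k. c i * w i S))
      \<le> (l k + \<epsilon>) * ip I (\<lambda>S. \<Sum>i\<le>k. c i * w i S) (\<lambda>S. \<Sum>i\<le>k. c i * w i S)" by (simp add: t_def)
  qed
qed

text \<open>The test space is the span of \<open>sqrt m * u i\<close> for \<open>i \<ge> k\<close>.
  The degrees enter the form and the norm through the same \<open>A'\<close>, so their linear effect
  is \<open>(1 - l k) * (A' - a)\<close>; this is why \<open>\<tau>\<close> carries the factor
  \<open>\<kappa>\<close>.\<close>

lemma eigenvalue_perturbation_ge:
  assumes fin: "finite I" and symA: "symm I A"
    and ebA: "eigenbasis I A e v" and monoA: "\<And>i j. i \<le> j \<Longrightarrow> j < card I \<Longrightarrow> e i \<le> e j"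
    and ebB: "eigenbasis I B l u" and monoB: "\<And>i j. i \<le> j \<Longrightarrow> j < card I \<Longrightarrow> l i \<le> l j"
    and \<tau>: "0 \<le> \<tau>" "\<tau> < 1" and m: "\<And>S. S \<in> I \<Longrightarrow> \<bar>m S - 1\<bar> \<le> \<tau>"
    and A: "\<And>S T. S \<in> I \<Longrightarrow> T \<in> I \<Longrightarrow> A S T = of_bool (S = T) - G S T / (sqrt (m S) * sqrt (m T))"
    and GB: "\<And>z. \<bar>ip I z (mv I G z) - (ip I z z - ip I z (mv I B z))\<bar> \<le> \<beta> * ip I z z"
    and lk: "\<bar>1 - l k\<bar> \<le> \<kappa>"
    and num: "0 \<le> \<epsilon>" "\<kappa> * \<tau> + \<beta> \<le> \<epsilon> * (1 - \<tau>)"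
    and k: "k < card I"
  shows "l k - \<epsilon> \<le> e k"
proof -
  have mpos: "0 < m S" if "S \<in> I" for S using m[OF that] \<tau> by (simp add: abs_le_iff)
  define w where "w = (\<lambda>i S. sqrt (m S) * u i S)"
  define zz where "zz = (\<lambda>c::nat \<Rightarrow> real. \<lambda>S. \<Sum>i\<in>{k..<card I}. c i * u i S)"
  have sub: "{k..<card I} \<subseteq> {..<card I}" by auto
  have w_sum: "(\<Sum>i\<in>{k..<card I}. c i * w i S) = sqrt (m S) * zz c S" for c S
    by (simp add: w_def zz_def sum_distrib_left algebra_simps)
  show ?thesis
  proof (rule eigenvalue_ge_of_subspace[OF fin symA ebA monoA k, where w = w])
    fix c assume 0: "\<And>S. S \<in> I \<Longrightarrow> (\<Sum>i\<in>{k..<card I}. c i * w i S) = 0"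
    have z: "zz c S = 0" if "S \<in> I" for S
      using 0[OF that] mpos[OF that] unfolding w_sum by simp
    have "c j = 0" if "j \<in> {k..<card I}" for j
    proof -
      have "0 = ip I (zz c) (u j)" using z by (simp add: ip_def)
      also have "\<dots> = c j" unfolding zz_def
        using eigenbasis_ip_sum[OF ebB sub, of j c] that k by auto
      finally show ?thesis by simp
    qed
    then show "\<forall>i\<in>{k..<card I}. c i = 0" by blast
  next
    fix c
    define z where "z = zz c"
    define a where "a = ip I z z"
    define A' where "A' = (\<Sum>S\<in>I. m S * (z S)\<^sup>2)"
    define g where "g = ip I z (mv I G z)"
    have a0: "a \<ge> 0" by (simp add: a_def ip_self_nonneg)
    have a: "a = (\<Sum>S\<in>I. (z S)\<^sup>2)" by (simp add: a_def ip_def power2_eq_square)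
    have "l k * (c i)\<^sup>2 \<le> l i * (c i)\<^sup>2" if "i \<in> {k..<card I}" for i
      using that by (intro mult_right_mono monoB) auto
    then have "ip I z (mv I B z) \<ge> l k * a"
      unfolding a_def z_def zz_def eigenbasis_quadratic_form_sum[OF ebB sub] eigenbasis_norm_sum[OF ebB sub] sum_distrib_left
      by (intro sum_mono) auto
    then have G_le: "g \<le> (1 - l k) * a + \<beta> * a"
      using GB[of z] unfolding a_def[symmetric] g_def[symmetric] by (simp add: algebra_simps abs_le_iff)
    have y: "(\<lambda>S. \<Sum>i\<in>{k..<card I}. c i * w i S) = (\<lambda>S. sqrt (m S) * z S)" by (simp add: w_sum z_def)
    have A'_le: "\<bar>A' - a\<bar> \<le> \<tau> * a"
    proof -
      have "A' - a = (\<Sum>S\<in>I. (m S - 1) * (z S)\<^sup>2)" by (simp add: A'_def a algebra_simps sum_subtractf)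
      also have "\<bar>\<dots>\<bar> \<le> (\<Sum>S\<in>I. \<tau> * (z S)\<^sup>2)"
        by (rule order_trans[OF sum_abs]) (auto intro!: sum_mono mult_right_mono m simp: abs_mult)
      finally show ?thesis by (simp add: a sum_distrib_left)
    qed
    have e1: "- (\<kappa> * (\<tau> * a)) \<le> (1 - l k) * (A' - a)"
    proof -
      have "\<bar>(1 - l k) * (A' - a)\<bar> \<le> \<kappa> * (\<tau> * a)" unfolding abs_mult using lk A'_le by (intro mult_mono) auto
      then show ?thesis by (simp add: abs_le_iff)
    qed
    have e3: "\<epsilon> * A' \<ge> \<epsilon> * (1 - \<tau>) * a"
    proof -
      have "A' \<ge> (1 - \<tau>) * a" using A'_le by (simp add: abs_le_iff algebra_simps)
      then show ?thesis using num(1) by (metis mult.assoc mult_left_mono)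
    qed
    have e4: "(\<kappa> * \<tau> + \<beta>) * a \<le> \<epsilon> * (1 - \<tau>) * a"
      using num(2) a0 by (rule mult_right_mono)
    have "(l k - \<epsilon>) * A' \<le> A' - g"
    proof -
      have gen: "x1 - x2 \<le> A' - g" if "- x3 \<le> x7" "x6 \<le> x2" "x3 + x4 \<le> x6" "g \<le> x5 + x4" "x7 = A' - x1 - x5"
        for x1 x2 x3 x4 x5 x6 x7 using that by linarith
      have e4': "\<kappa> * (\<tau> * a) + \<beta> * a \<le> \<epsilon> * (1 - \<tau>) * a" using e4 by (simp only: distrib_right mult.assoc)
      have "(1 - l k) * (A' - a) = A' - l k * A' - (1 - l k) * a" by (simp add: algebra_simps)
      from gen[OF e1 e3 e4' G_le this] show ?thesis by (simp only: left_diff_distrib)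
    qed
    moreover have "ip I (\<lambda>S. sqrt (m S) * z S) (mv I A (\<lambda>S. sqrt (m S) * z S)) = A' - g"
      unfolding A'_def g_def by (rule scaled_quadratic_form[OF mpos fin A])
    moreover have "ip I (\<lambda>S. sqrt (m S) * z S) (\<lambda>S. sqrt (m S) * z S) = A'"
      unfolding A'_def by (rule scaled_norm[OF mpos])
    ultimately show "(l k - \<epsilon>) * ip I (\<lambda>S. \<Sum>i\<in>{k..<card I}. c i * w i S) (\<lambda>S. \<Sum>i\<in>{k..<card I}. c i * w i S)
      \<le> ip I (\<lambda>S. \<Sum>i\<in>{k..<card I}. c i * w i S) (mv I A (\<lambda>S. \<Sum>i\<in>{k..<card I}. c i * w i S))"
      unfolding y by simp
  qed
qed

text \<open>\<open>B\<close> is the identity minus the normalised Kneser matrix, and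
  \<open>\<kappa>\<close> is the bound of \<open>disjointness_eigenvalue_bound\<close> divided by
  the valency \<open>c\<close>. The delicate point is that the eigenvalue 0, which belongs to the
  constants, is simple, so that every later eigenvector is orthogonal to them.\<close>

lemma complete_spectrum:
  fixes V :: "'a set" and s :: nat
  defines "I \<equiv> nsets V s" and "c \<equiv> real ((card V - s) choose s)"
  assumes V: "finite V" and s: "1 \<le> s" and n: "2 * s < card V"
    and eb: "eigenbasis I B l u" and mono: "\<And>i j. i \<le> j \<Longrightarrow> j < card I \<Longrightarrow> l i \<le> l j"
    and B: "\<And>S T. S \<in> I \<Longrightarrow> T \<in> I \<Longrightarrow> B S T = of_bool (S = T) - of_bool (S \<inter> T = {}) / c"
    and i: "1 \<le> i" "i < card I"
  shows "(\<Sum>S\<in>I. u i S) = 0" and "\<bar>1 - l i\<bar> \<le> real s / (real (card V) - real s)"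
proof -
  define \<kappa> where "\<kappa> = real s / (real (card V) - real s)"
  have fin: "finite I" using V by (simp add: I_def finite_imp_finite_nsets)
  have c: "c > 0" using n by (simp add: c_def)
  have sym: "symm I B" by (auto simp: symm_def B Int_commute)
  have \<kappa>1: "\<kappa> < 1" using n by (simp add: \<kappa>_def)
  have \<kappa>: "real ((card V - s - 1) choose (s - 1)) = \<kappa> * c"
  proof -
    have "s * ((card V - s) choose s) = (card V - s) * ((card V - s - 1) choose (s - 1))"
      using s by (intro times_binomial_minus1_eq) simp
    then have "real s * c = real (card V - s) * real ((card V - s - 1) choose (s - 1))"
      unfolding c_def by (metis of_nat_mult)
    then show ?thesis using n by (simp add: \<kappa>_def field_simps of_nat_diff)
  qed
  have mvB: "mv I B x S = x S - (\<Sum>T\<in>I. of_bool (S \<inter> T = {}) * x T) / c" if "S \<in> I" for x S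
  proof -
    have "mv I B x S = (\<Sum>T\<in>I. (if T = S then x T else 0) - of_bool (S \<inter> T = {}) * x T / c)"
      unfolding mv_def by (intro sum.cong) (auto simp: B that left_diff_distrib)
    then show ?thesis using fin that by (simp only: sum_subtractf sum_divide_distrib sum.delta if_True)
  qed
  have eigen_bound: "\<bar>1 - \<theta>\<bar> \<le> \<kappa>"
    if x: "\<And>S. S \<in> I \<Longrightarrow> mv I B x S = \<theta> * x S" "(\<Sum>S\<in>I. x S) = 0" "S0 \<in> I" "x S0 \<noteq> 0" for x \<theta> S0
  proof -
    have "(\<Sum>T\<in>I. of_bool (S \<inter> T = {}) * x T) = (c * (1 - \<theta>)) * x S" if "S \<in> I" for S
      using x(1)[OF that] c unfolding mvB[OF that] by (simp add: field_simps)
    then have "\<bar>c * (1 - \<theta>)\<bar> \<le> real ((card V - s - 1) choose (s - 1))"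
      using V s n x unfolding I_def by (intro disjointness_eigenvalue_bound[of V s x _ S0]) auto
    then have "c * \<bar>1 - \<theta>\<bar> \<le> c * \<kappa>" unfolding \<kappa> using c by (simp add: abs_mult mult.commute)
    then show ?thesis using c by simp
  qed
  have row: "mv I B (\<lambda>_. 1) S = 0" if "S \<in> I" for S
  proof -
    have "(\<Sum>T\<in>I. of_bool (S \<inter> T = {}) * (1::real)) = real (card {T \<in> I. T \<inter> S = {}})"
      using fin by (simp only: mult_1_right sum_of_bool_eq Int_def mem_Collect_eq) (simp add: conj_commute Int_def)
    also have "\<dots> = c" using card_nsets_between[of V "{}" S s] V that
      by (simp add: c_def I_def nsets_def)
    finally show ?thesis using mvB[OF that, of "\<lambda>_. 1"] c by simp
  qed
  have ortho: "l j * (\<Sum>S\<in>I. u j S) = 0" if "j < card I" for j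
  proof -
    have "l j * (\<Sum>S\<in>I. u j S) = ip I (\<lambda>_. 1) (\<lambda>S. l j * u j S)" by (simp add: ip_def sum_distrib_left)
    also have "\<dots> = ip I (\<lambda>_. 1) (mv I B (u j))" by (rule ip_cong) (auto simp: eigenbasis_mv[OF eb that])
    also have "\<dots> = ip I (mv I B (\<lambda>_. 1)) (u j)" by (rule ip_mv_symm[OF sym])
    also have "\<dots> = 0" by (simp add: ip_def row)
    finally show ?thesis .
  qed
  have nz: "\<exists>S\<in>I. u j S \<noteq> 0" if "j < card I" for j
  proof (rule ccontr)
    assume "\<not> ?thesis"
    then have "ip I (u j) (u j) = 0" by (simp add: ip_def)
    then show False using eigenbasis_ip[OF eb that that] by simp
  qed
  have bound: "\<bar>1 - l j\<bar> \<le> \<kappa>" if "j < card I" "(\<Sum>S\<in>I. u j S) = 0" for j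
    using nz[OF that(1)] eigen_bound[of "u j" "l j"] eigenbasis_mv[OF eb that(1)] that(2) by blast
  have 0: "0 < card I" using i by simp
  have "l i \<noteq> 0"
  proof
    assume li: "l i = 0"
    \<comment> \<open>A nonzero \<open>l 0\<close> would make \<open>u 0\<close> orthogonal to the
      constants, so \<open>l 0\<close> would be positive by \<open>\<kappa> < 1\<close> and exceed
      \<open>l i = 0\<close>, against the order.\<close>
    have l0: "l 0 = 0"
    proof (rule ccontr)
      assume "l 0 \<noteq> 0"
      then have "\<bar>1 - l 0\<bar> \<le> \<kappa>" using ortho[OF 0] bound[OF 0] by simp
      then have "l 0 > 0" using \<kappa>1 by (simp add: abs_le_iff)
      then show False using mono[of 0 i] i li by simp
    qed
    define a b where "a = (\<Sum>S\<in>I. u 0 S)" and "b = (\<Sum>S\<in>I. u i S)"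
    \<comment> \<open>In a kernel of dimension two this combination is orthogonal to the constants,
      and \<open>\<kappa> < 1\<close> excludes an eigenvector of that kind with eigenvalue
      0.\<close>
    define x where "x = (\<lambda>S. b * u 0 S + (- a) * u i S)"
    have "a \<noteq> 0" using bound[OF 0] l0 \<kappa>1 by (auto simp: a_def)
    have "mv I B x S = 0 * x S" if "S \<in> I" for S
      unfolding x_def mv_add mv_scale using eigenbasis_mv[OF eb 0 that] eigenbasis_mv[OF eb i(2) that] l0 li by simp
    moreover have "(\<Sum>S\<in>I. x S) = 0"
      by (simp add: x_def a_def b_def sum.distrib sum_subtractf sum_distrib_left[symmetric])
    moreover have "\<exists>S\<in>I. x S \<noteq> 0"
    proof (rule ccontr)
      assume "\<not> (\<exists>S\<in>I. x S \<noteq> 0)"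
      then have "0 = ip I x (u i)" by (simp add: ip_def)
      also have "\<dots> = - a"
        unfolding x_def ip_add_left ip_scale_left using eigenbasis_ip[OF eb 0 i(2)] eigenbasis_ip[OF eb i(2) i(2)] i by simp
      finally show False using \<open>a \<noteq> 0\<close> by simp
    qed
    ultimately have "\<bar>1 - 0\<bar> \<le> \<kappa>" using eigen_bound[of x 0] by blast
    then show False using \<kappa>1 by simp
  qed
  then show "(\<Sum>S\<in>I. u i S) = 0" using ortho[OF i(2)] by simp
  then show "\<bar>1 - l i\<bar> \<le> real s / (real (card V) - real s)" using bound[OF i(2)] by (simp add: \<kappa>_def)
qed

section \<open>The normalised Laplacian as an instance of the perturbation problem\<close>

lemma hdegree_eq_sum:
  assumes "finite V" "E \<subseteq> nsets V r"
  shows "real (hdegree E U) = (\<Sum>e\<in>nsets V r. of_bool (U \<subseteq> e) * of_bool (e \<in> E))"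
proof -
  have "(\<Sum>e\<in>nsets V r. of_bool (U \<subseteq> e) * of_bool (e \<in> E)) = (\<Sum>e\<in>nsets V r. of_bool (U \<subseteq> e \<and> e \<in> E) :: real)"
    by (simp only: of_bool_conj)
  also have "\<dots> = real (card {e \<in> nsets V r. U \<subseteq> e \<and> e \<in> E})"
    using assms(1) by (simp only: finite_imp_finite_nsets sum_of_bool_eq Int_def mem_Collect_eq)
  also have "{e \<in> nsets V r. U \<subseteq> e \<and> e \<in> E} = {e \<in> E. U \<subseteq> e}" using assms(2) by auto
  finally show ?thesis by (simp add: hdegree_def)
qed

lemma weight_eq_signed_weight:
  assumes "finite V" "E \<subseteq> nsets V r"
  shows "weight E S T = signed_weight V r (\<lambda>e. of_bool (e \<in> E)) S T"
proof (cases "S \<inter> T = {}")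
  case True
  then show ?thesis unfolding weight_def signed_weight_def hdegree_eq_sum[OF assms]
    by (auto intro!: sum.cong)
next
  case False
  then show ?thesis by (auto simp: weight_def signed_weight_def Int_commute)
qed

lemma signed_weight_row_sum:
  assumes V: "finite V" and S: "S \<in> nsets V s"
  shows "(\<Sum>T\<in>nsets V s. signed_weight V r Y S T) = real ((r - s) choose s) * (\<Sum>e\<in>nsets V r. of_bool (S \<subseteq> e) * Y e)"
proof -
  have cardT: "card {T \<in> nsets e s. T \<inter> S = {}} = (r - s) choose s" if "e \<in> nsets V r" "S \<subseteq> e" for e
    using card_nsets_between[of e "{}" S s] that S by (simp add: nsets_def)
  have "(\<Sum>T\<in>nsets V s. signed_weight V r Y S T) = mv (nsets V s) (signed_weight V r Y) (\<lambda>_. 1) S"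
    by (simp add: mv_def)
  also have "\<dots> = (\<Sum>e\<in>{e \<in> nsets V r. S \<subseteq> e}. real ((r - s) choose s) * Y e)"
    unfolding mv_signed_weight[OF V] by (intro sum.cong refl) (simp add: cardT)
  also have "\<dots> = (\<Sum>e\<in>nsets V r. of_bool (S \<subseteq> e) * (real ((r - s) choose s) * Y e))"
    using V by (intro sum.mono_neutral_cong_left) (auto simp: finite_imp_finite_nsets)
  finally show ?thesis by (simp only: sum_distrib_left mult.left_commute)
qed

text \<open>With \<open>Y\<close> the indicator of the edges this is the decomposition
  \<open>W = p W\<^sub>K + M\<close>.\<close>

lemma signed_weight_affine:
  "signed_weight V r Y S T = p * signed_weight V r (\<lambda>_. 1) S T + signed_weight V r (\<lambda>e. Y e - p) S T"
  by (simp only: signed_weight_def sum_distrib_left sum.distrib[symmetric]) (intro sum.cong refl, simp add: algebra_simps)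

text \<open>The Laplacian entrywise. Division by 0 agrees with the convention of
  \<open>inv_sqrt_T\<close> at sets of degree 0, so it describes the matrix for every
  \<open>E\<close>.\<close>

definition lap_entry :: "nat \<Rightarrow> nat \<Rightarrow> 'a set set \<Rightarrow> 'a set \<Rightarrow> 'a set \<Rightarrow> real" where
  "lap_entry r s E S T = of_bool (S = T) - weight E S T /
     (sqrt (real ((r - s) choose s) * real (hdegree E S)) * sqrt (real ((r - s) choose s) * real (hdegree E T)))"

lemma laplacian_eq_subset_mat:
  assumes "finite V"
  shows "laplacian V r s E = subset_mat V s (lap_entry r s E)"
proof -
  define N where "N = card (nsets V s)"
  define F where "F = from_nat_into (nsets V s)"
  define a where "a = (\<lambda>i. 1 / sqrt (real ((r - s) choose s) * real (hdegree E (F i))))"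
  have "bij_betw F {..<N} (nsets V s)"
    unfolding F_def N_def using assms by (intro bij_betw_from_nat_into_finite finite_imp_finite_nsets)
  then have inj: "F i = F j \<longleftrightarrow> i = j" if "i < N" "j < N" for i j
    using that by (auto simp: bij_betw_def inj_on_def)
  define P where "P = Matrix.mat N N (\<lambda>(i, j). if i = j then a i else 0)"
  define W where "W = subset_mat V s (weight E)"
  have P: "inv_sqrt_T V r s E = P"
    unfolding inv_sqrt_T_def subset_mat_def N_def[symmetric] F_def[symmetric]
    by (rule eq_matI) (auto simp: P_def inj a_def)
  have W: "W = Matrix.mat N N (\<lambda>(i, j). weight E (F i) (F j))" by (simp add: W_def subset_mat_def N_def F_def)
  have carr: "P \<in> carrier_mat N N" "W \<in> carrier_mat N N" by (auto simp: P_def W)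
  have PW: "(P * W) $$ (i, j) = a i * weight E (F i) (F j)" if "i < N" "j < N" for i j
  proof -
    have "(P * W) $$ (i, j) = (\<Sum>k<N. (if i = k then a i else 0) * weight E (F k) (F j))"
      using that by (simp add: P_def W scalar_prod_def lessThan_atLeast0)
    also have "\<dots> = (\<Sum>k<N. if k = i then a i * weight E (F k) (F j) else 0)" by (intro sum.cong) auto
    also have "\<dots> = a i * weight E (F i) (F j)" using that by simp
    finally show ?thesis .
  qed
  have PWP: "(P * W * P) $$ (i, j) = a i * weight E (F i) (F j) * a j" if "i < N" "j < N" for i j
  proof -
    have "(Q * P) $$ (i, j) = (\<Sum>k<N. Q $$ (i, k) * P $$ (k, j))" if "Q \<in> carrier_mat N N" for Q
      using that \<open>i < N\<close> \<open>j < N\<close> carr by (simp add: scalar_prod_def lessThan_atLeast0)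
    then have "(P * W * P) $$ (i, j) = (\<Sum>k<N. (P * W) $$ (i, k) * P $$ (k, j))"
      using carr mult_carrier_mat by blast
    also have "\<dots> = (\<Sum>k<N. if k = j then a i * weight E (F i) (F k) * a k else 0)"
    proof (rule sum.cong)
      fix k assume "k \<in> {..<N}"
      then have "P $$ (k, j) = (if k = j then a k else 0)" using that by (simp add: P_def)
      then show "(P * W) $$ (i, k) * P $$ (k, j) = (if k = j then a i * weight E (F i) (F k) * a k else 0)"
        using PW[of i k] that \<open>k \<in> {..<N}\<close> by simp
    qed simp
    also have "\<dots> = a i * weight E (F i) (F j) * a j" using that by simp
    finally show ?thesis .
  qed
  have "laplacian V r s E = 1\<^sub>m N - P * W * P" by (simp add: laplacian_def P W_def N_def)
  also have "\<dots> = subset_mat V s (lap_entry r s E)"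
  proof (rule eq_matI)
    fix i j assume "i < dim_row (subset_mat V s (lap_entry r s E))" "j < dim_col (subset_mat V s (lap_entry r s E))"
    then have ij: "i < N" "j < N" by (auto simp: subset_mat_def N_def)
    have "(1\<^sub>m N - P * W * P) $$ (i, j) = (if i = j then 1 else 0) - a i * weight E (F i) (F j) * a j"
      using ij carr PWP[OF ij] by simp
    also have "\<dots> = lap_entry r s E (F i) (F j)" using inj[OF ij] by (simp add: lap_entry_def a_def)
    also have "\<dots> = subset_mat V s (lap_entry r s E) $$ (i, j)" using ij by (simp add: subset_mat_def N_def F_def)
    finally show "(1\<^sub>m N - P * W * P) $$ (i, j) = subset_mat V s (lap_entry r s E) $$ (i, j)" .
  qed (use carr in \<open>auto simp: subset_mat_def N_def\<close>)
  finally show ?thesis .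
qed

lemma symm_lap_entry: "symm I (lap_entry r s E)"
  by (auto simp: symm_def lap_entry_def weight_def Int_commute Un_commute mult.commute)

text \<open>Joins the sorted list behind \<open>laplacian_eigenvalue\<close> to an orthonormal
  eigenbasis in the same order, the form in which the minimax lemmas take it.\<close>

lemma laplacian_eigenbasis:
  assumes V: "finite V"
  obtains u where "eigenbasis (nsets V s) (lap_entry r s E) (laplacian_eigenvalue V r s E) u"
    and "\<And>i j. i \<le> j \<Longrightarrow> j < card (nsets V s) \<Longrightarrow> laplacian_eigenvalue V r s E i \<le> laplacian_eigenvalue V r s E j"
proof -
  define es where "es = sorted_list_of_multiset (proots (char_poly (laplacian V r s E)))"
  have ev: "laplacian_eigenvalue V r s E = (\<lambda>i. es ! i)" by (simp add: fun_eq_iff laplacian_eigenvalue_def es_def)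
  have fin: "finite (nsets V s)" using V by (rule finite_imp_finite_nsets)
  note sd = spectral_decomposition[OF fin symm_lap_entry[of _ r s E] bij_betw_from_nat_into_finite[OF fin],
      folded subset_mat_def laplacian_eq_subset_mat[OF V], folded es_def]
  have "sorted es" by (simp add: es_def)
  then have "es ! i \<le> es ! j" if "i \<le> j" "j < card (nsets V s)" for i j
    using that sd(1) by (auto intro: sorted_nth_mono)
  moreover obtain u where "eigenbasis (nsets V s) (lap_entry r s E) (\<lambda>i. es ! i) u"
    using sd(2) unfolding eigenbasis_def by blast
  ultimately show ?thesis using that unfolding ev by blast
qed

lemma lap_entry_complete:
  assumes V: "finite V" and s: "2 * s \<le> r" and r: "r \<le> card V" and S: "S \<in> nsets V s" and T: "T \<in> nsets V s"
  shows "lap_entry r s (nsets V r) S T = of_bool (S = T) - weight (nsets V r) S T / (real ((r - s) choose s) * real ((card V - s) choose (r - s)))"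
    and "lap_entry r s (nsets V r) S T = of_bool (S = T) - of_bool (S \<inter> T = {}) / real ((card V - s) choose s)"
proof -
  define C D where "C = real ((r - s) choose s)" and "D = real ((card V - s) choose (r - s))"
  have deg: "real (hdegree (nsets V r) U) = D" if "U \<in> nsets V s" for U
    using card_nsets_superset[of V U r] that V s by (simp add: hdegree_def nsets_def D_def)
  have "sqrt (C * D) * sqrt (C * D) = C * D" by (simp add: C_def D_def)
  then show 1: "lap_entry r s (nsets V r) S T = of_bool (S = T) - weight (nsets V r) S T / (C * D)"
    by (simp add: lap_entry_def deg S T C_def[symmetric])
  define b where "b = real ((card V - 2 * s) choose (r - 2 * s))"
  have w: "weight (nsets V r) S T = of_bool (S \<inter> T = {}) * b"
  proof (cases "S \<inter> T = {}")
    case True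
    then have "card (S \<union> T) = 2 * s" using S T by (simp add: nsets_def card_Un_disjoint)
    then have "card {e \<in> nsets V r. S \<union> T \<subseteq> e} = (card V - 2 * s) choose (r - 2 * s)"
      using card_nsets_superset[of V "S \<union> T" r] V s S T by (simp add: nsets_def)
    then show ?thesis using True by (simp add: weight_def hdegree_def b_def)
  qed (simp add: weight_def)
  \<comment> \<open>One may choose an edge through \<open>S\<close> and then \<open>T\<close> inside
    it, or first \<open>T\<close> and then the rest of the edge. The codegree \<open>b\<close>
    therefore cancels and the normalised Kneser matrix appears.\<close>
  have "((card V - s) choose (r - s)) * ((r - s) choose s) = ((card V - s) choose s) * ((card V - s - s) choose (r - s - s))"
    using s r by (intro choose_mult) auto
  then have "D * C = real ((card V - s) choose s) * b"
    unfolding D_def C_def b_def by (simp only: of_nat_mult[symmetric] diff_diff_left mult_2)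
  moreover have "b \<noteq> 0" using s r by (simp add: b_def)
  ultimately show "lap_entry r s (nsets V r) S T = of_bool (S = T) - of_bool (S \<inter> T = {}) / real ((card V - s) choose s)"
    unfolding 1 w by (simp add: mult.commute[of C D])
qed

text \<open>The deterministic core. With degrees in units of \<open>d\<close> and weights in units
  of \<open>C * d\<close>, the weight matrix differs from the normalised one of the complete
  hypergraph by \<open>M / (C * d)\<close>, whose form is bounded by \<open>\<beta>\<close>.\<close>

lemma laplacian_eigenvalue_bounds:
  fixes V :: "'a set" and r s :: nat and p :: real
  defines "I \<equiv> nsets V s" and "d \<equiv> real ((card V - s) choose (r - s)) * p" and "C \<equiv> real ((r - s) choose s)"
    and "\<kappa> \<equiv> real s / (real (card V) - real s)"
  assumes V: "finite V" and s: "1 \<le> s" "2 * s \<le> r" and n: "r \<le> card V" "2 * s < card V"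
    and E: "E \<subseteq> nsets V r" and p: "0 < p"
    and \<tau>: "0 \<le> \<tau>" "\<tau> < 1" and deg: "\<And>S. S \<in> I \<Longrightarrow> \<bar>real (hdegree E S) - d\<bar> \<le> \<tau> * d"
    and form: "\<And>z. \<bar>ip I z (mv I (signed_weight V r (\<lambda>e. of_bool (e \<in> E) - p)) z)\<bar> \<le> \<beta> * (C * d) * ip I z z"
    and num: "0 \<le> \<epsilon>" "\<kappa> * \<tau> + \<beta> + (1 + \<kappa> + \<epsilon>) * \<tau>\<^sup>2 / (1 - \<tau>) \<le> \<epsilon> * (1 - \<tau>)"
    and k: "1 \<le> k" "k < card I"
  shows "\<bar>laplacian_eigenvalue V r s E k - laplacian_eigenvalue V r s (nsets V r) k\<bar> \<le> \<epsilon>"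
    and "\<bar>1 - laplacian_eigenvalue V r s (nsets V r) k\<bar> \<le> \<kappa>"
proof -
  define K where "K = nsets V r"
  define D where "D = real ((card V - s) choose (r - s))"
  have D: "D > 0" using n by (simp add: D_def)
  have d: "d > 0" using D p by (simp add: d_def D_def)
  have C: "C > 0" using s by (simp add: C_def)
  have dD: "d = D * p" by (simp add: d_def D_def)
  have fin: "finite I" using V by (simp add: I_def finite_imp_finite_nsets)
  obtain v where ebA: "eigenbasis I (lap_entry r s E) (laplacian_eigenvalue V r s E) v"
    and monoA: "\<And>i j. i \<le> j \<Longrightarrow> j < card I \<Longrightarrow> laplacian_eigenvalue V r s E i \<le> laplacian_eigenvalue V r s E j"
    using laplacian_eigenbasis[OF V, of s r E] unfolding I_def by blast
  obtain u where ebB: "eigenbasis I (lap_entry r s K) (laplacian_eigenvalue V r s K) u"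
    and monoB: "\<And>i j. i \<le> j \<Longrightarrow> j < card I \<Longrightarrow> laplacian_eigenvalue V r s K i \<le> laplacian_eigenvalue V r s K j"
    using laplacian_eigenbasis[OF V, of s r K] unfolding I_def by blast
  note complete = complete_spectrum[OF V s(1) n(2) ebB[unfolded I_def] monoB[unfolded I_def], folded I_def \<kappa>_def,
      OF _ _ lap_entry_complete(2)[OF V s(2) n(1), folded I_def K_def]]
  have orth: "(\<Sum>S\<in>I. u i S) = 0" and spec: "\<bar>1 - laplacian_eigenvalue V r s K i\<bar> \<le> \<kappa>" if "1 \<le> i" "i < card I" for i
    using complete that by blast+
  then show "\<bar>1 - laplacian_eigenvalue V r s (nsets V r) k\<bar> \<le> \<kappa>" using k by (simp add: K_def)
  define m where "m = (\<lambda>S. real (hdegree E S) / d)"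
  define G where "G = (\<lambda>S T. weight E S T / (C * d))"
  have m: "\<bar>m S - 1\<bar> \<le> \<tau>" if "S \<in> I" for S
  proof -
    have "m S - 1 = (real (hdegree E S) - d) / d" using d by (simp add: m_def diff_divide_distrib)
    then have "\<bar>m S - 1\<bar> = \<bar>real (hdegree E S) - d\<bar> / d" using d by simp
    also have "\<dots> \<le> \<tau>" using deg[OF that] d by (simp add: pos_divide_le_eq)
    finally show ?thesis .
  qed
  have symG: "symm I G" by (auto simp: symm_def G_def weight_def Int_commute Un_commute)
  have A: "lap_entry r s E S T = of_bool (S = T) - G S T / (sqrt (m S) * sqrt (m T))" for S T
  proof -
    have "sqrt (C * x) * sqrt (C * y) = C * d * (sqrt (x / d) * sqrt (y / d))" for x y
    proof -
      have "sqrt (C * x) * sqrt (C * y) = (sqrt C * sqrt C) * (sqrt x * sqrt y)" by (simp only: real_sqrt_mult mult_ac)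
      also have "\<dots> = C * (sqrt x * sqrt y)" using C by simp
      also have "sqrt x * sqrt y = d * (sqrt (x / d) * sqrt (y / d))"
      proof -
        have "sqrt (x / d) * sqrt (y / d) = (sqrt x * sqrt y) / (sqrt d * sqrt d)" by (simp add: real_sqrt_divide)
        also have "sqrt d * sqrt d = d" using d by simp
        finally show ?thesis using d by simp
      qed
      finally show ?thesis by simp
    qed
    then show ?thesis by (simp only: lap_entry_def G_def m_def C_def[symmetric] divide_divide_eq_left)
  qed
  have rows: "(\<Sum>T\<in>I. G S T) = m S" if "S \<in> I" for S
  proof -
    have "(\<Sum>T\<in>I. weight E S T) = C * real (hdegree E S)"
      using signed_weight_row_sum[OF V that[unfolded I_def], of r "\<lambda>e. of_bool (e \<in> E)"]
      unfolding weight_eq_signed_weight[OF V E] hdegree_eq_sum[OF V E] I_def C_def .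
    then show ?thesis using C by (simp add: G_def m_def sum_divide_distrib[symmetric])
  qed
  have GB: "\<bar>ip I z (mv I G z) - (ip I z z - ip I z (mv I (lap_entry r s K) z))\<bar> \<le> \<beta> * ip I z z" for z
  proof -
    define M where "M = signed_weight V r (\<lambda>e. of_bool (e \<in> E) - p)"
    have wK: "weight K S T = signed_weight V r (\<lambda>_. 1) S T" for S T
      unfolding K_def weight_eq_signed_weight[OF V order.refl] by (auto simp: signed_weight_def intro!: sum.cong)
    have wE: "weight E S T = p * weight K S T + M S T" for S T
      unfolding weight_eq_signed_weight[OF V E] wK M_def by (rule signed_weight_affine)
    have G: "G S T = weight K S T / (C * D) + M S T / (C * d)" for S T
      using C D p by (simp add: G_def wE dD field_simps)
    have "mv I G z = (\<lambda>S. (1 / (C * D)) * mv I (weight K) z S + (1 / (C * d)) * mv I M z S)"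
      by (simp add: mv_def fun_eq_iff G algebra_simps sum.distrib sum_divide_distrib add_divide_distrib)
    then have 1: "ip I z (mv I G z) = (1 / (C * D)) * ip I z (mv I (weight K) z) + (1 / (C * d)) * ip I z (mv I M z)"
      by (simp only: ip_add_right ip_scale_right)
    have "mv I (lap_entry r s K) z S = z S - (1 / (C * D)) * mv I (weight K) z S" if "S \<in> I" for S
    proof -
      have "mv I (lap_entry r s K) z S = (\<Sum>T\<in>I. (if T = S then z T else 0) - (1 / (C * D)) * (weight K S T * z T))"
        unfolding mv_def using that lap_entry_complete(1)[OF V s(2) n(1), folded I_def K_def C_def D_def]
        by (intro sum.cong) (auto simp: left_diff_distrib)
      then show ?thesis using fin that by (simp only: sum_subtractf sum.delta if_True mv_def sum_distrib_left)
    qed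
    then have "ip I z (mv I (lap_entry r s K) z) = ip I z (\<lambda>S. z S - (1 / (C * D)) * mv I (weight K) z S)"
      by (intro ip_cong) auto
    then have 2: "ip I z (mv I (lap_entry r s K) z) = ip I z z - (1 / (C * D)) * ip I z (mv I (weight K) z)"
      by (simp only: ip_diff_right ip_scale_right)
    have "\<bar>(1 / (C * d)) * ip I z (mv I M z)\<bar> = (1 / (C * d)) * \<bar>ip I z (mv I M z)\<bar>" using C d by (simp add: abs_mult)
    also have "\<dots> \<le> (1 / (C * d)) * (\<beta> * (C * d) * ip I z z)"
      unfolding M_def using C d by (intro mult_left_mono form) auto
    also have "\<dots> = \<beta> * ip I z z" using C d by simp
    finally show ?thesis unfolding 1 2 by simp
  qed
  have \<kappa>1: "\<kappa> \<le> 1" using n by (simp add: \<kappa>_def)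
  have up: "laplacian_eigenvalue V r s E k \<le> laplacian_eigenvalue V r s K k + \<epsilon>"
    by (rule eigenvalue_perturbation_le[OF fin symm_lap_entry symG ebA monoA ebB monoB \<tau> m A rows GB orth \<kappa>1 spec num k])
  have "(1 + \<kappa> + \<epsilon>) * \<tau>\<^sup>2 / (1 - \<tau>) \<ge> 0" using num(1) \<tau> n by (simp add: \<kappa>_def)
  then have num': "\<kappa> * \<tau> + \<beta> \<le> \<epsilon> * (1 - \<tau>)" using num(2) by linarith
  have "laplacian_eigenvalue V r s K k - \<epsilon> \<le> laplacian_eigenvalue V r s E k"
    by (rule eigenvalue_perturbation_ge[OF fin symm_lap_entry ebA monoA ebB monoB \<tau> m A GB spec[OF k] num(1) num' k(2)])
  with up show "\<bar>laplacian_eigenvalue V r s E k - laplacian_eigenvalue V r s (nsets V r) k\<bar> \<le> \<epsilon>"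
    unfolding K_def by (simp add: abs_le_iff)
qed

text \<open>Walks grow by at most \<open>11 / 5 * (C * \<sigma>)\<close> per step and the threshold
  is \<open>t = 29 / 10 * (C * \<sigma>)\<close>; the quotient is \<open>22 / 29\<close>. Since
  \<open>\<sigma> = \<delta> * d\<close>, the form uses up \<open>29 / 10 * \<delta>\<close> and
  leaves \<open>\<delta> / 10\<close> of the budget \<open>3 * \<delta>\<close> for the
  degrees.\<close>

lemma prob_laplacian_eigenvalues_deviate:
  fixes V :: "'a set" and r s :: nat and p :: real
  defines "D \<equiv> real ((card V - s) choose (r - s))" and "\<kappa> \<equiv> real s / (real (card V) - real s)"
  defines "\<sigma> \<equiv> sqrt (p * (1 - p) * D)" and "\<delta> \<equiv> sqrt ((1 - p) / (D * p))"
  assumes V: "finite V" and s: "1 \<le> s" "2 * s \<le> r" and n: "r \<le> card V" "2 * s < card V"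
    and p: "0 < p" "p < 1" and L: "even L" "0 < L" and a: "0 \<le> a" "a * \<delta> < 1" and \<sigma>1: "1 \<le> \<sigma>"
    and walk: "\<sigma> * (2 + real (s + r * L) * real (r - s) / real (card V - s) * real L ^ ((r choose s) + 1)) + real L ^ 2 \<le> 11 / 5 * \<sigma>"
    and num: "\<kappa> * (a * \<delta>) + 29 / 10 * \<delta> + (1 + \<kappa> + 3 * \<delta>) * (a * \<delta>)\<^sup>2 / (1 - a * \<delta>) \<le> 3 * \<delta> * (1 - a * \<delta>)"
  shows "measure_pmf.prob (bernoulli_edges (nsets V r) p)
      {f. \<not> (\<forall>k\<in>{1..card (nsets V s) - 1}.
        \<bar>laplacian_eigenvalue V r s {e \<in> nsets V r. f e} k - laplacian_eigenvalue V r s (nsets V r) k\<bar> \<le> 3 * \<delta> \<and>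
        \<bar>1 - laplacian_eigenvalue V r s (nsets V r) k\<bar> \<le> \<kappa>)}
    \<le> real (card V choose s) * (22 / 29) ^ L + real (card V choose s) * (2 * exp (1 - a))"
proof -
  define P where "P = bernoulli_edges (nsets V r) p"
  define C where "C = real ((r - s) choose s)"
  define d where "d = D * p"
  define t where "t = 29 / 10 * (C * \<sigma>)"
  have sr: "s < r" using s by simp
  have D: "D > 0" using n by (simp add: D_def)
  have C: "C > 0" using s by (simp add: C_def)
  have d: "d > 0" using D p by (simp add: d_def)
  have \<sigma>0: "\<sigma> > 0" using \<sigma>1 by simp
  have \<sigma>2: "\<sigma>\<^sup>2 = p * (1 - p) * D" unfolding \<sigma>_def using p D by (subst real_sqrt_pow2) auto
  have \<sigma>d: "\<sigma> = \<delta> * d"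
  proof -
    have "(\<delta> * d)\<^sup>2 = p * (1 - p) * D" unfolding power_mult_distrib \<delta>_def d_def
      using p D by (subst real_sqrt_pow2) (auto simp: power2_eq_square field_simps)
    moreover have "0 \<le> \<delta> * d" using d p D by (simp add: \<delta>_def)
    ultimately show ?thesis unfolding \<sigma>_def by (metis real_sqrt_unique)
  qed
  have \<delta>0: "0 \<le> \<delta>" using p D by (simp add: \<delta>_def)
  have t: "t > 0" using C \<sigma>0 by (simp add: t_def)
  define form where "form = (\<lambda>f. \<forall>x. \<bar>ip (nsets V s) x (mv (nsets V s) (signed_weight V r (\<lambda>e. of_bool (f e) - p)) x)\<bar>
              \<le> t * ip (nsets V s) x x)"
  define dev where "dev = (\<lambda>f. \<exists>S\<in>nsets V s. a * \<sigma> \<le> \<bar>degree_deviation V r p f S\<bar>)"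
  have good: "\<bar>laplacian_eigenvalue V r s {e \<in> nsets V r. f e} k - laplacian_eigenvalue V r s (nsets V r) k\<bar> \<le> 3 * \<delta> \<and>
        \<bar>1 - laplacian_eigenvalue V r s (nsets V r) k\<bar> \<le> \<kappa>"
    if f: "form f" "\<not> dev f" and k: "k \<in> {1..card (nsets V s) - 1}" for f k
  proof -
    define E where "E = {e \<in> nsets V r. f e}"
    have E: "E \<subseteq> nsets V r" by (auto simp: E_def)
    have sw: "signed_weight V r (\<lambda>e. of_bool (e \<in> E) - p) = signed_weight V r (\<lambda>e. of_bool (f e) - p)"
      unfolding signed_weight_def fun_eq_iff by (auto intro!: sum.cong simp: E_def)
    have deg: "\<bar>real (hdegree E S) - d\<bar> \<le> a * \<delta> * d" if S: "S \<in> nsets V s" for S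
    proof -
      have "(\<Sum>e\<in>nsets V r. of_bool (S \<subseteq> e) * p) = D * p"
      proof -
        have "(\<Sum>e\<in>nsets V r. of_bool (S \<subseteq> e)) = real (card {e \<in> nsets V r. S \<subseteq> e})"
          using V by (simp only: finite_imp_finite_nsets sum_of_bool_eq Int_def mem_Collect_eq)
        also have "\<dots> = D" using card_nsets_superset[of V S r] S V sr by (simp add: nsets_def D_def)
        finally show ?thesis by (simp only: sum_distrib_right[symmetric])
      qed
      moreover have "degree_deviation V r p f S = (\<Sum>e\<in>nsets V r. of_bool (S \<subseteq> e) * of_bool (e \<in> E)) - (\<Sum>e\<in>nsets V r. of_bool (S \<subseteq> e) * p)"
        unfolding degree_deviation_def sum_subtractf[symmetric]
        by (intro sum.cong) (auto simp: E_def right_diff_distrib)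
      ultimately have "degree_deviation V r p f S = real (hdegree E S) - d"
        by (simp only: hdegree_eq_sum[OF V E] d_def)
      moreover have "\<bar>degree_deviation V r p f S\<bar> < a * \<sigma>" using f(2) S by (auto simp: dev_def not_le)
      ultimately show ?thesis by (simp add: \<sigma>d)
    qed
    have fm: "\<bar>ip (nsets V s) z (mv (nsets V s) (signed_weight V r (\<lambda>e. of_bool (e \<in> E) - p)) z)\<bar> \<le> 29 / 10 * \<delta> * (C * d) * ip (nsets V s) z z" for z
      using f(1) unfolding form_def sw by (simp add: t_def \<sigma>d mult_ac)
    have k': "1 \<le> k" "k < card (nsets V s)" using k by auto
    have a\<delta>: "0 \<le> a * \<delta>" "0 \<le> 3 * \<delta>" using a \<delta>0 by auto
    show ?thesis unfolding E_def[symmetric] \<kappa>_def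
      using laplacian_eigenvalue_bounds[OF V s n E p(1) a\<delta>(1) a(2) deg[unfolded d_def D_def] fm[unfolded C_def d_def D_def]
          a\<delta>(2) num[unfolded \<kappa>_def] k'] by blast
  qed
  have "measure_pmf.prob P {f. \<not> (\<forall>k\<in>{1..card (nsets V s) - 1}.
        \<bar>laplacian_eigenvalue V r s {e \<in> nsets V r. f e} k - laplacian_eigenvalue V r s (nsets V r) k\<bar> \<le> 3 * \<delta> \<and>
        \<bar>1 - laplacian_eigenvalue V r s (nsets V r) k\<bar> \<le> \<kappa>)} \<le> measure_pmf.prob P ({f. \<not> form f} \<union> {f. dev f})"
    by (intro measure_pmf.finite_measure_mono) (use good in blast, simp)
  also have "\<dots> \<le> measure_pmf.prob P {f. \<not> form f} + measure_pmf.prob P {f. dev f}"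
    by (rule measure_Un_le) auto
  also have "measure_pmf.prob P {f. dev f} \<le> real (card V choose s) * (2 * exp (1 - a))"
    unfolding P_def dev_def using V sr p \<sigma>1 \<sigma>2 by (intro prob_degree_deviation_large) (auto simp: D_def)
  also have "measure_pmf.prob P {f. \<not> form f} \<le> real (card V choose s) * (22 / 29) ^ L"
  proof -
    define X where "X = \<sigma> * (2 + real (s + r * L) * real (r - s) / real (card V - s) * real L ^ ((r choose s) + 1)) + real L ^ 2"
    have X0: "0 \<le> X" using \<sigma>0 by (simp add: X_def)
    have "measure_pmf.prob P {f. \<not> form f} \<le> real (card V choose s) * (C * X / t) ^ L"
      unfolding P_def form_def C_def X_def
      using V s sr n L p \<sigma>0 \<sigma>2 t by (intro prob_quadratic_form_large) (auto simp: D_def)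
    also have "C * X / t \<le> 22 / 29"
      using walk C \<sigma>0 unfolding X_def[symmetric] t_def by (simp add: field_simps)
    then have "(C * X / t) ^ L \<le> (22 / 29) ^ L" using C X0 t by (intro power_mono) auto
    finally show ?thesis by (simp add: mult_left_mono)
  qed
  finally show ?thesis by (simp add: P_def)
qed

lemma log_power_div_tendsto_0:
  "(\<lambda>n. (ln (real n)) ^ k / real n) \<longlonglongrightarrow> 0"
  by real_asymp

subsection \<open>Asymptotics\<close>

text \<open>The fourth power of the logarithm in the hypothesis is used here: its square root is the
  growth that \<open>\<sigma>\<close> needs to dominate both \<open>L\<^sup>2\<close> in the walk
  bound and the squared degree error.\<close>

lemma eventually_sigma_large:
  fixes p :: "nat \<Rightarrow> real" and r s :: nat
  assumes sr: "s < r" and p: "\<And>n. 0 < p n \<and> p n < 1" and B: "0 < B"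
    and small: "(\<lambda>n. ln (real n) ^ 4 / real n ^ (r - s)) \<in> o(\<lambda>n. p n * (1 - p n))"
  shows "\<forall>\<^sub>F n in sequentially. B * (ln (real n))\<^sup>2 \<le> sqrt (p n * (1 - p n) * real ((n - s) choose (r - s)))"
proof -
  define m where "m = r - s"
  \<comment> \<open>The constant comes from \<open>n - s \<ge> n / 2\<close> and from the lower
    bound \<open>(N / m) ^ m\<close> for \<open>N choose m\<close>.\<close>
  define \<gamma> where "\<gamma> = (1 / (2 * real m)) ^ m"
  have m: "m > 0" using sr by (simp add: m_def)
  have \<gamma>: "\<gamma> > 0" using m by (simp add: \<gamma>_def)
  have "\<forall>\<^sub>F n in sequentially. norm (ln (real n) ^ 4 / real n ^ m) \<le> \<gamma> / B\<^sup>2 * norm (p n * (1 - p n))"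
    using small \<gamma> B unfolding m_def[symmetric] by (intro landau_o.smallD) auto
  moreover have "\<forall>\<^sub>F n in sequentially. 2 * s + r + 1 \<le> n" by (rule eventually_ge_at_top)
  ultimately show ?thesis
  proof eventually_elim
    case (elim n)
    define q where "q = p n * (1 - p n)"
    have q: "q > 0" using p[of n] by (simp add: q_def)
    have n: "real n > 0" using elim by simp
    have "norm (p n * (1 - p n)) = q" using abs_of_pos[OF q] by (simp only: q_def real_norm_def)
    with elim(1) have "norm (ln (real n) ^ 4 / real n ^ m) \<le> \<gamma> / B\<^sup>2 * q" by (simp only:)
    then have "ln (real n) ^ 4 / real n ^ m \<le> \<gamma> / B\<^sup>2 * q" unfolding real_norm_def by (rule abs_le_D1)
    then have 1: "B\<^sup>2 * ln (real n) ^ 4 \<le> q * (\<gamma> * real n ^ m)" using B n by (simp add: field_simps)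
    have "\<gamma> * real n ^ m = (real n / 2 / real m) ^ m" by (simp add: \<gamma>_def power_divide power_mult_distrib)
    also have "\<dots> \<le> (real (n - s) / real m) ^ m"
      using elim(2) by (intro power_mono divide_right_mono) auto
    also have "\<dots> \<le> real ((n - s) choose m)"
      using elim(2) by (intro binomial_ge_n_over_k_pow_k) (simp add: m_def)
    finally have "q * (\<gamma> * real n ^ m) \<le> q * real ((n - s) choose m)" using q by (intro mult_left_mono) auto
    with 1 have "(B * (ln (real n))\<^sup>2)\<^sup>2 \<le> q * real ((n - s) choose m)" by (simp add: power_mult_distrib flip: power_mult)
    then show ?case unfolding q_def m_def by (rule real_le_rsqrt)
  qed
qed

text \<open>Steps into old vertices cost a power of \<open>ln n\<close> against \<open>n\<close>.
  The quantifier over \<open>L\<close> stands inside because \<open>L\<close> depends on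
  \<open>n\<close>.\<close>

lemma eventually_walk_excess_small:
  fixes r s K :: nat
  shows "\<forall>\<^sub>F n in sequentially. \<forall>L. real L \<le> c * ln (real n) \<longrightarrow>
    real (s + r * L) * real (r - s) / real (n - s) * real L ^ K \<le> 1 / 10"
proof -
  define c' where "c' = (real s + real r * \<bar>c\<bar>) * real (r - s) * 2 * \<bar>c\<bar> ^ K"
  have "(\<lambda>n. c' * (ln (real n) ^ (K + 1) / real n)) \<longlonglongrightarrow> c' * 0"
    by (intro tendsto_mult tendsto_const log_power_div_tendsto_0)
  then have "\<forall>\<^sub>F n in sequentially. c' * (ln (real n) ^ (K + 1) / real n) < 1 / 10"
    by (rule order_tendstoD) simp
  moreover have "\<forall>\<^sub>F n in sequentially. 2 * s + 1 \<le> n" by (rule eventually_ge_at_top)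
  moreover have "\<forall>\<^sub>F n in sequentially. 1 \<le> ln (real n)" by real_asymp
  ultimately show ?thesis
  proof eventually_elim
    case (elim n)
    show ?case
    proof (intro allI impI)
      fix L assume "real L \<le> c * ln (real n)"
      also have "\<dots> \<le> \<bar>c\<bar> * ln (real n)" using elim by (intro mult_right_mono) auto
      finally have L: "real L \<le> \<bar>c\<bar> * ln (real n)" .
      have "real (s + r * L) \<le> real s * ln (real n) + real r * (\<bar>c\<bar> * ln (real n))"
        unfolding of_nat_add of_nat_mult using L elim(3) by (intro add_mono mult_left_mono) (auto simp: mult_le_cancel_left1)
      also have "\<dots> = (real s + real r * \<bar>c\<bar>) * ln (real n)" by (simp add: algebra_simps)
      finally have 1: "real (s + r * L) \<le> (real s + real r * \<bar>c\<bar>) * ln (real n)" .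
      have "real (s + r * L) * real (r - s) / real (n - s) * real L ^ K
          \<le> (real s + real r * \<bar>c\<bar>) * ln (real n) * real (r - s) / (real n / 2) * (\<bar>c\<bar> * ln (real n)) ^ K"
        using 1 L elim by (intro mult_mono frac_le power_mono mult_right_mono) auto
      also have "\<dots> = c' * (ln (real n) ^ (K + 1) / real n)"
        by (simp add: c'_def power_mult_distrib)
      finally show "real (s + r * L) * real (r - s) / real (n - s) * real L ^ K \<le> 1 / 10"
        by (rule order_trans[OF _ less_imp_le[OF elim(1)]])
    qed
  qed
qed

lemma eventually_kappa_log_small:
  "\<forall>\<^sub>F n in sequentially. real s / (real n - real s) * (c * ln (real n)) \<le> 1 / 100"
proof -
  have "(\<lambda>n. real s / (real n - real s) * (c * ln (real n))) \<longlonglongrightarrow> 0" by real_asymp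
  then have "\<forall>\<^sub>F n in sequentially. real s / (real n - real s) * (c * ln (real n)) < 1 / 100"
    by (rule order_tendstoD) simp
  then show ?thesis by (rule eventually_mono) simp
qed

text \<open>Applied with \<open>l = ln n\<close>, where \<open>x = A * l * \<delta>\<close> is the
  relative degree error. The factor 1000 makes \<open>x \<le> 1 / 1000\<close> and
  \<open>x\<^sup>2 \<le> \<delta> / 1000\<close>. In units of \<open>\<delta>\<close> the left side
  is then at most 0.01 + 2.9 + 0.006, and the right side at least 2.997.\<close>

lemma perturbation_budget:
  fixes \<delta> \<kappa> l A :: real
  assumes \<delta>: "0 \<le> \<delta>" and A: "1 \<le> A" and l: "1 \<le> l" and small: "1000 * A\<^sup>2 * (\<delta> * l\<^sup>2) \<le> 1"
    and \<kappa>: "0 \<le> \<kappa>" "\<kappa> \<le> 1" "\<kappa> * (A * l) \<le> 1 / 100"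
  shows "A * l * \<delta> < 1"
    and "\<kappa> * (A * l * \<delta>) + 29 / 10 * \<delta> + (1 + \<kappa> + 3 * \<delta>) * (A * l * \<delta>)\<^sup>2 / (1 - A * l * \<delta>) \<le> 3 * \<delta> * (1 - A * l * \<delta>)"
proof -
  define x where "x = A * l * \<delta>"
  have Al: "1 \<le> A * l" using A l by (metis mult_mono' mult_1 zero_le_one)
  have sq: "(A * l)\<^sup>2 * \<delta> \<le> 1 / 1000" using small by (simp add: power_mult_distrib mult_ac)
  have "A * l \<le> (A * l)\<^sup>2" using Al by (intro self_le_power) auto
  then have "x \<le> (A * l)\<^sup>2 * \<delta>" unfolding x_def using \<delta> by (intro mult_right_mono)
  then have x: "x \<le> 1 / 1000" using sq by linarith
  have x0: "0 \<le> x" using A l \<delta> by (simp add: x_def)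
  have "1 * \<delta> \<le> A * l * \<delta>" using Al \<delta> by (rule mult_right_mono)
  then have \<delta>1: "\<delta> \<le> 1 / 1000" using x by (simp add: x_def)
  show "A * l * \<delta> < 1" using x by (simp add: x_def)
  have 1: "\<kappa> * x \<le> \<delta> / 100"
    using mult_right_mono[OF \<kappa>(3) \<delta>] by (simp add: x_def mult_ac)
  have "x\<^sup>2 = ((A * l)\<^sup>2 * \<delta>) * \<delta>" by (simp add: x_def power2_eq_square)
  also have "\<dots> \<le> 1 / 1000 * \<delta>" using sq \<delta> by (rule mult_right_mono)
  finally have x2: "x\<^sup>2 \<le> \<delta> / 1000" by simp
  have "(1 + \<kappa> + 3 * \<delta>) * x\<^sup>2 / (1 - x) \<le> 3 * (\<delta> / 1000) / (1 / 2)"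
    using x x0 x2 \<kappa> \<delta> \<delta>1 by (intro frac_le mult_mono) auto
  then have 2: "(1 + \<kappa> + 3 * \<delta>) * x\<^sup>2 / (1 - x) \<le> 6 * \<delta> / 1000" by simp
  have "\<delta> * x \<le> \<delta> * (1 / 1000)" using x \<delta> by (rule mult_left_mono)
  then have 3: "3 * \<delta> * (1 - x) \<ge> 3 * \<delta> - 3 * \<delta> / 1000" by (simp add: right_diff_distrib)
  have "\<delta> / 100 + 29 / 10 * \<delta> + 6 * \<delta> / 1000 \<le> 3 * \<delta> - 3 * \<delta> / 1000" using \<delta> by simp
  with 1 2 3 have "\<kappa> * x + 29 / 10 * \<delta> + (1 + \<kappa> + 3 * \<delta>) * x\<^sup>2 / (1 - x) \<le> 3 * \<delta> * (1 - x)" by linarith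
  then show "\<kappa> * (A * l * \<delta>) + 29 / 10 * \<delta> + (1 + \<kappa> + 3 * \<delta>) * (A * l * \<delta>)\<^sup>2 / (1 - A * l * \<delta>) \<le> 3 * \<delta> * (1 - A * l * \<delta>)"
    by (simp only: x_def)
qed

text \<open>\<open>exp (1 / 4) \<le> 21 / 16 \<le> 29 / 22\<close>, so the lower bound on
  \<open>L\<close> makes \<open>(22 / 29) ^ L\<close> at most \<open>1 / n ^ (s + 1)\<close>, which
  absorbs the at most \<open>n ^ s\<close> sets of size \<open>s\<close>. The 7 is 1 from this term
  plus 6 from \<open>2 * exp 1 \<le> 6\<close>.\<close>

lemma binomial_tail_sum_le:
  assumes n: "s \<le> n" "0 < n" and L: "real L \<ge> 4 * real (s + 1) * ln (real n)"
  shows "real (n choose s) * (22 / 29) ^ L + real (n choose s) * (2 * exp (1 - real (s + 1) * ln (real n))) \<le> 7 / real n"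
proof -
  have N: "real (n choose s) \<le> real n ^ s" using binomial_le_pow[OF n(1)] by (metis of_nat_le_iff of_nat_power)
  have ea: "exp (- (real (s + 1) * ln (real n))) = 1 / real n ^ (s + 1)"
    using n by (simp add: exp_minus exp_of_nat_mult[of "s + 1", symmetric, simplified] inverse_eq_divide del: exp_of_nat_mult)
      (metis exp_ln exp_of_nat_mult of_nat_0_less_iff of_nat_Suc power_Suc add.commute)
  have "exp (1 / 4 :: real) \<le> 29 / 22" using exp_bound[of "1/4 :: real"] by (simp add: power2_eq_square)
  then have "22 / 29 \<le> exp (- (1 / 4) :: real)" by (simp add: exp_minus field_simps)
  then have "(22 / 29) ^ L \<le> exp (- (1 / 4) :: real) ^ L" by (intro power_mono) auto
  also have "\<dots> = exp (- (real L / 4))" by (simp flip: exp_of_nat_mult)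
  also have "\<dots> \<le> exp (- (real (s + 1) * ln (real n)))" using L by (simp add: algebra_simps)
  finally have 1: "(22 / 29) ^ L \<le> 1 / real n ^ (s + 1)" unfolding ea .
  have "2 * exp (1 - real (s + 1) * ln (real n)) = 2 * exp 1 * exp (- (real (s + 1) * ln (real n)))"
    by (simp flip: exp_add)
  also have "\<dots> \<le> 6 * (1 / real n ^ (s + 1))" unfolding ea using exp_le by (intro mult_right_mono) auto
  finally have 2: "2 * exp (1 - real (s + 1) * ln (real n)) \<le> 6 * (1 / real n ^ (s + 1))" .
  have "real (n choose s) * (22 / 29) ^ L + real (n choose s) * (2 * exp (1 - real (s + 1) * ln (real n)))
      \<le> real n ^ s * (1 / real n ^ (s + 1)) + real n ^ s * (6 * (1 / real n ^ (s + 1)))"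
  proof (rule add_mono)
    show "real (n choose s) * (22 / 29) ^ L \<le> real n ^ s * (1 / real n ^ (s + 1))"
      by (rule mult_mono[OF N 1]) auto
    show "real (n choose s) * (2 * exp (1 - real (s + 1) * ln (real n))) \<le> real n ^ s * (6 * (1 / real n ^ (s + 1)))"
      by (rule mult_mono[OF N 2]) auto
  qed
  also have "\<dots> = 7 / real n" using n by (simp add: field_simps)
  finally show ?thesis .
qed

lemma eventually_prob_laplacian_eigenvalues_deviate:
  fixes r s :: nat and p :: "nat \<Rightarrow> real"
  assumes s: "1 \<le> s" "2 * s \<le> r" and p: "\<And>n. 0 < p n \<and> p n < 1"
    and small: "(\<lambda>n. ln (real n) ^ 4 / real n ^ (r - s)) \<in> o(\<lambda>n. p n * (1 - p n))"
  shows "\<forall>\<^sub>F n in sequentially. measure_pmf.prob (bernoulli_edges (nsets {1..n} r) (p n))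
      {f. \<not> (\<forall>k\<in>{1..(n choose s) - 1}.
        \<bar>laplacian_eigenvalue {1..n} r s {e \<in> nsets {1..n} r. f e} k - laplacian_eigenvalue {1..n} r s (nsets {1..n} r) k\<bar>
          \<le> 3 * sqrt ((1 - p n) / (real ((n - s) choose (r - s)) * p n)) \<and>
        \<bar>1 - laplacian_eigenvalue {1..n} r s (nsets {1..n} r) k\<bar> \<le> real s / (real n - real s))}
    \<le> 7 / real n"
proof -
  define A where "A = real (s + 1)"
  \<comment> \<open>The factor 1000 serves twice: it gives the smallness of
    \<open>\<delta> * l\<^sup>2\<close> in the budget and, with \<open>L \<le> 6 * A * l\<close>,
    the bound of \<open>L\<^sup>2\<close> by \<open>\<sigma> / 10\<close>.\<close>
  define B where "B = 1000 * A\<^sup>2"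
  have A1: "1 \<le> A" by (simp add: A_def)
  have B0: "0 < B" using A1 by (simp add: B_def)
  have sr: "s < r" using s by simp
  have "\<forall>\<^sub>F n in sequentially. B * (ln (real n))\<^sup>2 \<le> sqrt (p n * (1 - p n) * real ((n - s) choose (r - s)))"
    by (rule eventually_sigma_large[OF sr p B0 small])
  moreover have "\<forall>\<^sub>F n in sequentially. \<forall>L. real L \<le> 6 * A * ln (real n) \<longrightarrow>
      real (s + r * L) * real (r - s) / real (n - s) * real L ^ ((r choose s) + 1) \<le> 1 / 10"
    by (rule eventually_walk_excess_small)
  moreover have "\<forall>\<^sub>F n in sequentially. real s / (real n - real s) * (A * ln (real n)) \<le> 1 / 100"
    by (rule eventually_kappa_log_small)
  moreover have "\<forall>\<^sub>F n in sequentially. 2 * s + r + 1 \<le> n" by (rule eventually_ge_at_top)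
  moreover have "\<forall>\<^sub>F n in sequentially. 1 \<le> ln (real n)" by real_asymp
  ultimately show ?thesis
  proof eventually_elim
    case (elim n)
    define D where "D = real ((n - s) choose (r - s))"
    define \<sigma> where "\<sigma> = sqrt (p n * (1 - p n) * D)"
    define \<delta> where "\<delta> = sqrt ((1 - p n) / (D * p n))"
    define \<kappa> where "\<kappa> = real s / (real n - real s)"
    define l where "l = ln (real n)"
    \<comment> \<open>The leading 2 makes \<open>L\<close> even; rounding up puts it between
      \<open>4 * A * l\<close>, as the tail estimate requires, and \<open>6 * A * l\<close>, because
      \<open>A * l \<ge> 1\<close>.\<close>
    define L where "L = 2 * nat \<lceil>2 * A * l\<rceil>"
    have l: "1 \<le> l" using elim by (simp add: l_def)
    have D: "D > 0" using elim by (simp add: D_def)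
    have pn: "0 < p n" "p n < 1" using p[of n] by auto
    have \<sigma>B: "B * l\<^sup>2 \<le> \<sigma>" using elim by (simp add: l_def \<sigma>_def D_def)
    have Bl: "1 \<le> B * l\<^sup>2"
    proof -
      have "1 \<le> A\<^sup>2" "1 \<le> l\<^sup>2" using A1 l by (auto simp: one_le_power)
      then have "1 \<le> A\<^sup>2 * l\<^sup>2" by (metis mult_mono' mult_1 zero_le_one)
      then show ?thesis by (simp add: B_def)
    qed
    then have \<sigma>1: "1 \<le> \<sigma>" using \<sigma>B by linarith
    have \<delta>0: "0 \<le> \<delta>" using D pn by (simp add: \<delta>_def)
    \<comment> \<open>This identity converts the lower bound on \<open>\<sigma>\<close> into the
      upper bound on \<open>\<delta> * l\<^sup>2\<close> that the budget requires.\<close>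
    have "\<delta> * \<sigma> = 1 - p n"
    proof -
      have "\<delta> * \<sigma> = sqrt ((1 - p n) / (D * p n) * (p n * (1 - p n) * D))"
        by (simp only: \<delta>_def \<sigma>_def real_sqrt_mult)
      also have "(1 - p n) / (D * p n) * (p n * (1 - p n) * D) = (1 - p n)\<^sup>2"
        using D pn by (simp add: power2_eq_square)
      finally show ?thesis using pn by simp
    qed
    then have "\<delta> * \<sigma> \<le> 1" using pn by simp
    moreover have "\<delta> * (B * l\<^sup>2) \<le> \<delta> * \<sigma>" using \<sigma>B \<delta>0 by (rule mult_left_mono)
    ultimately have small\<delta>: "1000 * A\<^sup>2 * (\<delta> * l\<^sup>2) \<le> 1" by (simp add: B_def mult_ac)
    have \<kappa>: "0 \<le> \<kappa>" "\<kappa> \<le> 1" "\<kappa> * (A * l) \<le> 1 / 100" using elim by (auto simp: \<kappa>_def l_def)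
    note budget = perturbation_budget[OF \<delta>0 A1 l small\<delta> \<kappa>]
    have Al: "1 \<le> A * l" using A1 l by (metis mult_mono' mult_1 zero_le_one)
    have L_ge: "real L \<ge> 4 * A * l" unfolding L_def using Al le_of_int_ceiling[of "2 * A * l"] by (simp add: mult.assoc)
    have "real (nat \<lceil>x\<rceil>) \<le> x + 1" if "0 \<le> x" for x :: real
    proof -
      have "real (nat \<lceil>x\<rceil>) = of_int \<lceil>x\<rceil>" using that by simp
      then show ?thesis using of_int_ceiling_le_add_one[of x] by linarith
    qed
    from this[of "2 * A * l"] have "real (nat \<lceil>2 * A * l\<rceil>) \<le> 2 * A * l + 1" using A1 l by simp
    then have "real L \<le> 2 * (2 * A * l + 1)"
      unfolding L_def of_nat_mult of_nat_numeral by (rule mult_left_mono) simp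
    then have L_le: "real L \<le> 6 * A * l" using Al by simp
    have "0 < 4 * A * l" using A1 l by simp
    then have "0 < real L" using L_ge by (rule less_le_trans)
    then have L0: "0 < L" by simp
    have evenL: "even L" by (simp add: L_def)
    have "(real L)\<^sup>2 \<le> (6 * A * l)\<^sup>2" using L_le by (intro power_mono) auto
    also have "\<dots> = 36 / 1000 * (B * l\<^sup>2)" by (simp add: B_def power_mult_distrib)
    also have "\<dots> \<le> 1 / 10 * \<sigma>" using \<sigma>B Bl by linarith
    finally have L2: "(real L)\<^sup>2 \<le> 1 / 10 * \<sigma>" .
    define X where "X = real (s + r * L) * real (r - s) / real (n - s) * real L ^ ((r choose s) + 1)"
    have "X \<le> 1 / 10" using elim(2) L_le by (simp add: X_def l_def)
    then have "\<sigma> * (2 + X) \<le> \<sigma> * (2 + 1 / 10)" using \<sigma>1 by (intro mult_left_mono) auto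
    with L2 have walk: "\<sigma> * (2 + X) + real L ^ 2 \<le> 11 / 5 * \<sigma>" by (simp add: algebra_simps)
    have card_n: "card {1..n} = n" by simp
    have "measure_pmf.prob (bernoulli_edges (nsets {1..n} r) (p n))
      {f. \<not> (\<forall>k\<in>{1..card (nsets {1..n} s) - 1}.
        \<bar>laplacian_eigenvalue {1..n} r s {e \<in> nsets {1..n} r. f e} k - laplacian_eigenvalue {1..n} r s (nsets {1..n} r) k\<bar> \<le> 3 * \<delta> \<and>
        \<bar>1 - laplacian_eigenvalue {1..n} r s (nsets {1..n} r) k\<bar> \<le> \<kappa>)}
      \<le> real (n choose s) * (22 / 29) ^ L + real (n choose s) * (2 * exp (1 - A * l))"
      by (rule prob_laplacian_eigenvalues_deviate[of "{1..n}" s r "p n" L "A * l", unfolded card_n,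
            folded D_def, folded \<sigma>_def \<delta>_def \<kappa>_def, folded X_def,
            OF _ s _ _ pn evenL L0 _ budget(1) \<sigma>1 walk budget(2)]) (use elim(4) Al in simp_all)
    also have "\<dots> \<le> 7 / real n" unfolding A_def l_def
      using elim(4) L_ge by (intro binomial_tail_sum_le) (auto simp: A_def l_def)
    finally show ?case by (simp add: \<delta>_def \<kappa>_def D_def)
  qed
qed

lemma tendsto_1_of_eventually_ge:
  fixes f :: "nat \<Rightarrow> real"
  assumes "\<And>n. f n \<le> 1" "\<forall>\<^sub>F n in sequentially. 1 - c / real n \<le> f n"
  shows "f \<longlonglongrightarrow> 1"
proof (rule tendsto_sandwich[OF assms(2)])
  show "\<forall>\<^sub>F n in sequentially. f n \<le> 1" using assms(1) by simp
  show "(\<lambda>n. 1 - c / real n) \<longlonglongrightarrow> 1" by real_asymp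
qed simp

theorem theorem2:
  fixes r s :: nat and p :: "nat \<Rightarrow> real"
  assumes "1 \<le> s" and "real s \<le> real r / 2"
    and "\<And>n. 0 < p n \<and> p n < 1"
    and "(\<lambda>n. ln (real n) ^ 4 / real n ^ (r - s)) \<in> o(\<lambda>n. p n * (1 - p n))"
    and "(\<lambda>n. ln (real n) / real n ^ 2) \<in> o(\<lambda>n. 1 - p n)"
  shows
    "(\<exists>\<epsilon> :: nat \<Rightarrow> real. \<epsilon> \<longlonglongrightarrow> 0 \<and>
       (\<lambda>n. measure_pmf.prob (random_hypergraph r n (p n))
          {E. lambda_bar {1..n} r s E
              \<le> real s / (real n - real s)
                + (3 + \<epsilon> n) * sqrt ((1 - p n) / (real ((n - s) choose (r - s)) * p n))})
       \<longlonglongrightarrow> 1) \<and>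
     (\<exists>\<epsilon> :: nat \<Rightarrow> real. \<epsilon> \<longlonglongrightarrow> 0 \<and>
       (\<lambda>n. measure_pmf.prob (random_hypergraph r n (p n))
          {E. \<forall>k\<in>{1..(n choose s) - 1}.
                \<bar>laplacian_eigenvalue {1..n} r s E k
                  - laplacian_eigenvalue {1..n} r s (nsets {1..n} r) k\<bar>
                \<le> (3 + \<epsilon> n) * sqrt ((1 - p n) / (real ((n - s) choose (r - s)) * p n))})
       \<longlonglongrightarrow> 1)"
proof -
  have s: "1 \<le> s" "2 * s \<le> r" using assms(1,2) by auto
  define \<delta> where "\<delta> = (\<lambda>n. sqrt ((1 - p n) / (real ((n - s) choose (r - s)) * p n)))"
  \<comment> \<open>Both parts of the theorem follow pointwise from this one event; the second
    conjunct concerns only the complete hypergraph and gives the bound on \<open>lambda_bar\<close>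
    by the triangle inequality.\<close>
  define close where "close = (\<lambda>n E. \<forall>k\<in>{1..(n choose s) - 1}.
    \<bar>laplacian_eigenvalue {1..n} r s E k - laplacian_eigenvalue {1..n} r s (nsets {1..n} r) k\<bar> \<le> 3 * \<delta> n \<and>
    \<bar>1 - laplacian_eigenvalue {1..n} r s (nsets {1..n} r) k\<bar> \<le> real s / (real n - real s))"
  have ge: "\<forall>\<^sub>F n in sequentially. 1 - 7 / real n \<le> measure_pmf.prob (random_hypergraph r n (p n)) {E. close n E}"
    using eventually_prob_laplacian_eigenvalues_deviate[OF s assms(3,4)]
  proof eventually_elim
    case (elim n)
    define P where "P = bernoulli_edges (nsets {1..n} r) (p n)"
    define g where "g = (\<lambda>f. close n {e \<in> nsets {1..n} r. f e})"
    have "measure_pmf.prob (random_hypergraph r n (p n)) {E. close n E} = measure_pmf.prob P {f. g f}"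
      by (simp add: random_hypergraph_def P_def g_def vimage_def)
    also have "\<dots> = 1 - measure_pmf.prob P {f. \<not> g f}"
      using measure_pmf.prob_compl[of "{f. \<not> g f}" P] by (simp add: Compl_eq_Diff_UNIV[symmetric] Collect_neg_eq[symmetric])
    finally show ?case using elim by (simp add: P_def g_def close_def \<delta>_def)
  qed
  have concl: "(\<lambda>n. measure_pmf.prob (random_hypergraph r n (p n)) {E. Q n E}) \<longlonglongrightarrow> 1"
    if "\<forall>\<^sub>F n in sequentially. \<forall>E. close n E \<longrightarrow> Q n E" for Q
  proof (rule tendsto_1_of_eventually_ge)
    show "\<forall>\<^sub>F n in sequentially. 1 - 7 / real n \<le> measure_pmf.prob (random_hypergraph r n (p n)) {E. Q n E}"
      using ge that
    proof eventually_elim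
      case (elim n)
      have "measure_pmf.prob (random_hypergraph r n (p n)) {E. close n E} \<le> measure_pmf.prob (random_hypergraph r n (p n)) {E. Q n E}"
        using elim(2) by (intro measure_pmf.finite_measure_mono) auto
      with elim(1) show ?case by linarith
    qed
  qed (rule measure_pmf.prob_le_1)
  have "\<forall>\<^sub>F n in sequentially. \<forall>E. close n E \<longrightarrow>
      lambda_bar {1..n} r s E \<le> real s / (real n - real s) + 3 * \<delta> n"
    using eventually_ge_at_top[of "s + 2"]
  proof eventually_elim
    case (elim n)
    show ?case
    proof (intro allI impI)
      fix E assume E: "close n E"
      \<comment> \<open>Guarantees that \<open>Max\<close> in \<open>lambda_bar\<close> is taken
        over a nonempty set.\<close>
      have "s + 1 \<le> n choose s"
      proof -
        have "n \<le> n choose s" using s(1) elim by (intro upper_le_binomial) auto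
        then show ?thesis using elim by simp
      qed
      then have ne: "{1..(n choose s) - 1} \<noteq> {}" using s by simp
      have "\<bar>1 - laplacian_eigenvalue {1..n} r s E k\<bar> \<le> real s / (real n - real s) + 3 * \<delta> n"
        if "k \<in> {1..(n choose s) - 1}" for k
        using E that unfolding close_def by fastforce
      then show "lambda_bar {1..n} r s E \<le> real s / (real n - real s) + 3 * \<delta> n"
        using ne by (simp add: lambda_bar_def)
    qed
  qed
  from concl[OF this] have 1: "(\<lambda>n. measure_pmf.prob (random_hypergraph r n (p n))
      {E. lambda_bar {1..n} r s E \<le> real s / (real n - real s) + (3 + 0) * \<delta> n}) \<longlonglongrightarrow> 1" by simp
  have "\<forall>\<^sub>F n in sequentially. \<forall>E. close n E \<longrightarrow> (\<forall>k\<in>{1..(n choose s) - 1}.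
      \<bar>laplacian_eigenvalue {1..n} r s E k - laplacian_eigenvalue {1..n} r s (nsets {1..n} r) k\<bar> \<le> 3 * \<delta> n)"
    by (simp add: close_def)
  from concl[OF this] have 2: "(\<lambda>n. measure_pmf.prob (random_hypergraph r n (p n))
      {E. \<forall>k\<in>{1..(n choose s) - 1}.
        \<bar>laplacian_eigenvalue {1..n} r s E k - laplacian_eigenvalue {1..n} r s (nsets {1..n} r) k\<bar> \<le> (3 + 0) * \<delta> n}) \<longlonglongrightarrow> 1" by simp
  \<comment> \<open>The gap between 2 and 3 has absorbed all lower order terms, so the zero function
    is a witness for \<open>\<epsilon>\<close>.\<close>
  show ?thesis
    by (intro conjI exI[of _ "\<lambda>_. 0"]) (use 1 2 in \<open>simp_all add: \<delta>_def\<close>)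
qed

end
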